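(* The following decision problem is $\mathbf{NP}$-complete: given a $3$-regular graph $G$, decide whether $\eta(G)=2$.
   Context: All graphs are finite and simple. A lucky labeling of a graph $G$ is a function $\ell: V(G)\to\mathbb{N}$ such that for every two adjacent vertices $u,v$ of $G$ we have $\sum_{w\sim u}\ell(w)\neq\sum_{w\sim v}\ell(w)$, where $w\sim x$ means $w$ is adjacent to $x$. The lucky number $\eta(G)$ is the minimum positive integer $k$ such that $G$ has a lucky labeling $\ell: V(G)\to\{1,\dots,k\}$. A graph is $3$-regular if every vertex has degree $3$. *)

theory Defs
  imports
    "HOL-Computational_Algebra.Polynomial"
    "HOL-Library.Nat_Bijection"
    "Graph_Theory.Graph_Theory"
begin

section \<open>Deterministic multi-tape Turing machines\<close>

datatype move = MoveLeft | MoveStay | MoveRight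

text \<open>
  States are the numbers below \<open>tm_states\<close>, tape symbols the numbers below \<open>tm_symbols\<close>.
  Symbol 0 is the blank; symbols 1 and 2 represent the bits 0 and 1.
  The transition function maps a state and the scanned symbols (one per tape) to the new
  state and, for each tape, the symbol written and the head movement.
\<close>

record tm =
  tm_tapes :: nat
  tm_states :: nat
  tm_symbols :: nat
  tm_start :: nat
  tm_accept :: nat
  tm_reject :: nat
  tm_delta :: "nat \<Rightarrow> nat list \<Rightarrow> nat \<times> (nat \<times> move) list"

definition tm_wf :: "tm \<Rightarrow> bool" where
  "tm_wf M \<longleftrightarrow>
     0 < tm_tapes M \<and> 3 \<le> tm_symbols M \<and>
     tm_start M < tm_states M \<and> tm_accept M < tm_states M \<and> tm_reject M < tm_states M \<and>
     tm_accept M \<noteq> tm_reject M \<and>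
     (\<forall>q < tm_states M. \<forall>as. length as = tm_tapes M \<and> set as \<subseteq> {..<tm_symbols M} \<longrightarrow>
        (case tm_delta M q as of (q', acts) \<Rightarrow>
           q' < tm_states M \<and> length acts = tm_tapes M \<and>
           (\<forall>(b, m) \<in> set acts. b < tm_symbols M)))"

text \<open>A two-way infinite tape together with the head position.\<close>

type_synonym tape = "(int \<Rightarrow> nat) \<times> int"

type_synonym config = "nat \<times> tape list"

fun scan :: "tape \<Rightarrow> nat" where
  "scan (t, h) = t h"

fun move_head :: "move \<Rightarrow> int \<Rightarrow> int" where
  "move_head MoveLeft h = h - 1"
| "move_head MoveStay h = h"
| "move_head MoveRight h = h + 1"

fun act :: "nat \<times> move \<Rightarrow> tape \<Rightarrow> tape" where
  "act (b, m) (t, h) = (t(h := b), move_head m h)"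

definition halting :: "tm \<Rightarrow> nat \<Rightarrow> bool" where
  "halting M q \<longleftrightarrow> q = tm_accept M \<or> q = tm_reject M"

text \<open>
  Halted configurations are fixed points of \<open>step\<close>, so being in a halting state after
  \<open>n\<close> iterations means having halted within \<open>n\<close> steps.
\<close>

fun step :: "tm \<Rightarrow> config \<Rightarrow> config" where
  "step M (q, ts) =
     (if halting M q then (q, ts)
      else case tm_delta M q (map scan ts) of (q', acts) \<Rightarrow> (q', map2 act acts ts))"

definition bit_symbol :: "bool \<Rightarrow> nat" where
  "bit_symbol b = (if b then 2 else 1)"

definition string_cells :: "bool list \<Rightarrow> int \<Rightarrow> nat" where
  "string_cells x i = (if 0 \<le> i \<and> i < int (length x) then bit_symbol (x ! nat i) else 0)"

text \<open>Each input string is placed on a tape of its own; the remaining tapes are blank.\<close>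

definition init_config :: "tm \<Rightarrow> bool list list \<Rightarrow> config" where
  "init_config M xs =
     (tm_start M,
      map (\<lambda>x. (string_cells x, 0)) xs
        @ replicate (tm_tapes M - length xs) (string_cells [], 0))"

definition run :: "tm \<Rightarrow> bool list list \<Rightarrow> nat \<Rightarrow> config" where
  "run M xs n = (step M ^^ n) (init_config M xs)"

definition halts_within :: "tm \<Rightarrow> bool list list \<Rightarrow> nat \<Rightarrow> bool" where
  "halts_within M xs n \<longleftrightarrow> halting M (fst (run M xs n))"

definition accepts :: "tm \<Rightarrow> bool list list \<Rightarrow> bool" where
  "accepts M xs \<longleftrightarrow> (\<exists>n. fst (run M xs n) = tm_accept M)"

section \<open>NP-completeness\<close>

text \<open>The output is the complete contents of the last tape on halting.\<close>

definition polytime_computable :: "(bool list \<Rightarrow> bool list) \<Rightarrow> bool" where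
  "polytime_computable f \<longleftrightarrow>
     (\<exists>M (p :: nat poly). tm_wf M \<and>
        (\<forall>x. halts_within M [x] (poly p (length x)) \<and>
             fst (last (snd (run M [x] (poly p (length x))))) = string_cells (f x)))"

text \<open>
  Languages with polynomial-time verifiable certificates of polynomial length; the verifier
  gets the input on its first and the certificate on its second tape.
\<close>

definition NP :: "bool list set set" where
  "NP = {L. \<exists>M (p :: nat poly) (r :: nat poly). tm_wf M \<and> 2 \<le> tm_tapes M \<and>
          (\<forall>x u. halts_within M [x, u] (poly r (length x + length u))) \<and>
          (\<forall>x. x \<in> L \<longleftrightarrow> (\<exists>u. length u \<le> poly p (length x) \<and> accepts M [x, u]))}"

definition polytime_reducible :: "bool list set \<Rightarrow> bool list set \<Rightarrow> bool" where
  "polytime_reducible A B \<longleftrightarrow>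
     (\<exists>f. polytime_computable f \<and> (\<forall>x. x \<in> A \<longleftrightarrow> f x \<in> B))"

definition NP_complete :: "bool list set \<Rightarrow> bool" where
  "NP_complete L \<longleftrightarrow> L \<in> NP \<and> (\<forall>A \<in> NP. polytime_reducible A L)"

section \<open>Graphs and lucky labelings\<close>

text \<open>
  A finite simple graph is a \<open>pair_graph\<close>: finite, loop-free, with a symmetric arc relation.
  Hence the degree of a vertex is its \<open>out_degree\<close>.
\<close>

definition regular :: "nat \<Rightarrow> 'a pair_pre_digraph \<Rightarrow> bool" where
  "regular d G \<longleftrightarrow> (\<forall>v \<in> pverts G. out_degree (with_proj G) v = d)"

definition lucky_labeling :: "'a pair_pre_digraph \<Rightarrow> ('a \<Rightarrow> nat) \<Rightarrow> bool" where
  "lucky_labeling G l \<longleftrightarrow>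
     (\<forall>u v. (u, v) \<in> parcs G \<longrightarrow>
        (\<Sum>w | (w, u) \<in> parcs G. l w) \<noteq> (\<Sum>w | (w, v) \<in> parcs G. l w))"

definition lucky_number :: "'a pair_pre_digraph \<Rightarrow> nat" where
  "lucky_number G =
     (LEAST k. 0 < k \<and> (\<exists>l. lucky_labeling G l \<and> (\<forall>v \<in> pverts G. l v \<in> {1..k})))"

text \<open>The minimum defining the lucky number is always taken over a nonempty set.\<close>

lemma lucky_labeling_exists:
  assumes "pair_graph G"
  shows "\<exists>k>0. \<exists>l. lucky_labeling G l \<and> (\<forall>v \<in> pverts G. l v \<in> {1..k})"
proof -
  interpret pair_graph G by fact
  obtain f :: "_ \<Rightarrow> nat" where f: "inj_on f (pverts G)"
    using pair_finite_verts finite_imp_inj_to_nat_seg by blast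
  define l where "l = (\<lambda>v. (2::nat) ^ f v)"
  have sub: "{w. (w, u) \<in> parcs G} \<subseteq> pverts G" for u
    using in_arcsD1 by auto
  have enc: "(\<Sum>w | (w, u) \<in> parcs G. l w) = set_encode (f ` {w. (w, u) \<in> parcs G})" for u
    unfolding set_encode_def l_def
    by (subst sum.reindex) (use f sub in \<open>auto intro: inj_on_subset simp: comp_def\<close>)
  have "lucky_labeling G l"
    unfolding lucky_labeling_def
  proof (intro allI impI notI)
    fix u v
    assume uv: "(u, v) \<in> parcs G"
      and eq: "(\<Sum>w | (w, u) \<in> parcs G. l w) = (\<Sum>w | (w, v) \<in> parcs G. l w)"
    have fin: "finite (f ` {w. (w, x) \<in> parcs G})" for x
      using sub pair_finite_verts finite_subset by blast
    have "f ` {w. (w, u) \<in> parcs G} = f ` {w. (w, v) \<in> parcs G}"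
      using eq fin by (simp add: enc set_encode_eq)
    then have "{w. (w, u) \<in> parcs G} = {w. (w, v) \<in> parcs G}"
      using inj_on_image_eq_iff[OF f sub sub] by blast
    then have "(u, u) \<in> parcs G" using uv by blast
    then show False using pair_no_loops by fastforce
  qed
  moreover have "l v \<in> {1..Suc (\<Sum>w\<in>pverts G. l w)}" if "v \<in> pverts G" for v
    using that pair_finite_verts member_le_sum[of v "pverts G" l]
    by (auto simp: l_def intro: le_SucI)
  ultimately show ?thesis by blast
qed

section \<open>Graph problems as languages\<close>

text \<open>The number of vertices in unary, a separating 0, and the adjacency matrix row by row.\<close>

definition encode_graph :: "nat pair_pre_digraph \<Rightarrow> bool list" where
  "encode_graph G = (let n = card (pverts G) in
     replicate n True @ [False] @
     concat (map (\<lambda>i. map (\<lambda>j. (i, j) \<in> parcs G) [0..<n]) [0..<n]))"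

text \<open>
  Every finite simple graph is isomorphic to one with vertices \<open>0, \<dots>, n - 1\<close>, so it is
  enough to encode these.
\<close>

definition graph_problem :: "(nat pair_pre_digraph \<Rightarrow> bool) \<Rightarrow> bool list set" where
  "graph_problem P =
     {encode_graph G | G. pair_graph G \<and> pverts G = {..<card (pverts G)} \<and> P G}"

end

theory Submission
  imports Defs "HOL-Library.Countable_Set"
begin

text \<open>
  Membership in NP: a vertex set, the vertices labelled 2, is a certificate, and on a nonempty cubic graph
  the constant labeling is never lucky.

  Hardness: an accepting computation of a verifier, with tapes described relative to their heads, is a
  choice of one tile for every pair of a time and a tape position that avoids certain conflicts between two
  tiles. Hence it is a satisfying assignment of clauses that are either positive (some tile is
  chosen) or negative (two conflicting tiles are not both chosen). Subtracting 1 from the labels, a labeling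
  of a cubic graph by 1 and 2 becomes a 0/1-labeling with the same property. Two triangles sharing an edge
  (a diamond) then transport a bit, and four cores on eight vertices act as constraints on four such bits.
  Placing them on a torus whose rows are variables and whose columns are clauses gives a cubic graph that has
  a lucky 0/1-labeling iff the clauses are satisfiable. All the functions involved are built from arithmetic on
  numbers of polynomial size and bounded sums, and such functions are computed by Turing machines whose
  tapes serve as unary counters.
\<close>

section \<open>Counter programs on Turing machines\<close>

text \<open>Complementing all bits turns every 0/1-sum \<open>s\<close> in a cubic graph into
  \<open>3 - s\<close>, so luckiness is invariant under complementation and no gadget can fix the
  value of a single bit. Truth can therefore only mean agreement with a reference bit, which costs
  the torus an additional row. Closing rows and columns into cycles avoids vertices of lower degree
  at their ends, and the inversion of a bit on its way round a column is what forces a true literal.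
  Describing tapes relative to their heads keeps head positions out of the tiles: a move shifts a
  whole tape by at most one cell, so the transition relates tiles at distance at most one. The
  global information, state and scanned symbols, is copied into every tile of a row instead. The
  time bounds refer to concrete machines. Hence clauses, vertices and output bits are indexed by
  plain arithmetic and no data structure is ever stored: the reduction is a length together with a
  decidable predicate on output positions. Unary counters suffice because all these indices are
  polynomial in the input length.\<close>

datatype cmd = Inc nat | Dec nat | Out bool | Seq cmd cmd
  | Ite nat nat cmd cmd | While nat nat cmd

fun next_cmds :: "cmd list \<Rightarrow> (nat \<Rightarrow> nat) \<Rightarrow> cmd list" where
  "next_cmds (Seq a b # K) s = a # b # K"
| "next_cmds (Ite i v a b # K) s = (if s i = v then a else b) # K"
| "next_cmds (While i v c # K) s = (if s i = v then K else c # While i v c # K)"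
| "next_cmds K s = tl K"

fun cmd_move :: "cmd list \<Rightarrow> nat \<Rightarrow> move" where
  "cmd_move (Inc i # K) j = (if i = j then MoveRight else MoveStay)"
| "cmd_move (Dec i # K) j = (if i = j then MoveLeft else MoveStay)"
| "cmd_move K j = MoveStay"

fun emit :: "cmd list \<Rightarrow> bool list" where
  "emit (Out b # K) = [b]"
| "emit K = []"

text \<open>Tapes 0 and 1 hold the inputs; every other tape is a counter: its value is the position
  of the head, and the origin is marked so that zero can be recognised.\<close>

definition tape_cells :: "bool list \<times> bool list \<Rightarrow> nat \<Rightarrow> int \<Rightarrow> nat" where
  "tape_cells z i = (if i = 0 then string_cells (fst z) else if i = 1 then string_cells (snd z)
     else (\<lambda>p. if p = 0 then 1 else 0))"

type_synonym cmd_state = "cmd list \<times> (nat \<Rightarrow> int) \<times> bool list"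

fun cmd_step :: "bool list \<times> bool list \<Rightarrow> cmd_state \<Rightarrow> cmd_state" where
  "cmd_step z (K, h, w) = (next_cmds K (\<lambda>i. tape_cells z i (h i)),
     (\<lambda>j. move_head (cmd_move K j) (h j)), w @ emit K)"

text \<open>The stacks that occur between starting \<open>c\<close> on top of \<open>K\<close> and
  returning to \<open>K\<close>. They form a finite set, as a loop is put back unchanged below its
  body, and so can serve as states of a machine.\<close>

fun conts :: "cmd \<Rightarrow> cmd list \<Rightarrow> cmd list set" where
  "conts (Seq a b) K = insert (Seq a b # K) (conts a (b # K) \<union> conts b K)"
| "conts (Ite i v a b) K = insert (Ite i v a b # K) (conts a K \<union> conts b K)"
| "conts (While i v c) K = insert (While i v c # K) (conts c (While i v c # K))"
| "conts c K = {c # K}"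

fun width :: "cmd \<Rightarrow> nat" where
  "width (Seq a b) = max (width a) (width b)"
| "width (Ite i v a b) = max (Suc i) (max (width a) (width b))"
| "width (While i v c) = max (Suc i) (width c)"
| "width c = 0"

lemma finite_conts: "finite (conts c K)"
  by (induction c K rule: conts.induct) auto

lemma start_in_conts: "c # K \<in> conts c K"
  by (cases c) auto

lemma next_in_conts: "L \<in> conts c K \<Longrightarrow> next_cmds L s \<in> insert K (conts c K)"
proof (induction c arbitrary: K L)
  case (Seq a b)
  then show ?case using start_in_conts[of a "b # K"] start_in_conts[of b K] by fastforce
next
  case (Ite i v a b)
  from Ite.prems consider "L = Ite i v a b # K" | "L \<in> conts a K" | "L \<in> conts b K" by auto
  then show ?case
    by cases (use Ite.IH start_in_conts[of a K] start_in_conts[of b K] in auto)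
next
  case (While i v c)
  from While.prems consider "L = While i v c # K" | "L \<in> conts c (While i v c # K)" by auto
  then show ?case
    by cases (use While.IH start_in_conts[of c "While i v c # K"] in auto)
qed auto

lemma width_conts:
  assumes "L \<in> conts c K" "width c \<le> k" "\<forall>c' \<in> set K. width c' \<le> k"
  shows "\<forall>c' \<in> set L. width c' \<le> k"
  using assms
proof (induction c arbitrary: K L)
  case (Seq a b)
  from Seq.prems(1) consider "L = Seq a b # K" | "L \<in> conts a (b # K)" | "L \<in> conts b K" by auto
  then show ?case
  proof cases
    case 1 then show ?thesis using Seq.prems by auto
  next
    case 2 show ?thesis by (rule Seq.IH(1)[OF 2]) (use Seq.prems in auto)
  next
    case 3 show ?thesis by (rule Seq.IH(2)[OF 3]) (use Seq.prems in auto)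
  qed
next
  case (Ite i v a b)
  from Ite.prems(1) consider "L = Ite i v a b # K" | "L \<in> conts a K" | "L \<in> conts b K" by auto
  then show ?case
  proof cases
    case 1 then show ?thesis using Ite.prems by auto
  next
    case 2 show ?thesis by (rule Ite.IH(1)[OF 2]) (use Ite.prems in auto)
  next
    case 3 show ?thesis by (rule Ite.IH(2)[OF 3]) (use Ite.prems in auto)
  qed
next
  case (While i v c)
  from While.prems(1) consider "L = While i v c # K" | "L \<in> conts c (While i v c # K)" by auto
  then show ?case
  proof cases
    case 1 then show ?thesis using While.prems by auto
  next
    case 2 show ?thesis by (rule While.IH[OF 2]) (use While.prems in auto)
  qed
qed auto

lemma next_cmds_cong:
  assumes "\<forall>c \<in> set K. width c \<le> k" "\<And>i. i < k \<Longrightarrow> s i = s' i"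
  shows "next_cmds K s = next_cmds K s'"
  using assms by (cases "(K, s)" rule: next_cmds.cases) auto

lemma string_cells_snoc:
  "string_cells (w @ [b]) = (string_cells w)(int (length w) := bit_symbol b)"
  by (auto simp: string_cells_def fun_eq_iff nth_append nat_less_iff)

lemma step_halted_iterate:
  "halting M (fst c) \<Longrightarrow> (step M ^^ n) c = c"
  by (induction n) (cases c; auto)+

lemma run_stable:
  assumes "halting M (fst (run M xs m))" "m \<le> n"
  shows "run M xs n = run M xs m"
proof -
  have "run M xs n = (step M ^^ (n - m)) (run M xs m)"
    using assms(2) by (simp add: run_def flip: funpow_add[THEN fun_cong, unfolded comp_def])
  then show ?thesis using step_halted_iterate[OF assms(1)] by simp
qed

text \<open>The machine marks the origins of its counters, simulates the command step by step, its
  states being the finitely many continuations, and accepts iff counter 2 ends up positive.\<close>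

lemma machine_for_cmd:
  "\<exists>M. tm_wf M \<and> 2 \<le> tm_tapes M \<and>
    (\<forall>x u t h w n. (cmd_step (x, u) ^^ t) ([prog], \<lambda>_. 0, []) = ([], h, w) \<longrightarrow> t + 2 \<le> n \<longrightarrow>
       fst (run M [x, u] n) = (if h 2 = 0 then tm_reject M else tm_accept M) \<and>
       fst (last (snd (run M [x, u] n))) = string_cells w) \<and>
    (\<forall>x n. run M [x] n = run M [x, []] n)"
proof -
  define S where "S = insert [] (conts prog [])"
  \<comment> \<open>Tapes below \<open>k\<close> are the inputs and counters, tape \<open>k\<close>
    takes the output. The minimum 3 provides counter 2, from which the verdict is read.\<close>
  define k where "k = max 3 (width prog)"
  have "finite S" by (simp add: S_def finite_conts)
  then obtain num where num: "bij_betw num S {0..<card S}"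
    using ex_bij_betw_finite_nat by blast
  define dec where "dec = inv_into S num"
  have dec_in: "dec q \<in> S" if "q < card S" for q
    using num that unfolding dec_def by (intro inv_into_into) (auto simp: bij_betw_def)
  have dec_num: "dec (num K) = K" if "K \<in> S" for K
    using num that unfolding dec_def by (auto simp: bij_betw_def intro: inv_into_f_f)
  have num_less: "num K < card S" if "K \<in> S" for K
    using num that by (auto simp: bij_betw_def)
  have cS: "0 < card S" using \<open>finite S\<close> by (auto simp: S_def card_gt_0_iff)
  have next_in: "next_cmds K s \<in> S" if "K \<in> S" for K s
    using that next_in_conts by (cases "K = []") (auto simp: S_def)
  have wS: "\<forall>c \<in> set K. width c \<le> k" if "K \<in> S" for K
    using that width_conts[of K prog "[]" k] by (auto simp: S_def k_def)
  have k3: "3 \<le> k" by (simp add: k_def)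
  \<comment> \<open>State 0 marks the origins, 1 and 2 are the verdicts, and
    \<open>3 + num K\<close> stands for the stack \<open>K\<close>. On the empty stack a blank under
    head 2 means that this head is off the origin, that is, accept.\<close>
  define delta :: "nat \<Rightarrow> nat list \<Rightarrow> nat \<times> (nat \<times> move) list" where
    "delta q as = (let K = dec (q - 3) in
      if q = 0 then (3 + num [prog],
         map (\<lambda>i. (if 2 \<le> i \<and> i < k then 1 else as ! i, MoveStay)) [0..<Suc k])
      else if K = [] then (if as ! 2 = 0 then 1 else 2, map (\<lambda>i. (as ! i, MoveStay)) [0..<Suc k])
      else (3 + num (next_cmds K (\<lambda>i. as ! i)),
         map (\<lambda>i. if i < k then (as ! i, cmd_move K i) else
           if emit K = [] then (as ! i, MoveStay) else (bit_symbol (hd (emit K)), MoveRight)) [0..<Suc k]))"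
    for q as
  define M where "M = \<lparr>tm_tapes = Suc k, tm_states = 3 + card S, tm_symbols = 3, tm_start = 0,
    tm_accept = 1, tm_reject = 2, tm_delta = delta\<rparr>"
  have M_simps: "tm_tapes M = Suc k" "tm_states M = 3 + card S" "tm_symbols M = 3"
    "tm_start M = 0" "tm_accept M = 1" "tm_reject M = 2" "tm_delta M = delta"
    by (simp_all add: M_def)
  have prog_in: "[prog] \<in> S" by (simp add: S_def start_in_conts)
  have "tm_wf M"
    unfolding tm_wf_def M_simps
  proof (intro conjI allI impI)
    fix q as assume q: "q < 3 + card S" and as: "length as = Suc k \<and> set as \<subseteq> {..<3::nat}"
    have K: "dec (q - 3) \<in> S" using q cS by (intro dec_in) linarith
    have asi: "as ! i < 3" if "i < Suc k" for i
      using as that nth_mem[of i as] by (metis lessThan_iff subsetD)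
    show "case delta q as of (q', acts) \<Rightarrow> q' < 3 + card S \<and> length acts = Suc k \<and>
        (\<forall>(b, m) \<in> set acts. b < 3)"
      unfolding delta_def Let_def
      using asi num_less[OF prog_in] num_less[OF next_in[OF K]]
      by (auto simp: bit_symbol_def less_Suc_eq split: if_splits)
  qed auto
  define tapes where "tapes z h w = map (\<lambda>i. (tape_cells z i, h i)) [0..<k]
      @ [(string_cells w, int (length w))]" for z h w
  define cfg where "cfg z s = (case s of (K, h, w) \<Rightarrow> (3 + num K, tapes z h w))" for z s
  have len: "length (tapes z h w) = Suc k" for z h w by (simp add: tapes_def)
  have nth_tapes: "tapes z h w ! i = (if i < k then (tape_cells z i, h i) else (string_cells w, int (length w)))"
    if "i < Suc k" for z h w i
    using that by (auto simp: tapes_def nth_append)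
  have sim: "step M (cfg z (K, h, w)) = cfg z (cmd_step z (K, h, w))" if K: "K \<in> S" "K \<noteq> []" for z K h w
  proof -
    let ?as = "map scan (tapes z h w)"
    have as: "?as ! i = tape_cells z i (h i)" if "i < k" for i
      using that by (simp add: len nth_tapes)
    have ask: "?as ! k = 0" by (simp add: len nth_tapes string_cells_def)
    have nx: "next_cmds K (\<lambda>i. ?as ! i) = next_cmds K (\<lambda>i. tape_cells z i (h i))"
      by (rule next_cmds_cong[OF wS[OF K(1)]]) (use as in auto)
    have blank: "(string_cells w)(int (length w) := 0) = string_cells w"
      by (auto simp: string_cells_def fun_eq_iff)
    have em: "emit K = [] \<or> (\<exists>b. emit K = [b])"
      by (cases K rule: emit.cases) auto
    have upd: "(tape_cells z i)(h i := tape_cells z i (h i)) = tape_cells z i" for i by simp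
    have "delta (3 + num K) ?as = (3 + num (next_cmds K (\<lambda>i. tape_cells z i (h i))),
      map (\<lambda>i. if i < k then (?as ! i, cmd_move K i) else
           if emit K = [] then (?as ! i, MoveStay) else (bit_symbol (hd (emit K)), MoveRight)) [0..<Suc k])"
      (is "_ = (_, ?acts)")
      using K by (simp add: delta_def Let_def dec_num nx del: upt_Suc)
    moreover have "map2 act ?acts (tapes z h w) =
       tapes z (\<lambda>j. move_head (cmd_move K j) (h j)) (w @ emit K)"
    proof (rule nth_equalityI)
      fix i assume "i < length (map2 act ?acts (tapes z h w))"
      then have i: "i < Suc k" by (simp add: len)
      show "map2 act ?acts (tapes z h w) ! i =
         tapes z (\<lambda>j. move_head (cmd_move K j) (h j)) (w @ emit K) ! i"
      proof (cases "i < k")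
        case True
        then show ?thesis using i as[OF True] by (simp add: len nth_tapes upd del: upt_Suc)
      next
        case False
        then have "i = k" using i by simp
        then show ?thesis using em ask blank
          by (auto simp: len nth_tapes string_cells_snoc simp del: upt_Suc)
      qed
    qed (simp add: len)
    ultimately show ?thesis
      by (simp add: cfg_def halting_def M_simps)
  qed
  have sims: "(step M ^^ t) (cfg z s) = cfg z ((cmd_step z ^^ t) s)"
    if s: "fst s \<in> S" and running: "\<forall>t'<t. fst ((cmd_step z ^^ t') s) \<noteq> []" for z s t
  proof -
    have "(step M ^^ t') (cfg z s) = cfg z ((cmd_step z ^^ t') s) \<and> fst ((cmd_step z ^^ t') s) \<in> S"
      if "t' \<le> t" for t'
      using that
    proof (induction t')
      case 0 then show ?case using s by simp
    next
      case (Suc t')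
      obtain K h w where s': "(cmd_step z ^^ t') s = (K, h, w)" by (metis prod_cases3)
      have "K \<noteq> []" using running Suc.prems s' by (metis Suc_le_lessD fst_conv)
      then show ?case using Suc s' sim[of K z h w] next_in by auto
    qed
    then show ?thesis by blast
  qed
  have start: "step M (init_config M [x, u]) = cfg (x, u) ([prog], \<lambda>_. 0, [])" for x u
  proof -
    let ?ts = "snd (init_config M [x, u])"
    have ts: "?ts = (string_cells x, 0) # (string_cells u, 0) # replicate (k - 1) (string_cells [], 0)"
      by (simp add: init_config_def M_simps)
    have lt: "length ?ts = Suc k" using k3 by (simp add: ts)
    have nt: "?ts ! i = (if i = 0 then (string_cells x, 0) else if i = 1 then (string_cells u, 0)
       else (string_cells [], 0))" if "i < Suc k" for i
      using that k3 by (auto simp: ts nth_Cons split: nat.splits)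
    have "map2 act (map (\<lambda>i. (if 2 \<le> i \<and> i < k then 1 else map scan ?ts ! i, MoveStay)) [0..<Suc k]) ?ts
        = tapes (x, u) (\<lambda>_. 0) []"
    proof (rule nth_equalityI)
      fix i assume "i < length (map2 act (map (\<lambda>i. (if 2 \<le> i \<and> i < k then 1 else map scan ?ts ! i, MoveStay)) [0..<Suc k]) ?ts)"
      then have i: "i < Suc k" by (simp add: lt)
      then show "map2 act (map (\<lambda>i. (if 2 \<le> i \<and> i < k then 1 else map scan ?ts ! i, MoveStay)) [0..<Suc k]) ?ts ! i
        = tapes (x, u) (\<lambda>_. 0) [] ! i"
        using k3 nt[of i]
        by (cases "i = k") (auto simp: lt nth_tapes tape_cells_def string_cells_def fun_eq_iff
            simp del: upt_Suc)
    qed (simp add: lt len)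
    moreover have "init_config M [x, u] = (0, ?ts)" by (simp add: init_config_def M_simps)
    then have "step M (init_config M [x, u]) = step M (0, ?ts)" by simp
    ultimately show ?thesis
      by (simp add: cfg_def M_simps halting_def delta_def del: upt_Suc)
  qed
  have main: "fst (run M [x, u] n) = (if h 2 = 0 then tm_reject M else tm_accept M) \<and>
       fst (last (snd (run M [x, u] n))) = string_cells w"
    if ex: "(cmd_step (x, u) ^^ t) ([prog], \<lambda>_. 0, []) = ([], h, w)" and n: "t + 2 \<le> n" for x u t h w n
  proof -
    let ?s = "([prog], \<lambda>_. 0 :: int, [])"
    \<comment> \<open>\<open>cmd_step\<close> idles on the empty stack while the machine goes on to
      its verdict, so the simulation is stopped at the first time the stack is empty.\<close>
    define t0 where "t0 = (LEAST t. fst ((cmd_step (x, u) ^^ t) ?s) = [])"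
    have t0: "fst ((cmd_step (x, u) ^^ t0) ?s) = []"
      unfolding t0_def by (rule LeastI[of _ t]) (simp add: ex)
    have t0le: "t0 \<le> t" unfolding t0_def by (rule Least_le) (simp add: ex)
    have t0min: "\<forall>t'<t0. fst ((cmd_step (x, u) ^^ t') ?s) \<noteq> []"
      using not_less_Least unfolding t0_def by blast
    obtain h0 w0 where s0: "(cmd_step (x, u) ^^ t0) ?s = ([], h0, w0)"
      using t0 by (metis prod_cases3 fst_conv)
    have fix0: "(cmd_step (x, u) ^^ m) ([], h0, w0) = ([], h0, w0)" for m
      by (induction m) auto
    have "(cmd_step (x, u) ^^ t) ?s = (cmd_step (x, u) ^^ (t - t0)) ((cmd_step (x, u) ^^ t0) ?s)"
      using t0le by (simp flip: funpow_add[THEN fun_cong, unfolded comp_def])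
    then have hw: "h0 = h" "w0 = w" using ex s0 fix0 by auto
    have "run M [x, u] (Suc t0) = (step M ^^ t0) (cfg (x, u) ?s)"
      by (simp add: run_def funpow_Suc_right start del: funpow.simps(2))
    also have "\<dots> = cfg (x, u) ([], h, w)"
      using sims[of ?s t0 "(x, u)"] prog_in t0min s0 hw by simp
    finally have r1: "run M [x, u] (Suc t0) = cfg (x, u) ([], h, w)" .
    have empty_in: "[] \<in> S" by (simp add: S_def)
    let ?ts = "tapes (x, u) h w"
    have "run M [x, u] (Suc (Suc t0)) = step M (run M [x, u] (Suc t0))"
      by (simp add: run_def)
    also have "\<dots> = (if map scan ?ts ! 2 = 0 then 1 else 2,
        map2 act (map (\<lambda>i. (map scan ?ts ! i, MoveStay)) [0..<Suc k]) ?ts)"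
      by (simp add: r1 cfg_def halting_def M_simps delta_def dec_num[OF empty_in] del: upt_Suc)
    also have "map2 act (map (\<lambda>i. (map scan ?ts ! i, MoveStay)) [0..<Suc k]) ?ts = ?ts"
      by (rule nth_equalityI) (auto simp: len nth_tapes less_Suc_eq fun_eq_iff simp del: upt_Suc)
    finally have r2: "run M [x, u] (Suc (Suc t0)) = (if map scan ?ts ! 2 = 0 then 1 else 2, ?ts)" .
    have "map scan ?ts ! 2 = 0 \<longleftrightarrow> h 2 \<noteq> 0"
      using k3 by (simp add: len nth_tapes tape_cells_def)
    then have r3: "run M [x, u] (Suc (Suc t0)) = (if h 2 = 0 then tm_reject M else tm_accept M, ?ts)"
      using r2 by (simp add: M_simps)
    then have "run M [x, u] n = run M [x, u] (Suc (Suc t0))"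
      using n t0le by (intro run_stable) (auto simp: halting_def)
    then show ?thesis using r3 by (simp add: tapes_def)
  qed
  \<comment> \<open>A missing second input is a blank tape, which is also the tape of the empty
    string. So the same machines compute functions of one string.\<close>
  have "run M [x] n = run M [x, []] n" for x n
  proof -
    have "k = Suc (k - 1)" using k3 by simp
    then have "init_config M [x] = init_config M [x, []]"
      by (simp add: init_config_def M_simps) (metis replicate_Suc)
    then show ?thesis by (simp add: run_def)
  qed
  then show ?thesis using \<open>tm_wf M\<close> main k3 by (intro exI[of _ M]) (simp add: M_simps)
qed

section \<open>Execution of counter programs with time bounds\<close>

text \<open>The number of steps is the same for every stack \<open>K\<close> below, which makes the
  judgement compose. Registers are natural numbers, hence head positions that never lie left of the
  origin.\<close>

definition exec :: "bool list \<times> bool list \<Rightarrow> cmd \<Rightarrow> (nat \<Rightarrow> nat) \<Rightarrow> bool list \<Rightarrow> nat \<Rightarrow>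
    (nat \<Rightarrow> nat) \<Rightarrow> bool list \<Rightarrow> bool" where
  "exec z c e w T e' w' \<longleftrightarrow>
     (\<exists>t\<le>T. \<forall>K. (cmd_step z ^^ t) (c # K, int \<circ> e, w) = (K, int \<circ> e', w'))"

lemma execI: "(\<And>K. (cmd_step z ^^ t) (c # K, int \<circ> e, w) = (K, int \<circ> e', w')) \<Longrightarrow> exec z c e w t e' w'"
  by (auto simp: exec_def)

lemma exec_mono: "exec z c e w T e' w' \<Longrightarrow> T \<le> T' \<Longrightarrow> exec z c e w T' e' w'"
  unfolding exec_def by (meson order_trans)

lemma exec_conv: "exec z c e w T e' w' \<Longrightarrow> T \<le> T' \<Longrightarrow> e' = e'' \<Longrightarrow> exec z c e w T' e'' w'"
  using exec_mono by blast

lemma exec_Inc: "exec z (Inc i) e w 1 (e(i := Suc (e i))) w"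
  by (rule execI) (auto simp: fun_eq_iff)

lemma exec_Dec: "0 < e i \<Longrightarrow> exec z (Dec i) e w 1 (e(i := e i - 1)) w"
  by (rule execI) (auto simp: fun_eq_iff)

lemma exec_Out: "exec z (Out b) e w 1 e (w @ [b])"
  by (rule execI) (auto simp: fun_eq_iff)

lemma exec_Seq:
  assumes "exec z a e w T e' w'" "exec z b e' w' T' e'' w''"
  shows "exec z (Seq a b) e w (Suc (T + T')) e'' w''"
proof -
  obtain t where t: "t \<le> T" "\<And>K. (cmd_step z ^^ t) (a # K, int \<circ> e, w) = (K, int \<circ> e', w')"
    using assms(1) by (auto simp: exec_def)
  obtain t' where t': "t' \<le> T'" "\<And>K. (cmd_step z ^^ t') (b # K, int \<circ> e', w') = (K, int \<circ> e'', w'')"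
    using assms(2) by (auto simp: exec_def)
  have one: "cmd_step z (Seq a b # K, int \<circ> e, w) = (a # b # K, int \<circ> e, w)" for K by (simp add: fun_eq_iff)
  have "(cmd_step z ^^ (Suc (t' + t))) (Seq a b # K, int \<circ> e, w) = (K, int \<circ> e'', w'')" for K
    unfolding funpow_Suc_right comp_apply one funpow_add t(2) t'(2) ..
  then have "exec z (Seq a b) e w (Suc (t' + t)) e'' w''" by (rule execI)
  then show ?thesis by (rule exec_mono) (use t t' in simp)
qed

lemma exec_step:
  assumes one: "\<And>K. cmd_step z (c # K, int \<circ> e, w) = (L @ K, int \<circ> e, w)"
    and t: "\<And>K. (cmd_step z ^^ t) (L @ K, int \<circ> e, w) = (K, int \<circ> e', w')"
  shows "exec z c e w (Suc t) e' w'"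
  by (rule execI) (simp only: funpow_Suc_right comp_apply one t)

lemma exec_Ite:
  assumes "exec z (if tape_cells z i (int (e i)) = v then a else b) e w T e' w'"
  shows "exec z (Ite i v a b) e w (Suc T) e' w'"
proof -
  define c where "c = (if tape_cells z i (int (e i)) = v then a else b)"
  obtain t where t: "t \<le> T" "\<And>K. (cmd_step z ^^ t) (c # K, int \<circ> e, w) = (K, int \<circ> e', w')"
    using assms by (auto simp: exec_def c_def)
  have "exec z (Ite i v a b) e w (Suc t) e' w'"
    by (rule exec_step[where L = "[c]"]) (simp_all add: c_def t(2)[unfolded c_def] fun_eq_iff)
  then show ?thesis by (rule exec_mono) (use t in simp)
qed

lemma exec_While_stop:
  assumes "tape_cells z i (int (e i)) = v"
  shows "exec z (While i v c) e w 1 e w"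
  using assms by (intro execI) (simp add: fun_eq_iff)

lemma exec_While_go:
  assumes "tape_cells z i (int (e i)) \<noteq> v" "exec z c e w T e' w'" "exec z (While i v c) e' w' T' e'' w''"
  shows "exec z (While i v c) e w (Suc (T + T')) e'' w''"
proof -
  obtain t where t: "t \<le> T" "\<And>K. (cmd_step z ^^ t) (c # K, int \<circ> e, w) = (K, int \<circ> e', w')"
    using assms(2) by (auto simp: exec_def)
  obtain t' where t': "t' \<le> T'" "\<And>K. (cmd_step z ^^ t') (While i v c # K, int \<circ> e', w') = (K, int \<circ> e'', w'')"
    using assms(3) by (auto simp: exec_def)
  have "exec z (While i v c) e w (Suc (t' + t)) e'' w''"
  proof (rule exec_step)
    show "cmd_step z (While i v c # K, int \<circ> e, w) = ([c, While i v c] @ K, int \<circ> e, w)" for K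
      using assms(1) by (simp add: fun_eq_iff)
    show "(cmd_step z ^^ (t' + t)) ([c, While i v c] @ K, int \<circ> e, w) = (K, int \<circ> e'', w'')" for K
      by (simp only: funpow_add comp_apply append.simps t(2) t'(2))
  qed
  then show ?thesis by (rule exec_mono) (use t t' in simp)
qed

lemma exec_While:
  assumes "\<And>m. m < n \<Longrightarrow> tape_cells z i (int (E m i)) \<noteq> v"
    and "\<And>m. m < n \<Longrightarrow> exec z c (E m) (W m) T (E (Suc m)) (W (Suc m))"
    and "tape_cells z i (int (E n i)) = v"
  shows "exec z (While i v c) (E 0) (W 0) (Suc (n * Suc T)) (E n) (W n)"
  using assms
proof (induction n arbitrary: E W)
  case 0
  then show ?case using exec_While_stop by simp
next
  case (Suc n)
  have "exec z (While i v c) (E (Suc 0)) (W (Suc 0)) (Suc (n * Suc T)) (E (Suc n)) (W (Suc n))"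
    using Suc.IH[of "\<lambda>m. E (Suc m)" "\<lambda>m. W (Suc m)"] Suc.prems by auto
  then have "exec z (While i v c) (E 0) (W 0) (Suc (T + Suc (n * Suc T))) (E (Suc n)) (W (Suc n))"
    using Suc.prems by (intro exec_While_go) auto
  then show ?case by (rule exec_mono) simp
qed

lemma counter_zero: "2 \<le> i \<Longrightarrow> tape_cells z i p = 1 \<longleftrightarrow> p = 0"
  by (auto simp: tape_cells_def)

lemma counter_zero': "2 \<le> i \<Longrightarrow> tape_cells z i p = Suc 0 \<longleftrightarrow> p = 0"
  by (auto simp: tape_cells_def)

text \<open>Symbol 1 is the origin mark, so \<open>While i 1\<close> runs until counter
  \<open>i\<close> is 0: the counted loop behind all later programs. \<open>E\<close> and
  \<open>W\<close> list the registers and the output after each round.\<close>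

lemma exec_count_down:
  assumes "2 \<le> i" "\<And>m. m \<le> n \<Longrightarrow> E m i = n - m"
    and "\<And>m. m < n \<Longrightarrow> exec z c (E m) (W m) T (E (Suc m)) (W (Suc m))"
    and "e = E 0" "w = W 0"
  shows "exec z (While i 1 c) e w (Suc (n * Suc T)) (E n) (W n)"
  unfolding assms(4,5)
proof (rule exec_While)
  show "tape_cells z i (int (E m i)) \<noteq> 1" if "m < n" for m
    using counter_zero[OF assms(1)] assms(2)[of m] that by auto
  show "tape_cells z i (int (E n i)) = 1"
    using counter_zero[OF assms(1)] assms(2)[of n] by auto
qed (rule assms(3))

section \<open>Functions computable with polynomially bounded values and time\<close>

text \<open>From base 2 on, pure powers absorb constants, sums and products, so a single exponent
  replaces a polynomial.\<close>

definition poly_bounded :: "(nat \<Rightarrow> nat) \<Rightarrow> bool" where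
  "poly_bounded T \<longleftrightarrow> (\<exists>k. \<forall>B\<ge>2. T B \<le> B ^ k)"

lemma poly_bounded_const: "poly_bounded (\<lambda>B. c)"
  unfolding poly_bounded_def
proof (intro exI allI impI)
  fix B :: nat assume "2 \<le> B"
  have "c \<le> 2 ^ c" by (simp add: less_exp order.strict_implies_order)
  also have "\<dots> \<le> B ^ c" using \<open>2 \<le> B\<close> by (rule power_mono) simp
  finally show "c \<le> B ^ c" .
qed

lemma poly_bounded_id: "poly_bounded (\<lambda>B. B)"
  unfolding poly_bounded_def by (rule exI[of _ 1]) simp

lemma poly_bounded_mult:
  assumes "poly_bounded S" "poly_bounded T" shows "poly_bounded (\<lambda>B. S B * T B)"
proof -
  from assms obtain k l where "\<forall>B\<ge>2. S B \<le> B ^ k" "\<forall>B\<ge>2. T B \<le> B ^ l" by (auto simp: poly_bounded_def)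
  then have "\<forall>B\<ge>2. S B * T B \<le> B ^ (k + l)" by (simp add: power_add mult_le_mono)
  then show ?thesis unfolding poly_bounded_def by blast
qed

lemma poly_bounded_add:
  assumes "poly_bounded S" "poly_bounded T" shows "poly_bounded (\<lambda>B. S B + T B)"
proof -
  from assms obtain k l where kl: "\<forall>B\<ge>2. S B \<le> B ^ k" "\<forall>B\<ge>2. T B \<le> B ^ l" by (auto simp: poly_bounded_def)
  have "S B + T B \<le> B ^ Suc (max k l)" if "2 \<le> B" for B
  proof -
    have "S B \<le> B ^ max k l" "T B \<le> B ^ max k l"
      using kl that by (meson order_trans power_increasing max.cobounded1 max.cobounded2 one_le_numeral)+
    then have "S B + T B \<le> 2 * B ^ max k l" by simp
    also have "\<dots> \<le> B * B ^ max k l" using that by (rule mult_le_mono1)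
    finally show ?thesis by simp
  qed
  then show ?thesis unfolding poly_bounded_def by blast
qed

lemma poly_bounded_Suc: "poly_bounded S \<Longrightarrow> poly_bounded (\<lambda>B. Suc (S B))"
  using poly_bounded_add[OF poly_bounded_const[of 1]] by simp

text \<open>The argument \<open>B + T B\<close> is the bound for the variables inside a loop, where
  a loop variable of size up to \<open>T B\<close> has joined those bounded by
  \<open>B\<close>.\<close>

lemma poly_bounded_comp:
  assumes "poly_bounded S" "poly_bounded T" shows "poly_bounded (\<lambda>B. S (B + T B))"
proof -
  from poly_bounded_add[OF poly_bounded_id assms(2)] assms(1) obtain k l where
    kl: "\<forall>B\<ge>2. S B \<le> B ^ k" "\<forall>B\<ge>2. B + T B \<le> B ^ l" by (auto simp: poly_bounded_def)
  have "S (B + T B) \<le> B ^ (l * k)" if "2 \<le> B" for B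
  proof -
    have "S (B + T B) \<le> (B + T B) ^ k" using kl(1) that by simp
    also have "\<dots> \<le> (B ^ l) ^ k" using kl(2) that by (intro power_mono) auto
    finally show ?thesis by (simp add: power_mult)
  qed
  then show ?thesis unfolding poly_bounded_def by blast
qed

lemmas poly_bounded_intros = poly_bounded_const poly_bounded_id poly_bounded_mult poly_bounded_add
  poly_bounded_Suc poly_bounded_comp

text \<open>The summand 2 keeps \<open>B\<close> in the range where \<open>poly_bounded\<close> says
  something.\<close>

definition input_bound :: "bool list \<times> bool list \<Rightarrow> nat list \<Rightarrow> nat \<Rightarrow> bool" where
  "input_bound z vs B \<longleftrightarrow> length (fst z) + length (snd z) + 2 \<le> B \<and> (\<forall>v \<in> set vs. v \<le> B)"

text \<open>The first argument of a definable function is the pair of input strings, the second is the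
  list of the values of the free variables. The parameters of \<open>computes_at\<close> are the
  registers of these variables and the result register; all higher registers are scratch.\<close>

definition computes_at :: "(bool list \<times> bool list \<Rightarrow> nat list \<Rightarrow> nat) \<Rightarrow> nat list \<Rightarrow> nat \<Rightarrow> cmd \<Rightarrow>
    (nat \<Rightarrow> nat) \<Rightarrow> bool" where
  "computes_at f rs r c T \<longleftrightarrow> (\<forall>z e w B. (\<forall>j. r \<le> j \<or> j < 2 \<longrightarrow> e j = 0) \<longrightarrow> input_bound z (map e rs) B
      \<longrightarrow> exec z c e w (T B) (e(r := f z (map e rs))) w)"

text \<open>The bound on the values is kept next to the program since values become loop counts of
  larger programs. Programs are given for all register assignments, so closure lemmas can place
  intermediate results above the registers in use.\<close>

definition computable :: "nat \<Rightarrow> (bool list \<times> bool list \<Rightarrow> nat list \<Rightarrow> nat) \<Rightarrow> bool" where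
  "computable d f \<longleftrightarrow>
     (\<exists>G. poly_bounded G \<and> (\<forall>z vs B. length vs = d \<longrightarrow> input_bound z vs B \<longrightarrow> f z vs \<le> G B)) \<and>
     (\<forall>rs r. length rs = d \<longrightarrow> set rs \<subseteq> {2..<r} \<longrightarrow> 2 \<le> r \<longrightarrow>
        (\<exists>c T. poly_bounded T \<and> computes_at f rs r c T))"

lemma computableI:
  assumes "poly_bounded G" "\<And>z vs B. length vs = d \<Longrightarrow> input_bound z vs B \<Longrightarrow> f z vs \<le> G B"
    and "\<And>rs r. length rs = d \<Longrightarrow> set rs \<subseteq> {2..<r} \<Longrightarrow> 2 \<le> r \<Longrightarrow> \<exists>c T. poly_bounded T \<and> computes_at f rs r c T"
  shows "computable d f"
  using assms unfolding computable_def by blast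

lemma computable_bound:
  assumes "computable d f"
  obtains G where "poly_bounded G" "\<And>z vs B. length vs = d \<Longrightarrow> input_bound z vs B \<Longrightarrow> f z vs \<le> G B"
  using assms unfolding computable_def by blast

lemma computable_cmd:
  assumes "computable d f" "length rs = d" "set rs \<subseteq> {2..<r}" "2 \<le> r"
  obtains c T where "poly_bounded T" "computes_at f rs r c T"
  using assms unfolding computable_def by blast

lemma computes_at_exec:
  assumes "computes_at f rs r c T" "\<And>j. r \<le> j \<or> j < 2 \<Longrightarrow> e j = 0" "map e rs = vs" "input_bound z vs B"
  shows "exec z c e w (T B) (e(r := f z vs)) w"
  using assms unfolding computes_at_def by blast

lemma regs_fresh: "set rs \<subseteq> {2..<r} \<Longrightarrow> (r::nat) \<le> j \<Longrightarrow> j \<notin> set rs"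
  by auto

lemma computable_const: "computable d (\<lambda>z vs. c)"
proof (rule computableI[OF poly_bounded_const[of c]])
  fix rs :: "nat list" and r :: nat assume rs: "length rs = d" "set rs \<subseteq> {2..<r}" "2 \<le> r"
  have "\<exists>p T. \<forall>z e w. e r = 0 \<longrightarrow> exec z p e w T (e(r := c)) w"
  proof (induction c)
    case 0
    \<comment> \<open>There is no skip command; a loop on a counter that is 0 takes its
      place.\<close>
    have "exec z (While r 1 (Inc r)) e w 1 (e(r := 0)) w" if "e r = 0" for z e w
    proof -
      have "exec z (While r 1 (Inc r)) e w 1 e w"
        using rs that by (intro exec_While_stop) (simp add: counter_zero')
      moreover have "e(r := 0) = e" using that by auto
      ultimately show ?thesis by simp
    qed
    then show ?case by blast
  next
    case (Suc c)
    then obtain p T where p: "\<And>z e w. e r = 0 \<Longrightarrow> exec z p e w T (e(r := c)) w" by blast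
    have "exec z (Seq p (Inc r)) e w (Suc (T + 1)) (e(r := Suc c)) w" if "e r = 0" for z e w
      by (rule exec_conv[OF exec_Seq[OF p[of e, OF that] exec_Inc]]) auto
    then show ?case by blast
  qed
  then obtain p T where "\<And>z e w. e r = 0 \<Longrightarrow> exec z p e w T (e(r := c)) w" by blast
  then have "computes_at (\<lambda>z vs. c) rs r p (\<lambda>B. T)" by (auto simp: computes_at_def)
  then show "\<exists>p T. poly_bounded T \<and> computes_at (\<lambda>z vs. c) rs r p T"
    using poly_bounded_const by blast
qed simp

lemma computable_var:
  assumes "i < d" shows "computable d (\<lambda>z vs. vs ! i)"
proof (rule computableI[OF poly_bounded_id])
  show "vs ! i \<le> B" if "length vs = d" "input_bound z vs B" for z vs B
    using that assms by (auto simp: input_bound_def)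
  fix rs :: "nat list" and r :: nat assume rs: "length rs = d" "set rs \<subseteq> {2..<r}" "2 \<le> r"
  define q where "q = rs ! i"
  have q: "q \<in> set rs" using assms rs by (simp add: q_def)
  then have q2: "2 \<le> q" "q < r" using rs by auto
  \<comment> \<open>A counter is read by emptying it. So it is moved to \<open>r\<close> and
    \<open>Suc r\<close> at once and then restored from \<open>Suc r\<close>, which becomes 0
    again.\<close>
  define c where "c = Seq (While q 1 (Seq (Dec q) (Seq (Inc r) (Inc (Suc r)))))
     (While (Suc r) 1 (Seq (Dec (Suc r)) (Inc q)))"
  define T where "T B = Suc (Suc (B * Suc 5) + Suc (B * Suc 3))" for B :: nat
  have "computes_at (\<lambda>z vs. vs ! i) rs r c T"
    unfolding computes_at_def
  proof (intro allI impI)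
    fix z e w B assume e: "\<forall>j. r \<le> j \<or> j < 2 \<longrightarrow> e j = 0" and B: "input_bound z (map e rs) B"
    have eB: "e q \<le> B" using B q by (auto simp: input_bound_def)
    let ?E = "\<lambda>m. e(q := e q - m, r := m, Suc r := m)"
    have 1: "exec z (While q 1 (Seq (Dec q) (Seq (Inc r) (Inc (Suc r))))) e w (Suc (e q * Suc 5)) (?E (e q)) w"
    proof (rule exec_count_down[where E = ?E and W = "\<lambda>_. w"])
      fix m assume m: "m < e q"
      show "exec z (Seq (Dec q) (Seq (Inc r) (Inc (Suc r)))) (?E m) w 5 (?E (Suc m)) w"
        by (rule exec_conv[OF exec_Seq[OF exec_Dec exec_Seq[OF exec_Inc exec_Inc]]])
          (use m q2 in \<open>auto simp: fun_eq_iff\<close>)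
    qed (use q2 e in \<open>auto simp: fun_eq_iff\<close>)
    let ?F = "\<lambda>m. e(q := m, r := e q, Suc r := e q - m)"
    have 2: "exec z (While (Suc r) 1 (Seq (Dec (Suc r)) (Inc q))) (?E (e q)) w (Suc (e q * Suc 3)) (?F (e q)) w"
    proof (rule exec_count_down[where E = ?F and W = "\<lambda>_. w"])
      fix m assume m: "m < e q"
      show "exec z (Seq (Dec (Suc r)) (Inc q)) (?F m) w 3 (?F (Suc m)) w"
        by (rule exec_conv[OF exec_Seq[OF exec_Dec exec_Inc]])
          (use m q2 in \<open>auto simp: fun_eq_iff\<close>)
    qed (use q2 e in \<open>auto simp: fun_eq_iff\<close>)
    show "exec z c e w (T B) (e(r := map e rs ! i)) w"
      unfolding c_def
      by (rule exec_conv[OF exec_Seq[OF 1 2]]) (use eB q2 e assms rs in \<open>auto simp: fun_eq_iff T_def q_def\<close>)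
  qed
  moreover have "poly_bounded T" unfolding T_def by (intro poly_bounded_intros)
  ultimately show "\<exists>c T. poly_bounded T \<and> computes_at (\<lambda>z vs. vs ! i) rs r c T" by blast
qed

text \<open>Shared by addition and truncated subtraction: \<open>g\<close> is counted down while \<open>op\<close> acts on \<open>f\<close>.\<close>

lemma computable_count:
  assumes f: "computable d f" and g: "computable d g"
    and bound: "\<And>z vs. iter (f z vs) (g z vs) \<le> f z vs + g z vs"
    and iter0: "\<And>a. iter a 0 = a"
    and op: "\<And>r. 2 \<le> r \<Longrightarrow> \<exists>c. \<forall>z e w a m. e r = iter a m \<longrightarrow> exec z c e w 2 (e(r := iter a (Suc m))) w"
  shows "computable d (\<lambda>z vs. iter (f z vs) (g z vs))"
proof -
  obtain F where F: "poly_bounded F" "\<And>z vs B. length vs = d \<Longrightarrow> input_bound z vs B \<Longrightarrow> f z vs \<le> F B"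
    using computable_bound[OF f] by blast
  obtain G where G: "poly_bounded G" "\<And>z vs B. length vs = d \<Longrightarrow> input_bound z vs B \<Longrightarrow> g z vs \<le> G B"
    using computable_bound[OF g] by blast
  show ?thesis
  proof (rule computableI[OF poly_bounded_add[OF F(1) G(1)]])
    show "iter (f z vs) (g z vs) \<le> F B + G B" if "length vs = d" "input_bound z vs B" for z vs B
      using order_trans[OF bound add_mono[OF F(2)[OF that] G(2)[OF that]]] .
    fix rs :: "nat list" and r :: nat assume rs: "length rs = d" "set rs \<subseteq> {2..<r}" "2 \<le> r"
    obtain c1 T1 where c1: "poly_bounded T1" "computes_at f rs r c1 T1"
      using computable_cmd[OF f rs] by blast
    have "set rs \<subseteq> {2..<Suc r}" using rs by auto
    then obtain c2 T2 where c2: "poly_bounded T2" "computes_at g rs (Suc r) c2 T2"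
      by (rule computable_cmd[OF g rs(1)]) (use rs in auto)
    from op[OF rs(3)] obtain p where
      "\<forall>z e w a m. e r = iter a m \<longrightarrow> exec z p e w 2 (e(r := iter a (Suc m))) w" ..
    then have p: "e r = iter a m \<Longrightarrow> exec z p e w 2 (e(r := iter a (Suc m))) w" for z e w a m by iprover
    define c where "c = Seq c1 (Seq c2 (While (Suc r) 1 (Seq (Dec (Suc r)) p)))"
    define T where "T B = Suc (T1 B + Suc (T2 B + Suc (G B * Suc 4)))" for B
    have "computes_at (\<lambda>z vs. iter (f z vs) (g z vs)) rs r c T"
      unfolding computes_at_def
    proof (intro allI impI)
      fix z e w B assume e: "\<forall>j. r \<le> j \<or> j < 2 \<longrightarrow> e j = 0" and B: "input_bound z (map e rs) B"
      let ?vs = "map e rs"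
      let ?a = "f z ?vs" and ?b = "g z ?vs"
      have b: "?b \<le> G B" using G(2)[OF _ B] rs by simp
      have 1: "exec z c1 e w (T1 B) (e(r := ?a)) w"
        by (rule computes_at_exec[OF c1(2)]) (use e B in auto)
      have 2: "exec z c2 (e(r := ?a)) w (T2 B) (e(r := ?a, Suc r := ?b)) w"
        by (rule computes_at_exec[OF c2(2)]) (use e B rs in \<open>auto simp: regs_fresh\<close>)
      let ?E = "\<lambda>m. e(r := iter ?a m, Suc r := ?b - m)"
      have 3: "exec z (While (Suc r) 1 (Seq (Dec (Suc r)) p)) (e(r := ?a, Suc r := ?b)) w
          (Suc (?b * Suc 4)) (?E ?b) w"
      proof (rule exec_count_down[where E = ?E and W = "\<lambda>_. w"])
        fix m assume m: "m < ?b"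
        let ?E1 = "e(r := iter ?a m, Suc r := ?b - Suc m)"
        have "exec z (Dec (Suc r)) (?E m) w 1 ?E1 w"
          by (rule exec_conv[OF exec_Dec]) (use m in \<open>auto simp: fun_eq_iff\<close>)
        moreover have "exec z p ?E1 w 2 (?E1(r := iter ?a (Suc m))) w"
          by (rule p) simp
        ultimately show "exec z (Seq (Dec (Suc r)) p) (?E m) w 4 (?E (Suc m)) w"
          by (rule exec_conv[OF exec_Seq]) (auto simp: fun_eq_iff)
      qed (use rs e in \<open>auto simp: fun_eq_iff iter0\<close>)
      show "exec z c e w (T B) (e(r := iter ?a ?b)) w"
        unfolding c_def
        by (rule exec_conv[OF exec_Seq[OF 1 exec_Seq[OF 2 3]]]) (use b e in \<open>auto simp: fun_eq_iff T_def\<close>)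
    qed
    moreover have "poly_bounded T" unfolding T_def by (intro poly_bounded_intros c1 c2 G)
    ultimately show "\<exists>c T. poly_bounded T \<and> computes_at (\<lambda>z vs. iter (f z vs) (g z vs)) rs r c T" by blast
  qed
qed

lemma computable_add:
  assumes "computable d f" "computable d g"
  shows "computable d (\<lambda>z vs. f z vs + g z vs)"
proof (rule computable_count[where iter = "(+)", OF assms])
  fix r :: nat
  have "exec z (Inc r) e w 2 (e(r := a + Suc m)) w" if "e r = a + m" for z e w a m
    by (rule exec_conv[OF exec_Inc]) (use that in \<open>auto simp: fun_eq_iff\<close>)
  then show "\<exists>c. \<forall>z e w a m. e r = a + m \<longrightarrow> exec z c e w 2 (e(r := a + Suc m)) w" by blast
qed simp_all

lemma computable_diff:
  assumes "computable d f" "computable d g"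
  shows "computable d (\<lambda>z vs. f z vs - g z vs)"
proof (rule computable_count[where iter = "(-)", OF assms])
  fix r :: nat assume r: "2 \<le> r"
  have "exec z (Ite r 1 (While r 1 (Inc r)) (Dec r)) e w 2 (e(r := a - Suc m)) w" if "e r = a - m" for z e w a m
  proof (cases "e r = 0")
    case True
    show ?thesis
      by (rule exec_conv[OF exec_Ite[where T = 1 and e' = e]])
        (use True r that in \<open>auto simp: counter_zero' fun_eq_iff intro!: exec_While_stop[simplified]\<close>)
  next
    case False
    have "exec z (Dec r) e w 1 (e(r := a - Suc m)) w"
      by (rule exec_conv[OF exec_Dec]) (use False that in \<open>auto simp: fun_eq_iff\<close>)
    then show ?thesis
      by (intro exec_conv[OF exec_Ite[where T = 1 and e' = "e(r := a - Suc m)"]])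
        (use False r in \<open>auto simp: counter_zero'\<close>)
  qed
  then show "\<exists>c. \<forall>z e w a m. e r = a - m \<longrightarrow> exec z c e w 2 (e(r := a - Suc m)) w" by blast
qed simp_all

definition input_string :: "bool list \<times> bool list \<Rightarrow> nat \<Rightarrow> bool list" where
  "input_string z i = (if i = 0 then fst z else snd z)"

lemma input_symbol:
  assumes "i < 2"
  shows "tape_cells z i (int n) = (if n < length (input_string z i) then bit_symbol (input_string z i ! n) else 0)"
  using assms by (auto simp: tape_cells_def input_string_def string_cells_def less_Suc_eq numeral_2_eq_2)

lemma input_length_bound: "input_bound z vs B \<Longrightarrow> length (input_string z i) \<le> B"
  by (auto simp: input_bound_def input_string_def)

text \<open>The input head runs to the first blank while \<open>r\<close> and \<open>Suc r\<close>
  count. The copy in \<open>Suc r\<close> brings it back, because programs expect both input heads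
  at 0.\<close>

lemma computable_length:
  assumes i: "i < 2" shows "computable d (\<lambda>z vs. length (input_string z i))"
proof (rule computableI[OF poly_bounded_id])
  show "length (input_string z i) \<le> B" if "input_bound z vs B" for z vs B
    using that by (rule input_length_bound)
  fix rs :: "nat list" and r :: nat assume rs: "length rs = d" "set rs \<subseteq> {2..<r}" "2 \<le> r"
  define c where "c = Seq (While i 0 (Seq (Inc i) (Seq (Inc r) (Inc (Suc r)))))
     (While (Suc r) 1 (Seq (Dec (Suc r)) (Dec i)))"
  define T where "T B = Suc (Suc (B * Suc 5) + Suc (B * Suc 3))" for B :: nat
  have "computes_at (\<lambda>z vs. length (input_string z i)) rs r c T"
    unfolding computes_at_def
  proof (intro allI impI)
    fix z e w B assume e: "\<forall>j. r \<le> j \<or> j < 2 \<longrightarrow> e j = 0" and B: "input_bound z (map e rs) B"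
    let ?n = "length (input_string z i)"
    have nB: "?n \<le> B" using B by (rule input_length_bound)
    let ?E = "\<lambda>m. e(i := m, r := m, Suc r := m)"
    have e0: "e = ?E 0" using e i by (auto simp: fun_eq_iff)
    have "exec z (While i 0 (Seq (Inc i) (Seq (Inc r) (Inc (Suc r))))) (?E 0) w (Suc (?n * Suc 5)) (?E ?n) w"
    proof (rule exec_While[where E = ?E and W = "\<lambda>_. w"])
      fix m assume m: "m < ?n"
      show "exec z (Seq (Inc i) (Seq (Inc r) (Inc (Suc r)))) (?E m) w 5 (?E (Suc m)) w"
        by (rule exec_conv[OF exec_Seq[OF exec_Inc exec_Seq[OF exec_Inc exec_Inc]]])
          (use m i rs in \<open>auto simp: fun_eq_iff\<close>)
      show "tape_cells z i (int (?E m i)) \<noteq> 0"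
        using m i rs by (simp add: input_symbol bit_symbol_def)
    next
      show "tape_cells z i (int (?E ?n i)) = 0" using i rs by (simp add: input_symbol)
    qed
    then have 1: "exec z (While i 0 (Seq (Inc i) (Seq (Inc r) (Inc (Suc r))))) e w (Suc (?n * Suc 5)) (?E ?n) w"
      using e0 by simp
    let ?F = "\<lambda>m. e(i := ?n - m, r := ?n, Suc r := ?n - m)"
    have 2: "exec z (While (Suc r) 1 (Seq (Dec (Suc r)) (Dec i))) (?E ?n) w (Suc (?n * Suc 3)) (?F ?n) w"
    proof (rule exec_count_down[where E = ?F and W = "\<lambda>_. w"])
      fix m assume m: "m < ?n"
      show "exec z (Seq (Dec (Suc r)) (Dec i)) (?F m) w 3 (?F (Suc m)) w"
        by (rule exec_conv[OF exec_Seq[OF exec_Dec exec_Dec]])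
          (use m i rs in \<open>auto simp: fun_eq_iff\<close>)
    qed (use i rs e in \<open>auto simp: fun_eq_iff\<close>)
    show "exec z c e w (T B) (e(r := ?n)) w"
      unfolding c_def
      by (rule exec_conv[OF exec_Seq[OF 1 2]]) (use nB i e rs in \<open>auto simp: fun_eq_iff T_def\<close>)
  qed
  moreover have "poly_bounded T" unfolding T_def by (intro poly_bounded_intros)
  ultimately show "\<exists>c T. poly_bounded T \<and> computes_at (\<lambda>z vs. length (input_string z i)) rs r c T" by blast
qed

definition input_bit :: "bool list \<times> bool list \<Rightarrow> nat \<Rightarrow> nat \<Rightarrow> bool" where
  "input_bit z i n \<longleftrightarrow> n < length (input_string z i) \<and> input_string z i ! n"

text \<open>The index is counted down while the input head advances, and \<open>Suc r\<close> brings
  the head back. Past the end of the string the scanned symbol is blank, so the bit is 0.\<close>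

lemma computable_bit:
  assumes i: "i < 2" and f: "computable d f" shows "computable d (\<lambda>z vs. of_bool (input_bit z i (f z vs)))"
proof (rule computableI[OF poly_bounded_const[of 1]])
  obtain F where F: "poly_bounded F" "\<And>z vs B. length vs = d \<Longrightarrow> input_bound z vs B \<Longrightarrow> f z vs \<le> F B"
    using computable_bound[OF f] by blast
  fix rs :: "nat list" and r :: nat assume rs: "length rs = d" "set rs \<subseteq> {2..<r}" "2 \<le> r"
  obtain c1 T1 where c1: "poly_bounded T1" "computes_at f rs r c1 T1"
    using computable_cmd[OF f rs] by blast
  let ?skip = "While (r + 2) 1 (Inc r)"
  define c where "c = Seq c1 (Seq (While r 1 (Seq (Dec r) (Seq (Inc i) (Inc (Suc r)))))
     (Seq (Ite i 2 (Inc r) ?skip) (While (Suc r) 1 (Seq (Dec (Suc r)) (Dec i)))))"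
  define T where "T B = Suc (T1 B + Suc (Suc (F B * Suc 5) + Suc (2 + Suc (F B * Suc 3))))" for B :: nat
  have "computes_at (\<lambda>z vs. of_bool (input_bit z i (f z vs))) rs r c T"
    unfolding computes_at_def
  proof (intro allI impI)
    fix z e w B assume e: "\<forall>j. r \<le> j \<or> j < 2 \<longrightarrow> e j = 0" and B: "input_bound z (map e rs) B"
    let ?n = "f z (map e rs)"
    have nB: "?n \<le> F B" using F(2)[OF _ B] rs by simp
    have 0: "exec z c1 e w (T1 B) (e(r := ?n)) w"
      by (rule computes_at_exec[OF c1(2)]) (use e B in auto)
    let ?E = "\<lambda>m. e(i := m, r := ?n - m, Suc r := m)"
    have 1: "exec z (While r 1 (Seq (Dec r) (Seq (Inc i) (Inc (Suc r))))) (e(r := ?n)) w (Suc (?n * Suc 5)) (?E ?n) w"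
    proof (rule exec_count_down[where E = ?E and W = "\<lambda>_. w"])
      fix m assume m: "m < ?n"
      show "exec z (Seq (Dec r) (Seq (Inc i) (Inc (Suc r)))) (?E m) w 5 (?E (Suc m)) w"
        by (rule exec_conv[OF exec_Seq[OF exec_Dec exec_Seq[OF exec_Inc exec_Inc]]])
          (use m i rs in \<open>auto simp: fun_eq_iff\<close>)
    qed (use rs i e in \<open>auto simp: fun_eq_iff\<close>)
    let ?b = "of_bool (input_bit z i ?n) :: nat"
    let ?F = "\<lambda>m. e(i := ?n - m, r := ?b, Suc r := ?n - m)"
    have E2: "?E ?n (r + 2) = 0" using e i rs by auto
    have 2: "exec z (Ite i 2 (Inc r) ?skip) (?E ?n) w 2 (?F 0) w"
    proof (rule exec_conv[OF exec_Ite[where T = 1 and e' = "?F 0"]])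
      have bit: "tape_cells z i (int (?E ?n i)) = 2 \<longleftrightarrow> input_bit z i ?n"
        using i rs by (auto simp: input_symbol input_bit_def bit_symbol_def)
      show "exec z (if tape_cells z i (int (?E ?n i)) = 2 then Inc r else ?skip) (?E ?n) w 1 (?F 0) w"
      proof (cases "input_bit z i ?n")
        case True
        then show ?thesis unfolding bit using exec_conv[OF exec_Inc[of z r "?E ?n" w], of 1 "?F 0"]
          i rs by (auto simp: fun_eq_iff)
      next
        case False
        have "exec z ?skip (?E ?n) w 1 (?E ?n) w"
          by (rule exec_While_stop) (simp only: E2, simp add: counter_zero')
        then show ?thesis unfolding bit using False by simp
      qed
    qed simp_all
    have 3: "exec z (While (Suc r) 1 (Seq (Dec (Suc r)) (Dec i))) (?F 0) w (Suc (?n * Suc 3)) (?F ?n) w"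
    proof (rule exec_count_down[where E = ?F and W = "\<lambda>_. w"])
      fix m assume m: "m < ?n"
      show "exec z (Seq (Dec (Suc r)) (Dec i)) (?F m) w 3 (?F (Suc m)) w"
        by (rule exec_conv[OF exec_Seq[OF exec_Dec exec_Dec]])
          (use m i rs in \<open>auto simp: fun_eq_iff\<close>)
    qed (use i rs e in \<open>auto simp: fun_eq_iff\<close>)
    show "exec z c e w (T B) (e(r := of_bool (input_bit z i (f z (map e rs))))) w"
      unfolding c_def
      by (rule exec_conv[OF exec_Seq[OF 0 exec_Seq[OF 1 exec_Seq[OF 2 3]]]])
        (use nB i e rs in \<open>auto simp: fun_eq_iff T_def\<close>)
  qed
  moreover have "poly_bounded T" unfolding T_def by (intro poly_bounded_intros F c1)
  ultimately show "\<exists>c T. poly_bounded T \<and> computes_at (\<lambda>z vs. of_bool (input_bit z i (f z vs))) rs r c T" by blast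
qed simp

text \<open>The source of all iteration at this level: products, bounded quantifiers and quotients
  are obtained from it. The loop variable is put at the head of the variable list, so variables
  behave like de Bruijn indices.\<close>

lemma computable_sum:
  assumes f: "computable d f" and g: "computable (Suc d) (\<lambda>z vs. g z (tl vs) (hd vs))"
  shows "computable d (\<lambda>z vs. \<Sum>j < f z vs. g z vs j)"
proof -
  obtain F where F: "poly_bounded F" "\<And>z vs B. length vs = d \<Longrightarrow> input_bound z vs B \<Longrightarrow> f z vs \<le> F B"
    using computable_bound[OF f] by blast
  obtain G where G: "poly_bounded G" "\<And>z vs B. length vs = Suc d \<Longrightarrow> input_bound z vs B \<Longrightarrow> g z (tl vs) (hd vs) \<le> G B"
    using computable_bound[OF g] by blast
  have bnd: "input_bound z (j # vs) (B + F B)" if "length vs = d" "input_bound z vs B" "j < f z vs" for z vs B j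
    using that F(2)[OF that(1,2)] by (auto simp: input_bound_def)
  have gB: "g z vs j \<le> G (B + F B)" if "length vs = d" "input_bound z vs B" "j < f z vs" for z vs B j
    using G(2)[OF _ bnd[OF that]] that by simp
  show ?thesis
  proof (rule computableI[where G = "\<lambda>B. F B * G (B + F B)"])
    show "poly_bounded (\<lambda>B. F B * G (B + F B))" by (intro poly_bounded_intros F G)
    show "(\<Sum>j < f z vs. g z vs j) \<le> F B * G (B + F B)" if "length vs = d" "input_bound z vs B" for z vs B
    proof -
      have "(\<Sum>j < f z vs. g z vs j) \<le> of_nat (card {..<f z vs}) * G (B + F B)"
        by (rule sum_bounded_above) (use gB that in auto)
      also have "\<dots> \<le> F B * G (B + F B)" using F(2)[OF that] by simp
      finally show ?thesis .
    qed
    fix rs :: "nat list" and r :: nat assume rs: "length rs = d" "set rs \<subseteq> {2..<r}" "2 \<le> r"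
    \<comment> \<open>Register \<open>r\<close> accumulates the sum, \<open>r + 1\<close> counts the
      remaining rounds, \<open>r + 2\<close> is the loop variable and \<open>r + 3\<close> receives
      one summand.\<close>
    have "set rs \<subseteq> {2..<r + 1}" using rs by auto
    then obtain c1 T1 where c1: "poly_bounded T1" "computes_at f rs (r + 1) c1 T1"
      by (rule computable_cmd[OF f rs(1)]) (use rs in auto)
    have rs': "length ((r + 2) # rs) = Suc d" "set ((r + 2) # rs) \<subseteq> {2..<r + 3}" "2 \<le> r + 3"
      using rs by auto
    obtain c2 T2 where c2: "poly_bounded T2"
      "computes_at (\<lambda>z vs. g z (tl vs) (hd vs)) ((r + 2) # rs) (r + 3) c2 T2"
      using computable_cmd[OF g rs'] by blast
    let ?add = "While (r + 3) 1 (Seq (Dec (r + 3)) (Inc r))"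
    let ?body = "Seq (Dec (r + 1)) (Seq c2 (Seq ?add (Inc (r + 2))))"
    let ?clean = "While (r + 2) 1 (Dec (r + 2))"
    define c where "c = Seq c1 (Seq (While (r + 1) 1 ?body) ?clean)"
    define Tb where "Tb B = Suc (1 + Suc (T2 (B + F B) + Suc (Suc (G (B + F B) * Suc 3) + 1)))" for B
    define T where "T B = Suc (T1 B + Suc (Suc (F B * Suc (Tb B)) + Suc (F B * Suc 1)))" for B
    have "computes_at (\<lambda>z vs. \<Sum>j < f z vs. g z vs j) rs r c T"
      unfolding computes_at_def
    proof (intro allI impI)
      fix z e w B assume e: "\<forall>j. r \<le> j \<or> j < 2 \<longrightarrow> e j = 0" and B: "input_bound z (map e rs) B"
      let ?vs = "map e rs"
      let ?n = "f z ?vs"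
      have lv: "length ?vs = d" using rs by simp
      have nB: "?n \<le> F B" using F(2)[OF lv B] .
      have 1: "exec z c1 e w (T1 B) (e(r + 1 := ?n)) w"
        by (rule computes_at_exec[OF c1(2)]) (use e B in auto)
      let ?s = "\<lambda>m. \<Sum>j<m. g z ?vs j"
      let ?E = "\<lambda>m. e(r := ?s m, r + 1 := ?n - m, r + 2 := m)"
      have 2: "exec z (While (r + 1) 1 ?body) (e(r + 1 := ?n)) w (Suc (?n * Suc (Tb B))) (?E ?n) w"
      proof (rule exec_count_down[where E = ?E and W = "\<lambda>_. w"])
        fix m assume m: "m < ?n"
        let ?g = "g z ?vs m"
        let ?E1 = "e(r := ?s m, r + 1 := ?n - Suc m, r + 2 := m)"
        have b1: "exec z (Dec (r + 1)) (?E m) w 1 ?E1 w"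
          by (rule exec_conv[OF exec_Dec]) (use m in \<open>auto simp: fun_eq_iff\<close>)
        have mv: "map ?E1 ((r + 2) # rs) = m # ?vs" using rs by (auto simp: regs_fresh)
        have b2: "exec z c2 ?E1 w (T2 (B + F B)) (?E1(r + 3 := ?g)) w"
          by (rule exec_conv[OF computes_at_exec[OF c2(2) _ mv bnd[OF lv B m]]]) (use e rs in auto)
        let ?H = "\<lambda>l. e(r := ?s m + l, r + 1 := ?n - Suc m, r + 2 := m, r + 3 := ?g - l)"
        have b3: "exec z ?add (?E1(r + 3 := ?g)) w (Suc (?g * Suc 3)) (?H ?g) w"
        proof (rule exec_count_down[where E = ?H and W = "\<lambda>_. w"])
          fix l assume l: "l < ?g"
          show "exec z (Seq (Dec (r + 3)) (Inc r)) (?H l) w 3 (?H (Suc l)) w"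
            by (rule exec_conv[OF exec_Seq[OF exec_Dec exec_Inc]]) (use l in \<open>auto simp: fun_eq_iff\<close>)
        qed (auto simp: fun_eq_iff)
        show "exec z ?body (?E m) w (Tb B) (?E (Suc m)) w"
          by (rule exec_conv[OF exec_Seq[OF b1 exec_Seq[OF b2 exec_Seq[OF b3 exec_Inc]]]])
            (use gB[OF lv B m] e rs in \<open>auto simp: fun_eq_iff Tb_def\<close>)
      qed (use rs e in \<open>auto simp: fun_eq_iff\<close>)
      let ?F = "\<lambda>m. e(r := ?s ?n, r + 2 := ?n - m)"
      have 3: "exec z ?clean (?E ?n) w (Suc (?n * Suc 1)) (?F ?n) w"
      proof (rule exec_count_down[where E = ?F and W = "\<lambda>_. w"])
        fix m assume m: "m < ?n"
        show "exec z (Dec (r + 2)) (?F m) w 1 (?F (Suc m)) w"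
          by (rule exec_conv[OF exec_Dec]) (use m in \<open>auto simp: fun_eq_iff\<close>)
      qed (use rs e in \<open>auto simp: fun_eq_iff\<close>)
      show "exec z c e w (T B) (e(r := ?s ?n)) w"
        unfolding c_def
        by (rule exec_conv[OF exec_Seq[OF 1 exec_Seq[OF 2 3]]])
          (use nB e rs in \<open>auto simp: fun_eq_iff T_def intro: add_mono mult_le_mono\<close>)
    qed
    moreover have "poly_bounded T" unfolding T_def Tb_def by (intro poly_bounded_intros F c1 c2 G)
    ultimately show "\<exists>c T. poly_bounded T \<and> computes_at (\<lambda>z vs. \<Sum>j < f z vs. g z vs j) rs r c T" by blast
  qed
qed

text \<open>Moves an expression under one more loop variable: its program is taken for the tail of
  the register list.\<close>

lemma computable_weaken:
  assumes f: "computable d f" shows "computable (Suc d) (\<lambda>z vs. f z (tl vs))"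
proof -
  obtain F where F: "poly_bounded F" "\<And>z vs B. length vs = d \<Longrightarrow> input_bound z vs B \<Longrightarrow> f z vs \<le> F B"
    using computable_bound[OF f] by blast
  have tl: "input_bound z (tl vs) B" if "input_bound z vs B" for z vs B
    using that by (cases vs) (auto simp: input_bound_def)
  show ?thesis
  proof (rule computableI[OF F(1)])
    show "f z (tl vs) \<le> F B" if "length vs = Suc d" "input_bound z vs B" for z vs B
      using F(2)[OF _ tl[OF that(2)]] that by simp
    fix rs :: "nat list" and r :: nat assume rs: "length rs = Suc d" "set rs \<subseteq> {2..<r}" "(2::nat) \<le> r"
    have "length (tl rs) = d" "set (tl rs) \<subseteq> {2..<r}" using rs by (cases rs; auto)+
    then obtain c T where c: "poly_bounded T" "computes_at f (tl rs) r c T"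
      using computable_cmd[OF f _ _ rs(3)] by blast
    have "computes_at (\<lambda>z vs. f z (tl vs)) rs r c T"
      unfolding computes_at_def
    proof (intro allI impI)
      fix z e w B assume e: "\<forall>j. r \<le> j \<or> j < 2 \<longrightarrow> e j = 0" and B: "input_bound z (map e rs) B"
      show "exec z c e w (T B) (e(r := f z (tl (map e rs)))) w"
        by (rule computes_at_exec[OF c(2)]) (use e tl[OF B] in \<open>auto simp: map_tl\<close>)
    qed
    then show "\<exists>c T. poly_bounded T \<and> computes_at (\<lambda>z vs. f z (tl vs)) rs r c T" using c by blast
  qed
qed

section \<open>Closure properties of decidable predicates and computable functions\<close>

definition decidable :: "nat \<Rightarrow> (bool list \<times> bool list \<Rightarrow> nat list \<Rightarrow> bool) \<Rightarrow> bool" where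
  "decidable d P \<longleftrightarrow> computable d (\<lambda>z vs. of_bool (P z vs))"

lemma computable_of_bool: "decidable d P \<Longrightarrow> computable d (\<lambda>z vs. of_bool (P z vs))"
  by (simp add: decidable_def)

lemma computable_cong:
  assumes "computable d g" "\<And>z vs. f z vs = g z vs" shows "computable d f"
  using assms by presburger

lemma decidable_cong:
  assumes "decidable d Q" "\<And>z vs. P z vs \<longleftrightarrow> Q z vs" shows "decidable d P"
  using assms by presburger

lemma computable_mult:
  assumes "computable d f" "computable d g" shows "computable d (\<lambda>z vs. f z vs * g z vs)"
  by (rule computable_cong[OF computable_sum[OF assms(1) computable_weaken[OF assms(2)]]]) simp

lemma decidable_less:
  assumes "computable d f" "computable d g" shows "decidable d (\<lambda>z vs. f z vs < g z vs)"
  unfolding decidable_def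
  by (rule computable_cong[where g = "\<lambda>z vs. 1 - (1 - (g z vs - f z vs))"])
    (auto intro!: computable_diff computable_const assms)

lemma decidable_not:
  assumes "decidable d P" shows "decidable d (\<lambda>z vs. \<not> P z vs)"
  unfolding decidable_def
  by (rule computable_cong[where g = "\<lambda>z vs. 1 - of_bool (P z vs)"])
    (auto intro!: computable_diff computable_const computable_of_bool assms)

lemma decidable_conj:
  assumes "decidable d P" "decidable d Q" shows "decidable d (\<lambda>z vs. P z vs \<and> Q z vs)"
  unfolding decidable_def
  by (rule computable_cong[where g = "\<lambda>z vs. of_bool (P z vs) * of_bool (Q z vs)"])
    (auto intro!: computable_mult computable_of_bool assms)

lemma decidable_disj:
  assumes "decidable d P" "decidable d Q" shows "decidable d (\<lambda>z vs. P z vs \<or> Q z vs)"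
  by (rule decidable_cong[OF decidable_not[OF decidable_conj[OF assms[THEN decidable_not]]]]) simp

lemma decidable_imp:
  assumes "decidable d P" "decidable d Q" shows "decidable d (\<lambda>z vs. P z vs \<longrightarrow> Q z vs)"
  by (rule decidable_cong[OF decidable_disj[OF decidable_not[OF assms(1)] assms(2)]]) simp

lemma decidable_le:
  assumes "computable d f" "computable d g" shows "decidable d (\<lambda>z vs. f z vs \<le> g z vs)"
  by (rule decidable_cong[OF decidable_not[OF decidable_less[OF assms(2,1)]]]) auto

lemma decidable_eq:
  assumes "computable d f" "computable d g" shows "decidable d (\<lambda>z vs. f z vs = g z vs)"
  by (rule decidable_cong[OF decidable_conj[OF decidable_le[OF assms] decidable_le[OF assms(2,1)]]]) auto

lemma decidable_ex:
  assumes "computable d f" "decidable (Suc d) (\<lambda>z vs. P z (tl vs) (hd vs))"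
  shows "decidable d (\<lambda>z vs. \<exists>j < f z vs. P z vs j)"
  by (rule decidable_cong[OF decidable_less[OF computable_const[of d 0]
      computable_sum[OF assms(1), of "\<lambda>z vs j. of_bool (P z vs j)"]]])
    (use assms(2) in \<open>auto simp: decidable_def card_gt_0_iff\<close>)

lemma decidable_all:
  assumes "computable d f" "decidable (Suc d) (\<lambda>z vs. P z (tl vs) (hd vs))"
  shows "decidable d (\<lambda>z vs. \<forall>j < f z vs. P z vs j)"
  by (rule decidable_cong[OF decidable_not[OF decidable_ex[OF assms(1), of "\<lambda>z vs j. \<not> P z vs j"]]])
    (auto intro: decidable_not assms(2))

lemma decidable_const: "decidable d (\<lambda>z vs. b)"
  unfolding decidable_def by (rule computable_const)

lemma computable_if:
  assumes "decidable d P" "computable d f" "computable d g"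
  shows "computable d (\<lambda>z vs. if P z vs then f z vs else g z vs)"
  by (rule computable_cong[where g = "\<lambda>z vs. of_bool (P z vs) * f z vs + of_bool (\<not> P z vs) * g z vs"])
    (auto intro!: computable_mult computable_add computable_of_bool decidable_not assms)

lemma decidable_if:
  assumes "decidable d P" "decidable d Q" "decidable d R"
  shows "decidable d (\<lambda>z vs. if P z vs then Q z vs else R z vs)"
  by (rule decidable_cong[where Q = "\<lambda>z vs. (P z vs \<longrightarrow> Q z vs) \<and> (\<not> P z vs \<longrightarrow> R z vs)"])
    (auto intro!: decidable_imp decidable_conj decidable_not assms)

text \<open>The quotient counts the positive multiples of the divisor up to the dividend. The
  conjunct \<open>0 < g z vs\<close> produces the value 0 for division by zero.\<close>

lemma computable_div:
  assumes f: "computable d f" and g: "computable d g" shows "computable d (\<lambda>z vs. f z vs div g z vs)"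
proof (rule computable_cong[where g = "\<lambda>z vs. \<Sum>j < f z vs. of_bool (0 < g z vs \<and> (j + 1) * g z vs \<le> f z vs)"])
  have hd: "computable (Suc d) (\<lambda>z vs. hd vs)"
  proof -
    have eq: "length vs = Suc d \<Longrightarrow> hd vs = vs ! 0" for vs :: "nat list" by (cases vs) auto
    show ?thesis using computable_var[of 0 "Suc d"]
      unfolding computable_def computes_at_def by (simp add: eq)
  qed
  show "computable d (\<lambda>z vs. \<Sum>j < f z vs. of_bool (0 < g z vs \<and> (j + 1) * g z vs \<le> f z vs))"
    by (intro computable_sum computable_of_bool decidable_conj decidable_less decidable_le
        computable_const computable_mult computable_add hd
        computable_weaken[OF f] computable_weaken[OF g] f)
  fix z vs
  have "a div b = (\<Sum>j<a. of_bool (0 < b \<and> (j + 1) * b \<le> a))" for a b :: nat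
  proof (cases "b = 0")
    case False
    have "{j. j < a \<and> (j + 1) * b \<le> a} = {..<a div b}"
    proof (intro equalityI subsetI CollectI conjI)
      fix j assume "j \<in> {j. j < a \<and> (j + 1) * b \<le> a}"
      then show "j \<in> {..<a div b}" using False less_eq_div_iff_mult_less_eq[of b "j + 1" a] by simp
    next
      fix j assume "j \<in> {..<a div b}"
      then have *: "j + 1 \<le> a div b" by simp
      then show "(j + 1) * b \<le> a" using False less_eq_div_iff_mult_less_eq[of b "j + 1" a] by simp
      show "j < a" using * div_le_dividend[of a b] by linarith
    qed
    then have "card {j. j < a \<and> (j + 1) * b \<le> a} = a div b" by simp
    moreover have "{..<a} \<inter> {j. (j + 1) * b \<le> a} = {j. j < a \<and> (j + 1) * b \<le> a}" by auto
    ultimately show ?thesis using False by (simp add: of_bool_def sum.If_cases)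
  qed simp
  then show "f z vs div g z vs = (\<Sum>j < f z vs. of_bool (0 < g z vs \<and> (j + 1) * g z vs \<le> f z vs))" .
qed

lemma computable_mod:
  assumes "computable d f" "computable d g" shows "computable d (\<lambda>z vs. f z vs mod g z vs)"
  by (rule computable_cong[OF computable_diff[OF assms(1)
      computable_mult[OF computable_div[OF assms] assms(2)]]]) (simp add: minus_div_mult_eq_mod)

lemma computable_poly:
  assumes "computable d f" shows "computable d (\<lambda>z vs. poly p (f z vs))"
proof (induction p)
  case 0
  show ?case by (simp add: computable_const)
next
  case (pCons a p)
  then show ?case by (simp add: computable_add computable_mult computable_const assms)
qed

text \<open>Nested uses of \<open>computable_sum\<close> present their variables as
  \<open>hd\<close> of an iterated \<open>tl\<close>; on lists of length \<open>d\<close> this is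
  indexing.\<close>

lemma computable_nth_var:
  assumes "i < d" shows "computable d (\<lambda>z vs. hd ((tl ^^ i) vs))"
proof -
  have tl: "(tl ^^ i) vs = drop i vs" for vs :: "nat list"
    by (induction i) (auto simp: drop_Suc tl_drop)
  have eq: "length vs = d \<Longrightarrow> hd ((tl ^^ i) vs) = vs ! i" for vs :: "nat list"
    unfolding tl using assms by (simp add: hd_drop_conv_nth)
  show ?thesis using computable_var[OF assms]
    unfolding computable_def computes_at_def by (simp add: eq)
qed

lemma computable_hd:
  "0 < d \<Longrightarrow> computable d (\<lambda>z vs. hd vs)"
  "1 < d \<Longrightarrow> computable d (\<lambda>z vs. hd (tl vs))"
  "2 < d \<Longrightarrow> computable d (\<lambda>z vs. hd (tl (tl vs)))"
  "3 < d \<Longrightarrow> computable d (\<lambda>z vs. hd (tl (tl (tl vs))))"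
  using computable_nth_var[of 0 d] computable_nth_var[of 1 d] computable_nth_var[of 2 d]
    computable_nth_var[of 3 d] by (simp_all add: numeral_2_eq_2 numeral_3_eq_3)

text \<open>A finite set is hard-wired by one equality test per element. In this way the transition
  table of an arbitrary verifier enters a program.\<close>

lemma decidable_finite:
  assumes "finite S" "computable d f" shows "decidable d (\<lambda>z vs. f z vs \<in> S)"
  using assms(1)
proof (induction S)
  case empty
  then show ?case using decidable_const[of d False] by simp
next
  case (insert a S)
  have "decidable d (\<lambda>z vs. f z vs = a \<or> f z vs \<in> S)"
    by (intro decidable_disj decidable_eq assms(2) computable_const insert.IH)
  then show ?case by simp
qed

lemma decidable_finite2:
  assumes "finite S" "computable d f" "computable d g" shows "decidable d (\<lambda>z vs. (f z vs, g z vs) \<in> S)"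
  using assms(1)
proof (induction S)
  case empty
  then show ?case using decidable_const[of d False] by simp
next
  case (insert a S)
  have "decidable d (\<lambda>z vs. (f z vs = fst a \<and> g z vs = snd a) \<or> (f z vs, g z vs) \<in> S)"
    by (intro decidable_disj decidable_conj decidable_eq assms(2,3) computable_const insert.IH)
  then show ?case by (rule decidable_cong) auto
qed

lemma computable_input_length:
  "computable d (\<lambda>z vs. length (fst z))" "computable d (\<lambda>z vs. length (snd z))"
  using computable_length[of 0 d] computable_length[of 1 d] by (simp_all add: input_string_def)

definition nth_bit :: "bool list \<Rightarrow> nat \<Rightarrow> bool" where
  "nth_bit x i \<longleftrightarrow> i < length x \<and> x ! i"

lemma decidable_nth_bit:
  assumes "computable d f"
  shows "decidable d (\<lambda>z vs. nth_bit (fst z) (f z vs))" "decidable d (\<lambda>z vs. nth_bit (snd z) (f z vs))"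
  using computable_bit[of 0 d f] computable_bit[of 1 d f] assms
  by (simp_all add: decidable_def input_bit_def input_string_def nth_bit_def)

lemmas computable_intros = computable_hd computable_const computable_add computable_diff computable_mult
  computable_div computable_mod computable_sum computable_input_length computable_poly
  computable_of_bool computable_if decidable_const decidable_conj decidable_disj decidable_imp
  decidable_not decidable_less decidable_le decidable_eq decidable_ex decidable_all decidable_nth_bit
  decidable_if

section \<open>From counter programs to NP and polynomial-time computable functions\<close>

lemma exec_run:
  assumes "exec (x, u) c (\<lambda>_. 0) [] T e w"
  obtains t where "t \<le> T" "(cmd_step (x, u) ^^ t) ([c], \<lambda>_. 0, []) = ([], int \<circ> e, w)"
proof -
  obtain t where "t \<le> T" "\<And>K. (cmd_step (x, u) ^^ t) (c # K, int \<circ> (\<lambda>_. 0), []) = (K, int \<circ> e, w)"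
    using assms by (auto simp: exec_def)
  then show ?thesis using that[of t] by (simp add: comp_def)
qed

lemma poly_bounded_poly:
  assumes "poly_bounded T"
  obtains r :: "nat poly" where "\<And>n. T (n + 2) + 2 \<le> poly r n"
proof -
  obtain k where k: "\<forall>B\<ge>2. T B \<le> B ^ k" using assms by (auto simp: poly_bounded_def)
  \<comment> \<open>\<open>[:2, 1:]\<close> has the value \<open>n + 2\<close>, the least bound for
    inputs of total length \<open>n\<close>; the added 2 pays for the first and the last step of the
    simulating machine.\<close>
  have "T (n + 2) + 2 \<le> poly ([:2, 1:] ^ k + [:2:]) n" for n
    using k[rule_format, of "n + 2"] by (simp add: add.commute)
  then show ?thesis using that by blast
qed

text \<open>The truth value is computed into register 2, the counter whose final value is the
  verdict of the machine.\<close>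

lemma NP_I:
  assumes V: "decidable 0 (\<lambda>z vs. V (fst z) (snd z))"
    and L: "\<And>x. x \<in> L \<longleftrightarrow> (\<exists>u. length u \<le> poly p (length x) \<and> V x u)"
  shows "L \<in> NP"
proof -
  obtain c T where c: "poly_bounded T" "computes_at (\<lambda>z vs. of_bool (V (fst z) (snd z))) [] 2 c T"
    by (rule computable_cmd[OF V[unfolded decidable_def], of "[]" 2]) auto
  obtain r where r: "\<And>n. T (n + 2) + 2 \<le> poly r n" using poly_bounded_poly[OF c(1)] by blast
  obtain M where M: "tm_wf M" "2 \<le> tm_tapes M" and run: "\<And>x u t h w n.
      (cmd_step (x, u) ^^ t) ([c], \<lambda>_. 0, []) = ([], h, w) \<Longrightarrow> t + 2 \<le> n \<Longrightarrow>
       fst (run M [x, u] n) = (if h 2 = 0 then tm_reject M else tm_accept M)"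
    using machine_for_cmd[of c] by blast
  have run': "fst (run M [x, u] n) = (if V x u then tm_accept M else tm_reject M)"
    if n: "poly r (length x + length u) \<le> n" for x u n
  proof -
    let ?B = "length x + length u + 2"
    have "exec (x, u) c (\<lambda>_. 0) [] (T ?B) ((\<lambda>_. 0)(2 := of_bool (V x u))) []"
      using computes_at_exec[OF c(2), of "\<lambda>_. 0" "[]" "(x, u)" ?B] by (simp add: input_bound_def)
    then obtain t where "t \<le> T ?B"
      "(cmd_step (x, u) ^^ t) ([c], \<lambda>_. 0, []) = ([], int \<circ> (\<lambda>_. 0)(2 := of_bool (V x u)), [])"
      by (rule exec_run)
    then show ?thesis using run[where x = x and u = u and t = t and n = n] n r[of "length x + length u"] by auto
  qed
  have ne: "tm_accept M \<noteq> tm_reject M" using M by (auto simp: tm_wf_def)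
  have acc: "accepts M [x, u] \<longleftrightarrow> V x u" for x u
  proof
    assume "accepts M [x, u]"
    then obtain n where n: "fst (run M [x, u] n) = tm_accept M" by (auto simp: accepts_def)
    let ?n = "max n (poly r (length x + length u))"
    have "run M [x, u] ?n = run M [x, u] n"
      by (rule run_stable) (auto simp: halting_def n)
    then show "V x u" using run'[of x u ?n] n ne by (auto split: if_splits)
  next
    assume "V x u"
    then show "accepts M [x, u]" using run'[of x u] by (auto simp: accepts_def)
  qed
  have "halts_within M [x, u] (poly r (length x + length u))" for x u
    using run'[of x u "poly r (length x + length u)"] by (auto simp: halts_within_def halting_def)
  then show ?thesis unfolding NP_def using M acc L by blast
qed

text \<open>Output bits are decided one after the other and written at once, so nothing but the
  current position has to be remembered.\<close>

lemma polytime_computable_I: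
  assumes L: "computable 0 (\<lambda>z vs. L (fst z))" and F: "decidable 1 (\<lambda>z vs. F (fst z) (hd vs))"
  shows "polytime_computable (\<lambda>x. map (F x) [0..<L x])"
proof -
  obtain c1 T1 where c1: "poly_bounded T1" "computes_at (\<lambda>z vs. L (fst z)) [] 3 c1 T1"
    by (rule computable_cmd[OF L, of "[]" 3]) auto
  obtain c2 T2 where c2: "poly_bounded T2" "computes_at (\<lambda>z vs. of_bool (F (fst z) (hd vs))) [2] 4 c2 T2"
    by (rule computable_cmd[OF F[unfolded decidable_def], of "[2]" 4]) auto
  obtain G where G: "poly_bounded G" "\<And>z vs B. length vs = 0 \<Longrightarrow> input_bound z vs B \<Longrightarrow> L (fst z) \<le> G B"
    using computable_bound[OF L] by blast
  \<comment> \<open>Register 2 holds the output position, 3 the number of bits still to come, 4 the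
    current bit. A 0 in register 4 shows as the origin mark; a 1 is cleared by
    \<open>Dec 4\<close>.\<close>
  let ?out = "Ite 4 1 (Out False) (Seq (Dec 4) (Out True))"
  let ?body = "Seq (Dec 3) (Seq c2 (Seq ?out (Inc 2)))"
  define c where "c = Seq c1 (While 3 1 ?body)"
  define Tb where "Tb B = Suc (1 + Suc (T2 (B + G B) + Suc (4 + 1)))" for B
  define T where "T B = Suc (T1 B + Suc (G B * Suc (Tb B)))" for B
  have "poly_bounded T" unfolding T_def Tb_def by (intro poly_bounded_intros c1 c2 G)
  then obtain r where r: "\<And>n. T (n + 2) + 2 \<le> poly r n" using poly_bounded_poly by blast
  have ex: "exec (x, []) c (\<lambda>_. 0) [] (T (length x + 2)) ((\<lambda>_. 0)(2 := L x)) (map (F x) [0..<L x])" for x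
  proof -
    let ?B = "length x + 2" and ?z = "(x, [] :: bool list)" and ?e = "\<lambda>_ :: nat. 0 :: nat"
    have LB: "L x \<le> G ?B" using G(2)[of "[]" ?z ?B] by (simp add: input_bound_def)
    have 1: "exec ?z c1 ?e [] (T1 ?B) (?e(3 := L x)) []"
      using computes_at_exec[OF c1(2), of ?e "[]" ?z ?B] by (simp add: input_bound_def)
    let ?E = "\<lambda>m. ?e(2 := m, 3 := L x - m)" and ?W = "\<lambda>m. map (F x) [0..<m]"
    have 2: "exec ?z (While 3 1 ?body) (?e(3 := L x)) [] (Suc (L x * Suc (Tb ?B))) (?E (L x)) (?W (L x))"
    proof (rule exec_count_down[where E = ?E and W = ?W])
      fix m assume m: "m < L x"
      let ?w = "?W m"
      let ?E1 = "?e(2 := m, 3 := L x - Suc m)"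
      have b1: "exec ?z (Dec 3) (?E m) ?w 1 ?E1 ?w"
        by (rule exec_conv[OF exec_Dec]) (use m in \<open>auto simp: fun_eq_iff\<close>)
      have mv: "map ?E1 [2] = [m]" by simp
      have bd: "input_bound ?z [m] (?B + G ?B)" using m LB by (simp add: input_bound_def)
      have b2: "exec ?z c2 ?E1 ?w (T2 (?B + G ?B)) (?E1(4 := of_bool (F x m))) ?w"
        by (rule exec_conv[OF computes_at_exec[OF c2(2) _ mv bd]]) auto
      have b3: "exec ?z ?out (?E1(4 := of_bool (F x m))) ?w 4 ?E1 (?w @ [F x m])"
      proof (cases "F x m")
        case True
        have "exec ?z (Seq (Dec 4) (Out True)) (?E1(4 := 1)) ?w 3 ?E1 (?w @ [True])"
          by (rule exec_conv[OF exec_Seq[OF exec_Dec exec_Out]]) (auto simp: fun_eq_iff)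
        then have "exec ?z ?out (?E1(4 := 1)) ?w (Suc 3) ?E1 (?w @ [True])"
          by (intro exec_Ite) (simp add: tape_cells_def)
        then show ?thesis using True by simp
      next
        case False
        have "exec ?z (Out False) (?E1(4 := 0)) ?w 3 ?E1 (?w @ [False])"
          by (rule exec_conv[OF exec_Out]) (auto simp: fun_eq_iff)
        then have "exec ?z ?out (?E1(4 := 0)) ?w (Suc 3) ?E1 (?w @ [False])"
          by (intro exec_Ite) (simp add: tape_cells_def)
        then show ?thesis using False by simp
      qed
      have "exec ?z ?body (?E m) ?w (Tb ?B) (?E (Suc m)) (?w @ [F x m])"
        by (rule exec_conv[OF exec_Seq[OF b1 exec_Seq[OF b2 exec_Seq[OF b3 exec_Inc]]]])
          (auto simp: fun_eq_iff Tb_def)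
      then show "exec ?z ?body (?E m) ?w (Tb ?B) (?E (Suc m)) (?W (Suc m))" by simp
    qed (auto simp: fun_eq_iff)
    show ?thesis unfolding c_def
      by (rule exec_conv[OF exec_Seq[OF 1 2]]) (use LB in \<open>auto simp: fun_eq_iff T_def intro!: add_mono mult_le_mono\<close>)
  qed
  obtain M where M: "tm_wf M" and run: "\<And>x u t h w n.
      (cmd_step (x, u) ^^ t) ([c], \<lambda>_. 0, []) = ([], h, w) \<Longrightarrow> t + 2 \<le> n \<Longrightarrow>
       fst (run M [x, u] n) = (if h 2 = 0 then tm_reject M else tm_accept M) \<and>
       fst (last (snd (run M [x, u] n))) = string_cells w"
    and run1: "\<And>x n. run M [x] n = run M [x, []] n"
    using machine_for_cmd[of c] by blast
  have "halts_within M [x] (poly r (length x)) \<and>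
      fst (last (snd (run M [x] (poly r (length x))))) = string_cells (map (F x) [0..<L x])" for x
  proof -
    obtain t where t: "t \<le> T (length x + 2)"
      "(cmd_step (x, []) ^^ t) ([c], \<lambda>_. 0, []) = ([], int \<circ> (\<lambda>_. 0)(2 := L x), map (F x) [0..<L x])"
      using ex by (rule exec_run)
    show ?thesis
      using run[OF t(2), of "poly r (length x)"] t(1) r[of "length x"]
      by (auto simp: halts_within_def halting_def run1)
  qed
  then show ?thesis unfolding polytime_computable_def using M by blast
qed

section \<open>Accepting computations as solutions of binary constraints\<close>

text \<open>State, symbols under all the heads, and the column of symbols at one position of the
  tapes. Repeating the first two in every tile makes the transition checkable on two tiles, since
  its outcome is known wherever a symbol has to be compared.\<close>

type_synonym tile = "nat \<times> nat list \<times> nat list"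

definition offset :: "move \<Rightarrow> int" where
  "offset m = move_head m 0"

lemma move_head_offset: "move_head m h = h + offset m"
  by (cases m) (auto simp: offset_def)

text \<open>Tapes are described relative to the head, so that the scanned cell is always cell 0.\<close>

definition view :: "int \<Rightarrow> tape list \<Rightarrow> nat list" where
  "view s ts = map (\<lambda>(f, h). f (h + s)) ts"

lemma view_0: "view 0 ts = map scan ts"
  by (auto simp: view_def)

locale verifier =
  fixes M :: tm
  assumes wf: "tm_wf M" and two_tapes: "2 \<le> tm_tapes M"
begin

abbreviation "k \<equiv> tm_tapes M"

text \<open>Makes halting an ordinary transition that rewrites what it scans and stays, so an
  accepting run can be extended to any prescribed length.\<close>

definition effect :: "nat \<Rightarrow> nat list \<Rightarrow> nat \<times> (nat \<times> move) list" where
  "effect q as = (if halting M q then (q, map (\<lambda>a. (a, MoveStay)) as) else tm_delta M q as)"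

lemma step_effect:
  "step M (q, ts) = (fst (effect q (map scan ts)), map2 act (snd (effect q (map scan ts))) ts)"
proof -
  have "act (scan p, MoveStay) p = p" for p by (cases p) auto
  then have "map2 act (map (\<lambda>a. (a, MoveStay)) (map scan ts)) ts = ts"
    by (intro nth_equalityI) auto
  then show ?thesis by (auto simp: effect_def split: prod.splits)
qed

declare step.simps [simp del]

definition tiles :: "tile set" where
  "tiles = {(q, as, C). q < tm_states M \<and> as \<in> {as. set as \<subseteq> {..<tm_symbols M} \<and> length as = k} \<and>
     C \<in> {as. set as \<subseteq> {..<tm_symbols M} \<and> length as = k}}"

lemma finite_tiles: "finite tiles"
proof -
  have "tiles = {..<tm_states M} \<times> {as. set as \<subseteq> {..<tm_symbols M} \<and> length as = k} \<times>
      {as. set as \<subseteq> {..<tm_symbols M} \<and> length as = k}"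
    by (auto simp: tiles_def)
  then show ?thesis by (simp add: finite_lists_length_eq)
qed

fun row_ok :: "tile \<Rightarrow> tile \<Rightarrow> bool" where
  "row_ok (q, as, C) (q', as', C') \<longleftrightarrow> q = q' \<and> as = as'"

fun origin_ok :: "tile \<Rightarrow> bool" where
  "origin_ok (q, as, C) \<longleftrightarrow> C = as"

text \<open>The first tile lies \<open>d\<close> cells to the right of the second one and one time step earlier;
  \<open>b\<close> tells whether it is the scanned cell.\<close>

fun step_ok :: "int \<Rightarrow> bool \<Rightarrow> tile \<Rightarrow> tile \<Rightarrow> bool" where
  "step_ok d b (q, as, C) (q', as', C') \<longleftrightarrow> q' = fst (effect q as) \<and>
     (\<forall>i<k. offset (snd (snd (effect q as) ! i)) = d \<longrightarrow>
        C' ! i = (if b then fst (snd (effect q as) ! i) else C ! i))"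

fun symbol_at :: "nat \<Rightarrow> tile \<Rightarrow> nat" where
  "symbol_at i (q, as, C) = C ! i"

definition start_ok :: "tile \<Rightarrow> bool" where
  "start_ok \<tau> \<longleftrightarrow> fst \<tau> = tm_start M \<and> symbol_at 1 \<tau> \<le> 2 \<and> (\<forall>i. 2 \<le> i \<and> i < k \<longrightarrow> symbol_at i \<tau> = 0)"

text \<open>A head moves at most one cell per step, so the window from \<open>-T\<close> to
  \<open>T\<close> suffices. The certificate is guessed: in the start row tape 1 may show any bits
  in cells 0 to \<open>P - 1\<close>, and the condition that a blank is followed by a blank makes
  them a string.\<close>

definition fits :: "bool list \<Rightarrow> nat \<Rightarrow> nat \<Rightarrow> (nat \<Rightarrow> int \<Rightarrow> tile) \<Rightarrow> bool" where
  "fits x T P G \<longleftrightarrow>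
    (\<forall>t\<le>T. \<forall>s\<in>{-int T..int T}. G t s \<in> tiles) \<and>
    (\<forall>t\<le>T. \<forall>s\<in>{-int T..int T}. \<forall>s'\<in>{-int T..int T}. row_ok (G t s) (G t s')) \<and>
    (\<forall>t\<le>T. origin_ok (G t 0)) \<and>
    (\<forall>t<T. \<forall>s\<in>{-int T..int T}. \<forall>s'\<in>{-int T..int T}. \<bar>s' - s\<bar> \<le> 1 \<longrightarrow>
       step_ok (s' - s) (s' = 0) (G t s') (G (Suc t) s)) \<and>
    (\<forall>s\<in>{-int T..int T}. start_ok (G 0 s) \<and> symbol_at 0 (G 0 s) = string_cells x s \<and>
       (s < 0 \<or> int P \<le> s \<longrightarrow> symbol_at 1 (G 0 s) = 0)) \<and>
    (\<forall>s. 0 \<le> s \<and> s < int T \<and> symbol_at 1 (G 0 s) = 0 \<longrightarrow> symbol_at 1 (G 0 (s + 1)) = 0) \<and>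
    (\<forall>s\<in>{-int T..int T}. fst (G T s) = tm_accept M)"

lemma effect_wf:
  assumes "q < tm_states M" "set as \<subseteq> {..<tm_symbols M}" "length as = k"
  shows "fst (effect q as) < tm_states M" "length (snd (effect q as)) = k"
    "i < k \<Longrightarrow> fst (snd (effect q as) ! i) < tm_symbols M"
proof -
  obtain q' acts where d: "tm_delta M q as = (q', acts)" by fastforce
  have *: "q' < tm_states M \<and> length acts = k \<and> (\<forall>(b, m) \<in> set acts. b < tm_symbols M)"
    using wf assms d unfolding tm_wf_def by fastforce
  have "fst (acts ! i) < tm_symbols M" if "i < k" for i
    using * that nth_mem[of i acts] by (cases "acts ! i") auto
  moreover have "as ! i < tm_symbols M" if "i < k" for i
    using assms that nth_mem[of i as] by (metis lessThan_iff subsetD)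
  ultimately show "fst (effect q as) < tm_states M" "length (snd (effect q as)) = k"
    "i < k \<Longrightarrow> fst (snd (effect q as) ! i) < tm_symbols M"
    using assms * d by (auto simp: effect_def)
qed

text \<open>A cell at distance \<open>s\<close> from the new head was at distance \<open>s\<close>
  plus the offset of the move from the old head, and the symbol just written lay at distance
  0.\<close>

lemma view_step:
  assumes "length acts = length ts" "i < length ts"
  shows "view s (map2 act acts ts) ! i =
    (if s + offset (snd (acts ! i)) = 0 then fst (acts ! i) else view (s + offset (snd (acts ! i))) ts ! i)"
proof -
  obtain f h where ts: "ts ! i = (f, h)" by fastforce
  obtain b m where a: "acts ! i = (b, m)" by fastforce
  have "h + offset m + s = h \<longleftrightarrow> s + offset m = 0" by auto
  then show ?thesis using assms ts a
    by (auto simp: view_def move_head_offset add_ac)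
qed

definition run_tile :: "config \<Rightarrow> int \<Rightarrow> tile" where
  "run_tile c s = (fst c, map scan (snd c), view s (snd c))"

definition config_wf :: "config \<Rightarrow> bool" where
  "config_wf c \<longleftrightarrow> fst c < tm_states M \<and> length (snd c) = k \<and> (\<forall>(f, h) \<in> set (snd c). \<forall>p. f p < tm_symbols M)"

lemma run_tile_in_tiles:
  assumes "config_wf c" shows "run_tile c s \<in> tiles"
  using assms by (fastforce simp: config_wf_def run_tile_def tiles_def view_def)

lemma run_Suc: "run M xs (Suc n) = step M (run M xs n)"
  by (simp add: run_def)

lemma config_wf_run:
  assumes "length xs \<le> k" shows "config_wf (run M xs n)"
proof (induction n)
  case 0
  have "3 \<le> tm_symbols M" "tm_start M < tm_states M" using wf by (auto simp: tm_wf_def)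
  then have "string_cells x i < tm_symbols M" for x i by (auto simp: string_cells_def bit_symbol_def)
  then show ?case using assms \<open>tm_start M < tm_states M\<close>
    by (auto simp: run_def init_config_def config_wf_def)
next
  case (Suc n)
  obtain q ts where c: "run M xs n = (q, ts)" by fastforce
  let ?as = "map scan ts"
  have as: "q < tm_states M" "set ?as \<subseteq> {..<tm_symbols M}" "length ?as = k" "length ts = k"
    using Suc c by (fastforce simp: config_wf_def)+
  note e = effect_wf[OF as(1-3)]
  have "f p < tm_symbols M" if "i < k" "act (snd (effect q ?as) ! i) (ts ! i) = (f, h)" for f h p i
  proof -
    obtain f0 h0 where f0: "ts ! i = (f0, h0)" by fastforce
    then have "f0 p < tm_symbols M" for p
      using Suc c that(1) as(4) nth_mem[of i ts] by (fastforce simp: config_wf_def)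
    then show ?thesis using that f0 e(3)[OF that(1)] by (cases "snd (effect q ?as) ! i") auto
  qed
  then have "\<forall>(f, h) \<in> set (map2 act (snd (effect q ?as)) ts). \<forall>p. f p < tm_symbols M"
    using e(2) as(4) by (auto simp: in_set_conv_nth simp del: act.simps)
  then show ?case using e as c by (simp add: run_Suc step_effect config_wf_def)
qed

lemma fits_run:
  assumes "length u \<le> P" and acc: "fst (run M [x, u] T) = tm_accept M"
  shows "fits x T P (\<lambda>t. run_tile (run M [x, u] t))"
proof -
  have cw: "config_wf (run M [x, u] t)" for t by (rule config_wf_run) (use two_tapes in simp)
  have sok: "step_ok (s' - s) (s' = 0) (run_tile (run M [x, u] t) s') (run_tile (run M [x, u] (Suc t)) s)" for t s s'
  proof -
    obtain q ts where c: "run M [x, u] t = (q, ts)" by fastforce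
    have as: "q < tm_states M" "set (map scan ts) \<subseteq> {..<tm_symbols M}" "length (map scan ts) = k" "length ts = k"
      using cw[of t] c by (fastforce simp: config_wf_def)+
    note e = effect_wf[OF as(1-3)]
    have "view s (map2 act (snd (effect q (map scan ts))) ts) ! i =
        (if s' = 0 then fst (snd (effect q (map scan ts)) ! i) else view s' ts ! i)"
      if "i < k" "offset (snd (snd (effect q (map scan ts)) ! i)) = s' - s" for i
      using view_step[of "snd (effect q (map scan ts))" ts i s] e(2) as(4) that by simp
    then show ?thesis by (simp add: run_tile_def c run_Suc step_effect)
  qed
  have init: "snd (run M [x, u] 0) = (string_cells x, 0) # (string_cells u, 0) # replicate (k - 2) (string_cells [], 0)"
    "fst (run M [x, u] 0) = tm_start M"
    by (simp_all add: run_def init_config_def numeral_2_eq_2)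
  have sym: "symbol_at i (run_tile (run M [x, u] 0) s) = (if i = 0 then string_cells x s
      else if i = 1 then string_cells u s else 0)" if "i < k" for i s
    using that by (auto simp: run_tile_def init view_def nth_Cons string_cells_def split: nat.splits)
  have u2: "string_cells u s \<le> 2" "s < 0 \<or> int P \<le> s \<Longrightarrow> string_cells u s = 0"
    "0 \<le> s \<Longrightarrow> string_cells u s = 0 \<Longrightarrow> string_cells u (s + 1) = 0" for s
    using assms(1) by (auto simp: string_cells_def bit_symbol_def split: if_splits)
  have k1: "0 < k" "1 < k" using two_tapes by auto
  show ?thesis
    unfolding fits_def start_ok_def
    using run_tile_in_tiles[OF cw] sok u2 sym[OF k1(1)] sym[OF k1(2)] acc sym init
    by (auto simp: view_0 run_tile_def simp del: symbol_at.simps step_ok.simps)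
qed

lemma fitsD:
  assumes "fits x T P G"
  shows "t \<le> T \<Longrightarrow> s \<in> {-int T..int T} \<Longrightarrow> G t s \<in> tiles"
    "t \<le> T \<Longrightarrow> s \<in> {-int T..int T} \<Longrightarrow> s' \<in> {-int T..int T} \<Longrightarrow> row_ok (G t s) (G t s')"
    "t \<le> T \<Longrightarrow> origin_ok (G t 0)"
    "t < T \<Longrightarrow> s \<in> {-int T..int T} \<Longrightarrow> s' \<in> {-int T..int T} \<Longrightarrow> \<bar>s' - s\<bar> \<le> 1 \<Longrightarrow>
      step_ok (s' - s) (s' = 0) (G t s') (G (Suc t) s)"
    "s \<in> {-int T..int T} \<Longrightarrow> start_ok (G 0 s)"
    "s \<in> {-int T..int T} \<Longrightarrow> symbol_at 0 (G 0 s) = string_cells x s"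
    "s \<in> {-int T..int T} \<Longrightarrow> s < 0 \<or> int P \<le> s \<Longrightarrow> symbol_at 1 (G 0 s) = 0"
    "0 \<le> s \<Longrightarrow> s < int T \<Longrightarrow> symbol_at 1 (G 0 s) = 0 \<Longrightarrow> symbol_at 1 (G 0 (s + 1)) = 0"
    "s \<in> {-int T..int T} \<Longrightarrow> fst (G T s) = tm_accept M"
  using assms unfolding fits_def by simp_all (elim disjE; simp)

text \<open>At the border of the window a symbol may be shifted in from outside, where nothing
  constrains it, and this freedom spreads inwards by one cell per step. So the tiles are shown to
  agree with the run only on the cone \<open>\<bar>s\<bar> + int t \<le> int T\<close>, whose tip is
  the accepting origin tile at time \<open>T\<close>.\<close>

lemma run_of_fits:
  assumes F: "fits x T P G" and PT: "P \<le> T"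
  shows "\<exists>u. length u \<le> P \<and> fst (run M [x, u] T) = tm_accept M"
proof -
  let ?I = "{-int T..int T}"
  note tl = fitsD(1)[OF F] and row = fitsD(2)[OF F] and org = fitsD(3)[OF F] and sok = fitsD(4)[OF F]
    and st = fitsD(5-7)[OF F] and cert = fitsD(8)[OF F] and fin = fitsD(9)[OF F]
  define c where "c s = symbol_at 1 (G 0 s)" for s
  \<comment> \<open>The certificate ends at the first blank, or at \<open>P\<close> if none comes
    earlier; the disjunct \<open>j = P\<close> makes the minimum exist.\<close>
  define l where "l = (LEAST j. j = P \<or> c (int j) = 0)"
  have l: "l = P \<or> c (int l) = 0" unfolding l_def by (rule LeastI[of _ P]) simp
  have lP: "l \<le> P" unfolding l_def by (rule Least_le) simp
  have l0: "c (int j) \<noteq> 0" if "j < l" for j using not_less_Least[of j] that unfolding l_def by auto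
  define u where "u = map (\<lambda>j. c (int j) = 2) [0..<l]"
  have zero: "c (int j) = 0" if "l \<le> j" "j \<le> T" for j
    using that
  proof (induction j rule: dec_induct)
    case base
    then show ?case using l st(3)[of "int P"] by (auto simp: c_def)
  next
    case (step j)
    then show ?case using cert[of "int j"] by (simp add: c_def add.commute)
  qed
  have cu: "c s = string_cells u s" if s: "s \<in> ?I" for s
  proof (cases "0 \<le> s \<and> s < int l")
    case True
    then obtain j where j: "s = int j" "j < l" by (metis nonneg_int_cases of_nat_less_iff)
    have "c s \<le> 2" using st(1)[OF s] by (simp add: start_ok_def c_def)
    then show ?thesis using l0[OF j(2)] j by (auto simp: string_cells_def u_def bit_symbol_def)
  next
    case False
    have "c s = 0"
    proof (cases "s < 0")
      case True then show ?thesis using st(3)[OF s] by (simp add: c_def)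
    next
      case False
      then have "l \<le> nat s" "nat s \<le> T" "s = int (nat s)" using \<open>\<not> (0 \<le> s \<and> s < int l)\<close> s by auto
      then show ?thesis using zero[of "nat s"] by simp
    qed
    then show ?thesis using False by (auto simp: string_cells_def u_def)
  qed
  have cw: "config_wf (run M [x, u] t)" for t by (rule config_wf_run) (use two_tapes in simp)
  have init: "snd (run M [x, u] 0) = (string_cells x, 0) # (string_cells u, 0) # replicate (k - 2) (string_cells [], 0)"
    "fst (run M [x, u] 0) = tm_start M"
    by (simp_all add: run_def init_config_def numeral_2_eq_2)
  have len: "length (snd (run M [x, u] t)) = k" for t using cw[of t] by (simp add: config_wf_def)
  text \<open>The tiles of a row share state and scanned symbols, and the origin tile makes the latter
    agree with the tape, so it suffices to know the symbols of a row.\<close>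
  have rowI: "\<forall>s. \<bar>s\<bar> + int t \<le> int T \<longrightarrow> G t s = run_tile (run M [x, u] t) s"
    if t: "t \<le> T" and q: "fst (G t 0) = fst (run M [x, u] t)"
      and C: "\<And>s i. \<bar>s\<bar> + int t \<le> int T \<Longrightarrow> i < k \<Longrightarrow> symbol_at i (G t s) = view s (snd (run M [x, u] t)) ! i" for t
  proof (intro allI impI)
    fix s assume s: "\<bar>s\<bar> + int t \<le> int T"
    have sI: "s \<in> ?I" "0 \<in> ?I" using s by auto
    obtain q0 as0 C0 where G0: "G t 0 = (q0, as0, C0)" by (metis prod_cases3)
    obtain q1 as1 C1 where G1: "G t s = (q1, as1, C1)" by (metis prod_cases3)
    have lens: "length C0 = k" "length C1 = k"
      using tl[OF t sI(1)] tl[OF t sI(2)] G0 G1 by (auto simp: tiles_def)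
    have "C1 = view s (snd (run M [x, u] t))"
      by (rule nth_equalityI) (use lens len C[OF s] G1 in \<open>auto simp: view_def\<close>)
    moreover have "C0 = view 0 (snd (run M [x, u] t))"
      by (rule nth_equalityI) (use lens len C[of 0] G0 t in \<open>auto simp: view_def\<close>)
    moreover have "q1 = q0" "as1 = as0" "C0 = as0"
      using row[OF t sI] org[OF t] G0 G1 by auto
    ultimately show "G t s = run_tile (run M [x, u] t) s"
      using G0 G1 q by (simp add: run_tile_def view_0)
  qed
  have main: "\<forall>s. \<bar>s\<bar> + int t \<le> int T \<longrightarrow> G t s = run_tile (run M [x, u] t) s" if "t \<le> T" for t
    using that
  proof (induction t)
    case 0
    show ?case
    proof (rule rowI)
      show "fst (G 0 0) = fst (run M [x, u] 0)"
        using st(1)[of 0] by (simp add: start_ok_def init)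
      fix s i assume s: "\<bar>s\<bar> + int 0 \<le> int T" and i: "i < k"
      then have sI: "s \<in> ?I" by auto
      show "symbol_at i (G 0 s) = view s (snd (run M [x, u] 0)) ! i"
        using st(1,2)[OF sI] cu[OF sI] i
        by (auto simp: start_ok_def c_def init view_def nth_Cons string_cells_def[of "[]"] split: nat.splits)
    qed simp
  next
    case (Suc t)
    obtain q ts where r: "run M [x, u] t = (q, ts)" by fastforce
    have as: "q < tm_states M" "set (map scan ts) \<subseteq> {..<tm_symbols M}" "length (map scan ts) = k" "length ts = k"
      using cw[of t] r by (fastforce simp: config_wf_def)+
    note e = effect_wf[OF as(1-3)]
    let ?acts = "snd (effect q (map scan ts))"
    have IH: "G t s = (q, map scan ts, view s ts)" if "\<bar>s\<bar> + int t \<le> int T" for s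
      using Suc that r by (simp add: run_tile_def)
    show ?case
    proof (rule rowI)
      show "Suc t \<le> T" by fact
      obtain q1 as1 C1 where G1: "G (Suc t) 0 = (q1, as1, C1)" by (metis prod_cases3)
      show "fst (G (Suc t) 0) = fst (run M [x, u] (Suc t))"
        using sok[of t 0 0] Suc.prems IH[of 0] G1 by (simp add: run_Suc r step_effect)
    next
      fix s i assume s: "\<bar>s\<bar> + int (Suc t) \<le> int T" and i: "i < k"
      let ?d = "offset (snd (?acts ! i))"
      have d: "\<bar>?d\<bar> \<le> 1" by (cases "snd (?acts ! i)") (auto simp: offset_def)
      obtain q1 as1 C1 where G1: "G (Suc t) s = (q1, as1, C1)" by (metis prod_cases3)
      have "s \<in> ?I" "s + ?d \<in> ?I" using s d by auto
      then have "step_ok ?d (s + ?d = 0) (G t (s + ?d)) (G (Suc t) s)"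
        using sok[of t s "s + ?d"] d Suc.prems by auto
      moreover have "G t (s + ?d) = (q, map scan ts, view (s + ?d) ts)"
        by (rule IH) (use s d in auto)
      ultimately have "C1 ! i = (if s + ?d = 0 then fst (?acts ! i) else view (s + ?d) ts ! i)"
        using G1 i by simp
      then show "symbol_at i (G (Suc t) s) = view s (snd (run M [x, u] (Suc t))) ! i"
        using view_step[of ?acts ts i s] e(2) as(4) i by (simp add: G1 run_Suc r step_effect)
    qed
  qed
  have "G T 0 = run_tile (run M [x, u] T) 0" using main[of T] by simp
  then have "fst (run M [x, u] T) = tm_accept M" using fin[of 0] by (simp add: run_tile_def)
  then show ?thesis using lP by (intro exI[of _ u]) (simp add: u_def)
qed

section \<open>Numbered tiles and pairwise conflicts\<close>

definition ncol :: nat where "ncol = card tiles"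

definition tile_of :: "nat \<Rightarrow> tile" where "tile_of = from_nat_into tiles"

lemma tile_of_bij: "bij_betw tile_of {..<ncol} tiles"
  unfolding tile_of_def ncol_def using bij_betw_from_nat_into_finite[OF finite_tiles] .

text \<open>Tiles are replaced by their numbers so that every condition becomes a finite table of
  numbers, independent of the input.\<close>

definition bad_pairs :: "(tile \<Rightarrow> tile \<Rightarrow> bool) \<Rightarrow> (nat \<times> nat) set" where
  "bad_pairs R = {(c, c'). c < ncol \<and> c' < ncol \<and> \<not> R (tile_of c) (tile_of c')}"

definition bad_tiles :: "(tile \<Rightarrow> bool) \<Rightarrow> nat set" where
  "bad_tiles R = {c. c < ncol \<and> \<not> R (tile_of c)}"

lemma finite_bad: "finite (bad_pairs R)" "finite (bad_tiles Q)"
proof -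
  have "bad_pairs R \<subseteq> {..<ncol} \<times> {..<ncol}" by (auto simp: bad_pairs_def)
  then show "finite (bad_pairs R)" by (rule finite_subset) simp
qed (simp add: bad_tiles_def)

text \<open>A condition on one tile is a conflict with every second tile, itself included. Position
  \<open>j\<close> stands for cell \<open>j - T\<close> relative to the heads, so
  \<open>j = T\<close> is the scanned cell, and truncated subtraction is the reason for the guards
  \<open>T \<le> j\<close>. The parameters of the tables are constants such as \<open>1\<close> and
  \<open>True\<close>, never \<open>x\<close> or \<open>j\<close>, so that each table is
  fixed.\<close>

definition conflict :: "bool list \<Rightarrow> nat \<Rightarrow> nat \<Rightarrow> nat \<Rightarrow> nat \<Rightarrow> nat \<Rightarrow> nat \<Rightarrow> nat \<Rightarrow> nat \<Rightarrow> bool" where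
  "conflict x T P t j c t' j' c' \<longleftrightarrow>
     t = t' \<and> (c, c') \<in> bad_pairs row_ok \<or>
     j = T \<and> c \<in> bad_tiles origin_ok \<or>
     t' = t + 1 \<and> (
       j = j' \<and> j = T \<and> (c, c') \<in> bad_pairs (step_ok 0 True) \<or>
       j = j' \<and> j \<noteq> T \<and> (c, c') \<in> bad_pairs (step_ok 0 False) \<or>
       j = j' + 1 \<and> j = T \<and> (c, c') \<in> bad_pairs (step_ok 1 True) \<or>
       j = j' + 1 \<and> j \<noteq> T \<and> (c, c') \<in> bad_pairs (step_ok 1 False) \<or>
       j + 1 = j' \<and> j = T \<and> (c, c') \<in> bad_pairs (step_ok (-1) True) \<or>
       j + 1 = j' \<and> j \<noteq> T \<and> (c, c') \<in> bad_pairs (step_ok (-1) False)) \<or>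
     t = 0 \<and> (
       c \<in> bad_tiles start_ok \<or>
       T \<le> j \<and> nth_bit x (j - T) \<and> c \<in> bad_tiles (\<lambda>\<tau>. symbol_at 0 \<tau> = 2) \<or>
       T \<le> j \<and> j - T < length x \<and> \<not> nth_bit x (j - T) \<and> c \<in> bad_tiles (\<lambda>\<tau>. symbol_at 0 \<tau> = 1) \<or>
       (j < T \<or> length x \<le> j - T) \<and> c \<in> bad_tiles (\<lambda>\<tau>. symbol_at 0 \<tau> = 0) \<or>
       (j < T \<or> P \<le> j - T) \<and> c \<in> bad_tiles (\<lambda>\<tau>. symbol_at 1 \<tau> = 0) \<or>
       t' = 0 \<and> T \<le> j \<and> j' = j + 1 \<and>
         (c, c') \<in> bad_pairs (\<lambda>\<tau> \<tau>'. symbol_at 1 \<tau> = 0 \<longrightarrow> symbol_at 1 \<tau>' = 0)) \<or>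
     t = T \<and> c \<in> bad_tiles (\<lambda>\<tau>. fst \<tau> = tm_accept M)"

lemma conflict_stepI:
  assumes "(c, c') \<in> bad_pairs (step_ok d (j = T))"
    "d = 0 \<and> j = j' \<or> d = 1 \<and> j = j' + 1 \<or> d = -1 \<and> j + 1 = j'"
  shows "conflict x T P t j c (Suc t) j' c'"
  using assms(2,1) unfolding conflict_def by (cases "j = T") (elim disjE; simp)+

lemma conflict_startI: "c \<in> bad_tiles start_ok \<Longrightarrow> conflict x T P 0 j c t' j' c'"
  unfolding conflict_def by simp

lemma conflict_inputI:
  assumes "c \<in> bad_tiles (\<lambda>\<tau>. symbol_at 0 \<tau> = string_cells x (int j - int T))"
  shows "conflict x T P 0 j c t' j' c'"
proof -
  have T: "nat (int j - int T) = j - T" by simp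
  consider "T \<le> j" "nth_bit x (j - T)" | "T \<le> j" "j - T < length x" "\<not> nth_bit x (j - T)"
    | "j < T \<or> length x \<le> j - T" by fastforce
  then show ?thesis
  proof cases
    case 1
    then have "string_cells x (int j - int T) = 2"
      by (auto simp: string_cells_def nth_bit_def bit_symbol_def T)
    then show ?thesis using assms 1 unfolding conflict_def by simp
  next
    case 2
    then have "string_cells x (int j - int T) = 1"
      by (auto simp: string_cells_def nth_bit_def bit_symbol_def T)
    then show ?thesis using assms 2 unfolding conflict_def by simp
  next
    case 3
    then have "string_cells x (int j - int T) = 0" by (auto simp: string_cells_def)
    then show ?thesis using assms 3 unfolding conflict_def by simp
  qed
qed

lemma conflict_certI:
  "c \<in> bad_tiles (\<lambda>\<tau>. symbol_at 1 \<tau> = 0) \<Longrightarrow> j < T \<or> P \<le> j - T \<Longrightarrow> conflict x T P 0 j c t' j' c'"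
  "(c, c') \<in> bad_pairs (\<lambda>\<tau> \<tau>'. symbol_at 1 \<tau> = 0 \<longrightarrow> symbol_at 1 \<tau>' = 0) \<Longrightarrow> T \<le> j \<Longrightarrow>
    conflict x T P 0 j c 0 (j + 1) c'"
  unfolding conflict_def by simp_all

lemma conflict_acceptI: "c \<in> bad_tiles (\<lambda>\<tau>. fst \<tau> = tm_accept M) \<Longrightarrow> conflict x T P T j c t' j' c'"
  unfolding conflict_def by simp

lemma fits_of_conflict_free:
  assumes g: "\<And>t j. t \<le> T \<Longrightarrow> j \<le> 2 * T \<Longrightarrow> g t j < ncol"
    and nc: "\<And>t j t' j'. t \<le> T \<Longrightarrow> j \<le> 2 * T \<Longrightarrow> t' \<le> T \<Longrightarrow> j' \<le> 2 * T \<Longrightarrow>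
      \<not> conflict x T P t j (g t j) t' j' (g t' j')"
  shows "fits x T P (\<lambda>t s. tile_of (g t (nat (s + int T))))"
proof -
  let ?I = "{-int T..int T}"
  let ?j = "\<lambda>s. nat (s + int T)"
  let ?G = "\<lambda>t s. tile_of (g t (?j s))"
  have j: "?j s \<le> 2 * T" if "s \<in> ?I" for s using that by auto
  have gj: "g t (?j s) < ncol" if "t \<le> T" "s \<in> ?I" for t s using g[OF that(1) j[OF that(2)]] .
  have nc': "\<not> conflict x T P t (?j s) (g t (?j s)) t' (?j s') (g t' (?j s'))"
    if "t \<le> T" "t' \<le> T" "s \<in> ?I" "s' \<in> ?I" for t s t' s'
    using nc[OF that(1) j[OF that(3)] that(2) j[OF that(4)]] .
  have bp: "(g t (?j s), g t' (?j s')) \<notin> bad_pairs R \<Longrightarrow> R (?G t s) (?G t' s')"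
    if "t \<le> T" "t' \<le> T" "s \<in> ?I" "s' \<in> ?I" for t s t' s' R
    using gj[OF that(1,3)] gj[OF that(2,4)] by (auto simp: bad_pairs_def)
  have bt: "g t (?j s) \<notin> bad_tiles R \<Longrightarrow> R (?G t s)" if "t \<le> T" "s \<in> ?I" for t s R
    using gj[OF that(1,2)] by (auto simp: bad_tiles_def)
  have 1: "?G t s \<in> tiles" if "t \<le> T" "s \<in> ?I" for t s
    using bij_betwE[OF tile_of_bij] gj[OF that] by auto
  have 2: "row_ok (?G t s) (?G t s')" if "t \<le> T" "s \<in> ?I" "s' \<in> ?I" for t s s'
    by (rule bp[where R = row_ok]) (use that in \<open>auto intro!: contrapos_nn[OF nc'[OF that(1,1,2,3)]] simp: conflict_def\<close>)
  have 3: "origin_ok (?G t 0)" if "t \<le> T" for t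
  proof (rule bt[where R = origin_ok])
    show "g t (?j 0) \<notin> bad_tiles origin_ok"
      using that by (intro contrapos_nn[OF nc'[of t t 0 0]]) (auto simp: conflict_def)
  qed (use that in auto)
  have 4: "step_ok (s' - s) (s' = 0) (?G t s') (?G (Suc t) s)"
    if h: "t < T" "s \<in> ?I" "s' \<in> ?I" "\<bar>s' - s\<bar> \<le> 1" for t s s'
  proof (rule bp[where R = "step_ok (s' - s) (s' = 0)"])
    have "s' - s = 0 \<and> ?j s' = ?j s \<or> s' - s = 1 \<and> ?j s' = ?j s + 1 \<or> s' - s = -1 \<and> ?j s' + 1 = ?j s"
      using h by auto
    moreover have "(?j s' = T) = (s' = 0)" using h by auto
    ultimately have "(g t (?j s'), g (Suc t) (?j s)) \<in> bad_pairs (step_ok (s' - s) (s' = 0)) \<Longrightarrow>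
        conflict x T P t (?j s') (g t (?j s')) (Suc t) (?j s) (g (Suc t) (?j s))"
      using conflict_stepI[of "g t (?j s')" "g (Suc t) (?j s)" "s' - s" "?j s'" T "?j s"] by simp
    then show "(g t (?j s'), g (Suc t) (?j s)) \<notin> bad_pairs (step_ok (s' - s) (s' = 0))"
      using nc'[of t "Suc t" s' s] h by auto
  qed (use h in auto)
  have 5: "start_ok (?G 0 s)" if "s \<in> ?I" for s
    using bt[where R = start_ok, OF _ that, of 0] nc'[OF _ _ that that, of 0 0] conflict_startI by blast
  have 6: "symbol_at 0 (?G 0 s) = string_cells x s" if s: "s \<in> ?I" for s
  proof -
    have "int (?j s) - int T = s" using s by auto
    then have "g 0 (?j s) \<notin> bad_tiles (\<lambda>\<tau>. symbol_at 0 \<tau> = string_cells x s)"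
      using nc'[OF _ _ s s, of 0 0] conflict_inputI[of "g 0 (?j s)" x "?j s" T] by auto
    then show ?thesis using bt[OF _ s, of 0 "\<lambda>\<tau>. symbol_at 0 \<tau> = string_cells x s"] by simp
  qed
  have 7: "symbol_at 1 (?G 0 s) = 0" if s: "s \<in> ?I" and P: "s < 0 \<or> int P \<le> s" for s
  proof -
    have "?j s < T \<or> P \<le> ?j s - T" using s P by auto
    then have "g 0 (?j s) \<notin> bad_tiles (\<lambda>\<tau>. symbol_at 1 \<tau> = 0)"
      using nc'[OF _ _ s s, of 0 0] conflict_certI(1) by blast
    then show ?thesis using bt[OF _ s, of 0 "\<lambda>\<tau>. symbol_at 1 \<tau> = 0"] by simp
  qed
  have 8: "symbol_at 1 (?G 0 s) = 0 \<longrightarrow> symbol_at 1 (?G 0 (s + 1)) = 0" if h: "0 \<le> s" "s < int T" for s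
  proof -
    let ?R = "\<lambda>\<tau> \<tau>'. symbol_at 1 \<tau> = 0 \<longrightarrow> symbol_at 1 \<tau>' = 0"
    have j: "?j (s + 1) = ?j s + 1" "T \<le> ?j s" and I: "s \<in> ?I" "s + 1 \<in> ?I" using h by auto
    then have "(g 0 (?j s), g 0 (?j (s + 1))) \<notin> bad_pairs ?R"
      using nc'[OF _ _ I, of 0 0] conflict_certI(2)[of "g 0 (?j s)" "g 0 (?j (s + 1))" T "?j s"] by auto
    then show ?thesis using bp[OF _ _ I, of 0 0 ?R] by simp
  qed
  have 9: "fst (?G T s) = tm_accept M" if s: "s \<in> ?I" for s
  proof -
    have "g T (?j s) \<notin> bad_tiles (\<lambda>\<tau>. fst \<tau> = tm_accept M)"
      using nc'[OF _ _ s s, of T T] conflict_acceptI by blast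
    then show ?thesis using bt[OF _ s, of T "\<lambda>\<tau>. fst \<tau> = tm_accept M"] by simp
  qed
  show ?thesis unfolding fits_def
    by (intro conjI allI ballI impI; (elim conjE)?;
        (rule 1 2 3 4 5 6 7 9 8[rule_format]; assumption))
qed

text \<open>Joins the cases that \<open>conflict\<close> separates only to have fixed tables, namely
  whether \<open>j\<close> is the scanned cell.\<close>

lemma conflictE:
  assumes "conflict x T P t j c t' j' c'"
  obtains (row) "t = t'" "(c, c') \<in> bad_pairs row_ok"
    | (origin) "j = T" "c \<in> bad_tiles origin_ok"
    | (stay) "t' = t + 1" "j = j'" "(c, c') \<in> bad_pairs (step_ok 0 (j = T))"
    | (right) "t' = t + 1" "j = j' + 1" "(c, c') \<in> bad_pairs (step_ok 1 (j = T))"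
    | (left) "t' = t + 1" "j' = j + 1" "(c, c') \<in> bad_pairs (step_ok (-1) (j = T))"
    | (start) "t = 0" "c \<in> bad_tiles start_ok"
    | (one) "t = 0" "T \<le> j" "nth_bit x (j - T)" "c \<in> bad_tiles (\<lambda>\<tau>. symbol_at 0 \<tau> = 2)"
    | (zero) "t = 0" "T \<le> j" "j - T < length x" "\<not> nth_bit x (j - T)"
        "c \<in> bad_tiles (\<lambda>\<tau>. symbol_at 0 \<tau> = 1)"
    | (blank) "t = 0" "j < T \<or> length x \<le> j - T" "c \<in> bad_tiles (\<lambda>\<tau>. symbol_at 0 \<tau> = 0)"
    | (cert_blank) "t = 0" "j < T \<or> P \<le> j - T" "c \<in> bad_tiles (\<lambda>\<tau>. symbol_at 1 \<tau> = 0)"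
    | (cert) "t = 0" "t' = 0" "T \<le> j" "j' = j + 1"
        "(c, c') \<in> bad_pairs (\<lambda>\<tau> \<tau>'. symbol_at 1 \<tau> = 0 \<longrightarrow> symbol_at 1 \<tau>' = 0)"
    | (accept) "t = T" "c \<in> bad_tiles (\<lambda>\<tau>. fst \<tau> = tm_accept M)"
proof -
  from assms show thesis
    unfolding conflict_def
    apply (elim disjE conjE)
    subgoal by (rule that(1); simp)
    subgoal by (rule that(2); simp)
    subgoal by (rule that(3); simp)
    subgoal by (rule that(3); simp)
    subgoal by (rule that(4); simp)
    subgoal by (rule that(4); simp)
    subgoal by (rule that(5); simp)
    subgoal by (rule that(5); simp)
    subgoal by (rule that(6); simp)
    subgoal by (rule that(7); simp)
    subgoal by (rule that(8); simp)
    subgoal by (rule that(9); simp)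
    subgoal by (rule that(9); simp)
    subgoal by (rule that(10); simp)
    subgoal by (rule that(10); simp)
    subgoal by (rule that(11); simp)
    subgoal by (rule that(12); simp)
    done
qed

lemma conflict_free_of_fits:
  assumes F: "fits x T P G"
  obtains g where "\<And>t j. t \<le> T \<Longrightarrow> j \<le> 2 * T \<Longrightarrow> g t j < ncol"
    "\<And>t j t' j'. t \<le> T \<Longrightarrow> j \<le> 2 * T \<Longrightarrow> t' \<le> T \<Longrightarrow> j' \<le> 2 * T \<Longrightarrow>
      \<not> conflict x T P t j (g t j) t' j' (g t' j')"
proof -
  let ?I = "{-int T..int T}"
  define g where "g t j = inv_into {..<ncol} tile_of (G t (int j - int T))" for t j
  have I: "int j - int T \<in> ?I" if "j \<le> 2 * T" for j using that by auto
  have tl: "G t (int j - int T) \<in> tile_of ` {..<ncol}" if "t \<le> T" "j \<le> 2 * T" for t j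
    using fitsD(1)[OF F that(1) I[OF that(2)]] tile_of_bij unfolding bij_betw_def by simp
  have gK: "g t j < ncol" if "t \<le> T" "j \<le> 2 * T" for t j
    using inv_into_into[OF tl[OF that]] by (simp add: g_def)
  have gG: "tile_of (g t j) = G t (int j - int T)" if "t \<le> T" "j \<le> 2 * T" for t j
    using f_inv_into_f[OF tl[OF that]] by (simp add: g_def)
  have bp: "(g t j, g t' j') \<in> bad_pairs R \<longleftrightarrow> \<not> R (G t (int j - int T)) (G t' (int j' - int T))"
    if "t \<le> T" "j \<le> 2 * T" "t' \<le> T" "j' \<le> 2 * T" for t j t' j' R
    using that gK gG by (auto simp: bad_pairs_def)
  have bt: "g t j \<in> bad_tiles R \<longleftrightarrow> \<not> R (G t (int j - int T))" if "t \<le> T" "j \<le> 2 * T" for t j R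
    using that gK gG by (auto simp: bad_tiles_def)
  have "\<not> conflict x T P t j (g t j) t' j' (g t' j')"
    if b: "t \<le> T" "j \<le> 2 * T" "t' \<le> T" "j' \<le> 2 * T" for t j t' j'
  proof
    assume c: "conflict x T P t j (g t j) t' j' (g t' j')"
    note I1 = I[OF b(2)] and I2 = I[OF b(4)]
    let ?s = "int j - int T" and ?s' = "int j' - int T"
    note row' = fitsD(2)[OF F b(1) I1 I2] and org = fitsD(3)[OF F b(1)]
      and st = fitsD(5-7)[OF F I1] and fin = fitsD(9)[OF F I1]
    have step: "step_ok (?s - ?s') (?s = 0) (G t ?s) (G (Suc t) ?s')" if h: "t' = t + 1" "\<bar>?s - ?s'\<bar> \<le> 1"
    proof -
      have "t < T" using h b by simp
      then show ?thesis using fitsD(4)[OF F _ I2 I1 h(2)] by simp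
    qed
    have cert': "symbol_at 1 (G 0 ?s') = 0" if h: "j' = j + 1" "T \<le> j" "symbol_at 1 (G 0 ?s) = 0"
    proof -
      have "?s' = ?s + 1" "0 \<le> ?s" "?s < int T" using h b by auto
      then show ?thesis using fitsD(8)[OF F] h(3) by metis
    qed
    have e1: "nat ?s = j - T" by simp
    from c show False
    proof (cases rule: conflictE)
      case row then show False using row' b by (simp add: bp)
    next
      case origin then show False using org b by (simp add: bt)
    next
      case stay
      then have "?s - ?s' = 0" "(?s = 0) = (j = T)" by auto
      then show False using step stay b by (simp add: bp)
    next
      case right
      then have "?s - ?s' = 1" "(?s = 0) = (j = T)" by auto
      then show False using step right b by (simp add: bp)
    next
      case left
      then have "?s - ?s' = -1" "(?s = 0) = (j = T)" by auto
      then show False using step left b by (simp add: bp)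
    next
      case start then show False using st b by (simp add: bt)
    next
      case one
      then have "string_cells x ?s = 2" by (auto simp: string_cells_def nth_bit_def bit_symbol_def e1)
      then show False using one st(2) b by (simp add: bt)
    next
      case zero
      then have "string_cells x ?s = 1" by (auto simp: string_cells_def nth_bit_def bit_symbol_def e1)
      then show False using zero st(2) b by (simp add: bt)
    next
      case blank
      then have "string_cells x ?s = 0" by (auto simp: string_cells_def)
      then show False using blank st(2) b by (simp add: bt)
    next
      case cert_blank
      then have "?s < 0 \<or> int P \<le> ?s" by auto
      then show False using cert_blank st(3) b by (simp add: bt)
    next
      case cert then show False using cert' b by (simp add: bp)
    next
      case accept then show False using fin b by (simp add: bt)
    qed
  qed
  then show ?thesis using that gK by blast
qed

lemma accepting_iff_conflict_free:
  assumes "P \<le> T"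
  shows "(\<exists>u. length u \<le> P \<and> fst (run M [x, u] T) = tm_accept M) \<longleftrightarrow>
    (\<exists>g. (\<forall>t\<le>T. \<forall>j\<le>2 * T. g t j < ncol) \<and>
       (\<forall>t\<le>T. \<forall>j\<le>2 * T. \<forall>t'\<le>T. \<forall>j'\<le>2 * T. \<not> conflict x T P t j (g t j) t' j' (g t' j')))"
proof
  assume "\<exists>u. length u \<le> P \<and> fst (run M [x, u] T) = tm_accept M"
  then obtain u where "fits x T P (\<lambda>t. run_tile (run M [x, u] t))" using fits_run by blast
  then show "\<exists>g. (\<forall>t\<le>T. \<forall>j\<le>2 * T. g t j < ncol) \<and>
       (\<forall>t\<le>T. \<forall>j\<le>2 * T. \<forall>t'\<le>T. \<forall>j'\<le>2 * T. \<not> conflict x T P t j (g t j) t' j' (g t' j'))"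
  proof (rule conflict_free_of_fits)
    fix g assume "\<And>t j. t \<le> T \<Longrightarrow> j \<le> 2 * T \<Longrightarrow> g t j < ncol"
      "\<And>t j t' j'. t \<le> T \<Longrightarrow> j \<le> 2 * T \<Longrightarrow> t' \<le> T \<Longrightarrow> j' \<le> 2 * T \<Longrightarrow>
        \<not> conflict x T P t j (g t j) t' j' (g t' j')"
    then show ?thesis by (intro exI[of _ g]) simp
  qed
next
  assume "\<exists>g. (\<forall>t\<le>T. \<forall>j\<le>2 * T. g t j < ncol) \<and>
       (\<forall>t\<le>T. \<forall>j\<le>2 * T. \<forall>t'\<le>T. \<forall>j'\<le>2 * T. \<not> conflict x T P t j (g t j) t' j' (g t' j'))"
  then obtain g where "\<forall>t\<le>T. \<forall>j\<le>2 * T. g t j < ncol"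
    "\<forall>t\<le>T. \<forall>j\<le>2 * T. \<forall>t'\<le>T. \<forall>j'\<le>2 * T. \<not> conflict x T P t j (g t j) t' j' (g t' j')"
    by (elim exE conjE)
  then have "fits x T P (\<lambda>t s. tile_of (g t (nat (s + int T))))"
    by (intro fits_of_conflict_free) simp_all
  then show "\<exists>u. length u \<le> P \<and> fst (run M [x, u] T) = tm_accept M"
    using run_of_fits assms by blast
qed

end

section \<open>The cell gadgets\<close>

text \<open>A cell has eight core vertices; vertices 0, 1, 2, 3 are its left, right, upper and lower
  ports. The four types of cells are: type 0 for a variable occurring in a clause, type 1 for a variable not
  occurring in it, types 2 and 3 for the start of a positive and of a negative clause.\<close>

definition core :: "nat \<Rightarrow> nat list list" where
  "core t = (if t = 0 then [[4,5], [4,5], [4,6], [6,7], [0,1,2], [7,0,1], [7,2,3], [3,5,6]]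
     else if t = 1 then [[4,5], [4,5], [6,7], [6,7], [5,0,1], [0,1,4], [7,2,3], [2,3,6]]
     else if t = 2 then [[2,4], [2,4], [0,1], [5,6], [7,0,1], [6,7,3], [7,3,5], [4,5,6]]
     else [[3,4], [3,4], [5,6], [0,1], [7,0,1], [6,7,2], [7,2,5], [4,5,6]])"

definition core_sum :: "nat \<Rightarrow> (nat \<Rightarrow> bool) \<Rightarrow> nat \<Rightarrow> nat" where
  "core_sum t b i = (\<Sum>j \<leftarrow> core t ! i. of_bool (b j))"

text \<open>Every port has one neighbour outside the core, and that neighbour carries the opposite bit.\<close>

definition full_sum :: "nat \<Rightarrow> (nat \<Rightarrow> bool) \<Rightarrow> nat \<Rightarrow> nat" where
  "full_sum t b i = core_sum t b i + (if i < 4 then of_bool (\<not> b i) else 0)"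

text \<open>The last conjunct is luckiness of the edge that leaves port \<open>i\<close>. The outer
  neighbour has sum \<open>1 + b i\<close>, as the inner vertices of its diamond carry different
  bits, and the port has sum \<open>core_sum t b i + 1 - b i\<close>.\<close>

definition core_ok :: "nat \<Rightarrow> (nat \<Rightarrow> bool) \<Rightarrow> bool" where
  "core_ok t b \<longleftrightarrow> (\<forall>i \<in> set [0,1,2,3,4,5,6,7]. \<forall>j \<in> set (core t ! i). full_sum t b i \<noteq> full_sum t b j) \<and>
     (\<forall>i \<in> set [0,1,2,3]. core_sum t b i \<noteq> 2 * of_bool (b i))"

text \<open>Type 0 forbids just one vertical change, from the negation of the row bit above to the
  row bit below. Each relation is preserved by negating all four bits, as the complement symmetry of
  cubic graphs demands.\<close>

definition cell_rel :: "nat \<Rightarrow> bool \<Rightarrow> bool \<Rightarrow> bool \<Rightarrow> bool \<Rightarrow> bool" where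
  "cell_rel t l r u d \<longleftrightarrow> l = r \<and>
     (if t = 0 then u = l \<or> d \<noteq> l else if t = 1 then u = d
      else if t = 2 then d = l \<and> u \<noteq> l else u = l \<and> d \<noteq> l)"

lemma core_ok_rel_0: "core_ok 0 b \<Longrightarrow> cell_rel 0 (b 0) (b 1) (b 2) (b 3)"
  by (simp add: core_ok_def full_sum_def core_sum_def core_def cell_rel_def,
      cases "b 0"; cases "b (Suc 0)"; cases "b 2"; cases "b 3";
      cases "b 4"; cases "b 5"; cases "b 6"; cases "b 7"; simp)

lemma core_ok_rel_1: "core_ok 1 b \<Longrightarrow> cell_rel 1 (b 0) (b 1) (b 2) (b 3)"
  by (simp add: core_ok_def full_sum_def core_sum_def core_def cell_rel_def,
      cases "b 0"; cases "b (Suc 0)"; cases "b 2"; cases "b 3";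
      cases "b 4"; cases "b 5"; cases "b 6"; cases "b 7"; simp)

lemma core_ok_rel_2: "core_ok 2 b \<Longrightarrow> cell_rel 2 (b 0) (b 1) (b 2) (b 3)"
  by (simp add: core_ok_def full_sum_def core_sum_def core_def cell_rel_def,
      cases "b 0"; cases "b (Suc 0)"; cases "b 2"; cases "b 3";
      cases "b 4"; cases "b 5"; cases "b 6"; cases "b 7"; simp)

lemma core_ok_rel_3: "core_ok 3 b \<Longrightarrow> cell_rel 3 (b 0) (b 1) (b 2) (b 3)"
  by (simp add: core_ok_def full_sum_def core_sum_def core_def cell_rel_def,
      cases "b 0"; cases "b (Suc 0)"; cases "b 2"; cases "b 3";
      cases "b 4"; cases "b 5"; cases "b 6"; cases "b 7"; simp)

lemma core_ok_rel:
  assumes "t < 4" "core_ok t b" shows "cell_rel t (b 0) (b 1) (b 2) (b 3)"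
proof -
  have "t = 0 \<or> t = 1 \<or> t = 2 \<or> t = 3" using assms(1) by linarith
  then show ?thesis using assms(2) core_ok_rel_0 core_ok_rel_1 core_ok_rel_2 core_ok_rel_3 by blast
qed

lemma core_rel_ok:
  assumes t: "t < 4" and rel: "cell_rel t l r u d"
  shows "\<exists>b. core_ok t b \<and> b 0 = l \<and> b 1 = r \<and> b 2 = u \<and> b 3 = d"
proof -
  \<comment> \<open>In type 0 the bits 4 to 7 record, relative to \<open>l\<close>, how the vertical
    ports compare with it and with each other. In type 1 they are constants, in types 2 and 3 copies
    or negations of \<open>l\<close>.\<close>
  define b where "b = (\<lambda>i. [l, r, u, d,
    if t = 0 then (u = l \<and> d \<noteq> l) \<noteq> l else if t = 1 then False else \<not> l,
    if t = 0 then \<not> l else if t = 1 then True else l,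
    if t = 0 then (u = l \<and> d = l) \<noteq> l else if t = 1 then False else \<not> l,
    if t = 0 then (u = d) \<noteq> l else if t = 1 then True else l] ! i)"
  have b: "b 0 = l" "b 1 = r" "b (Suc 0) = r" "b 2 = u" "b 3 = d"
    "b 4 = (if t = 0 then (u = l \<and> d \<noteq> l) \<noteq> l else if t = 1 then False else \<not> l)"
    "b 5 = (if t = 0 then \<not> l else if t = 1 then True else l)"
    "b 6 = (if t = 0 then (u = l \<and> d = l) \<noteq> l else if t = 1 then False else \<not> l)"
    "b 7 = (if t = 0 then (u = d) \<noteq> l else if t = 1 then True else l)"
    by (simp_all add: b_def)
  have "t = 0 \<or> t = 1 \<or> t = 2 \<or> t = 3" using t by linarith
  then have "core_ok t b" using rel
    by (elim disjE; cases l; cases r; cases u; cases d;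
        simp add: core_ok_def full_sum_def core_sum_def core_def cell_rel_def b)
  then show ?thesis using b by blast
qed

text \<open>Sums at the vertices of a diamond with ends \<open>a\<close>, \<open>e\<close>, inner vertices \<open>m\<close>, \<open>n\<close> and outer
  neighbours \<open>p\<close>, \<open>q\<close> of the ends: a diamond transports the bit \<open>p\<close> to \<open>q\<close>.\<close>

lemma diamond:
  fixes p a m n e q :: bool
  shows "(of_bool p + of_bool m + of_bool n \<noteq> (of_bool a + of_bool n + of_bool e :: nat) \<and>
    of_bool p + of_bool m + of_bool n \<noteq> (of_bool a + of_bool m + of_bool e :: nat) \<and>
    of_bool a + of_bool n + of_bool e \<noteq> (of_bool a + of_bool m + of_bool e :: nat) \<and>
    of_bool a + of_bool n + of_bool e \<noteq> (of_bool m + of_bool n + of_bool q :: nat) \<and>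
    of_bool a + of_bool m + of_bool e \<noteq> (of_bool m + of_bool n + of_bool q :: nat)) \<longleftrightarrow>
    m \<noteq> n \<and> a = (\<not> p) \<and> e = (\<not> p) \<and> q = p"
  by (cases p; cases a; cases m; cases n; cases e; cases q; simp)

lemma less8: "i < 8 \<longleftrightarrow> i = 0 \<or> i = 1 \<or> i = 2 \<or> i = 3 \<or> i = 4 \<or> i = 5 \<or> i = 6 \<or> i = (7::nat)"
  by presburger

lemma core_wf:
  assumes "i < 8"
  shows "distinct (core t ! i)" "length (core t ! i) = (if i < 4 then 2 else 3)"
    "j \<in> set (core t ! i) \<Longrightarrow> j < 8 \<and> i \<in> set (core t ! j) \<and> j \<noteq> i"
  using assms unfolding less8 core_def by (elim disjE; auto)+

section \<open>Cubic graphs assembled from cells\<close>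

text \<open>Nothing is assumed of the arrangement but two pairs of mutually inverse maps. A cell may
  even be its own neighbour.\<close>

locale cell_graph =
  fixes C :: nat and rgt lft dn up ty :: "nat \<Rightarrow> nat"
  assumes rgt: "\<And>c. c < C \<Longrightarrow> rgt c < C \<and> lft (rgt c) = c"
    and lft: "\<And>c. c < C \<Longrightarrow> lft c < C \<and> rgt (lft c) = c"
    and dn: "\<And>c. c < C \<Longrightarrow> dn c < C \<and> up (dn c) = c"
    and up: "\<And>c. c < C \<Longrightarrow> up c < C \<and> dn (up c) = c"
    and ty: "\<And>c. ty c < 4"
begin

definition port_nb :: "nat \<Rightarrow> nat \<Rightarrow> (nat \<times> nat) list" where
  "port_nb c i = (if i = 0 then [(lft c, 11)] else if i = 1 then [(c, 8)]
     else if i = 2 then [(up c, 15)] else if i = 3 then [(c, 12)] else [])"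

text \<open>Vertices 8 to 11 form the diamond from the right port to the left port of the cell on
  the right, 12 to 15 the one from the lower port to the upper port of the cell below. The ends are
  8, 11 and 12, 15.\<close>

definition diamond_nb :: "nat \<Rightarrow> nat \<Rightarrow> (nat \<times> nat) list" where
  "diamond_nb c i = (if i = 8 then [(c, 1), (c, 9), (c, 10)] else if i = 9 then [(c, 8), (c, 10), (c, 11)]
     else if i = 10 then [(c, 8), (c, 9), (c, 11)] else if i = 11 then [(c, 9), (c, 10), (rgt c, 0)]
     else if i = 12 then [(c, 3), (c, 13), (c, 14)] else if i = 13 then [(c, 12), (c, 14), (c, 15)]
     else if i = 14 then [(c, 12), (c, 13), (c, 15)] else [(c, 13), (c, 14), (dn c, 2)])"

definition nb :: "nat \<Rightarrow> nat \<Rightarrow> (nat \<times> nat) list" where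
  "nb c i = (if i < 8 then map (Pair c) (core (ty c) ! i) @ port_nb c i else diamond_nb c i)"

lemma nb_simps:
  "nb c 0 = map (Pair c) (core (ty c) ! 0) @ [(lft c, 11)]"
  "nb c (Suc 0) = map (Pair c) (core (ty c) ! 1) @ [(c, 8)]"
  "nb c 2 = map (Pair c) (core (ty c) ! 2) @ [(up c, 15)]"
  "nb c 3 = map (Pair c) (core (ty c) ! 3) @ [(c, 12)]"
  "nb c 4 = map (Pair c) (core (ty c) ! 4)"
  "nb c 5 = map (Pair c) (core (ty c) ! 5)"
  "nb c 6 = map (Pair c) (core (ty c) ! 6)"
  "nb c 7 = map (Pair c) (core (ty c) ! 7)"
  "nb c 8 = [(c, 1), (c, 9), (c, 10)]"
  "nb c 9 = [(c, 8), (c, 10), (c, 11)]"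
  "nb c 10 = [(c, 8), (c, 9), (c, 11)]"
  "nb c 11 = [(c, 9), (c, 10), (rgt c, 0)]"
  "nb c 12 = [(c, 3), (c, 13), (c, 14)]"
  "nb c 13 = [(c, 12), (c, 14), (c, 15)]"
  "nb c 14 = [(c, 12), (c, 13), (c, 15)]"
  "nb c 15 = [(c, 13), (c, 14), (dn c, 2)]"
  by (simp_all add: nb_def port_nb_def diamond_nb_def)

lemma nb_regular:
  assumes "i < 16" shows "distinct (nb c i)" "length (nb c i) = 3"
proof -
  have c: "distinct (core (ty c) ! j)" "length (core (ty c) ! j) = (if j < 4 then 2 else 3)"
    "k \<in> set (core (ty c) ! j) \<Longrightarrow> k < 8" if "j < 8" for j k
    using core_wf[OF that] by blast+
  have "distinct (nb c i) \<and> length (nb c i) = 3"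
  proof (cases "i < 8")
    case True
    have "distinct (map (Pair c) (core (ty c) ! i))"
      using c(1)[OF True] by (simp add: distinct_map inj_on_def)
    moreover have "8 \<notin> set (core (ty c) ! i)" "11 \<notin> set (core (ty c) ! i)" "12 \<notin> set (core (ty c) ! i)"
      "15 \<notin> set (core (ty c) ! i)"
      using c(3)[OF True] by fastforce+
    ultimately show ?thesis using c(2)[OF True]
      by (auto simp: nb_def True port_nb_def)
  next
    case False
    then show ?thesis using assms by (auto simp: nb_def diamond_nb_def)
  qed
  then show "distinct (nb c i)" "length (nb c i) = 3" by auto
qed

text \<open>The conjunct \<open>i' \<noteq> i\<close> excludes loops even where a cell is its own
  neighbour, since edges always join different places within cells.\<close>

lemma nb_sym:
  assumes "c < C" "i < 16" "(c', i') \<in> set (nb c i)"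
  shows "c' < C \<and> i' < 16 \<and> (c, i) \<in> set (nb c' i') \<and> i' \<noteq> i"
proof (cases "i < 8")
  case True
  from assms(3) consider j where "(c', i') = (c, j)" "j \<in> set (core (ty c) ! i)" | "(c', i') \<in> set (port_nb c i)"
    by (auto simp: nb_def True)
  then show ?thesis
  proof cases
    case 1
    then show ?thesis using core_wf(3)[OF True 1(2)] assms(1) by (auto simp: nb_def)
  next
    case 2
    then show ?thesis using assms(1) lft[OF assms(1)] up[OF assms(1)]
      by (auto simp: port_nb_def nb_def diamond_nb_def split: if_splits)
  qed
next
  case False
  then have "i = 8 \<or> i = 9 \<or> i = 10 \<or> i = 11 \<or> i = 12 \<or> i = 13 \<or> i = 14 \<or> i = 15"
    using assms(2) by linarith
  then show ?thesis using assms(1,3) rgt[OF assms(1)] dn[OF assms(1)]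
    by (elim disjE) (auto simp: nb_def port_nb_def diamond_nb_def)
qed

definition nsum :: "(nat \<Rightarrow> nat \<Rightarrow> bool) \<Rightarrow> nat \<Rightarrow> nat \<Rightarrow> nat" where
  "nsum b c i = (\<Sum>(c', i') \<leftarrow> nb c i. of_bool (b c' i'))"

definition lucky_bits :: "(nat \<Rightarrow> nat \<Rightarrow> bool) \<Rightarrow> bool" where
  "lucky_bits b \<longleftrightarrow> (\<forall>c<C. \<forall>i<16. \<forall>(c', i') \<in> set (nb c i). nsum b c i \<noteq> nsum b c' i')"

lemma nsum_core:
  assumes "i < 8"
  shows "nsum b c i = core_sum (ty c) (b c) i + (\<Sum>(c', i') \<leftarrow> port_nb c i. of_bool (b c' i'))"
  using assms by (simp add: nsum_def nb_def core_sum_def comp_def)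

lemma nsum_diamond:
  "nsum b c 8 = of_bool (b c 1) + of_bool (b c 9) + of_bool (b c 10)"
  "nsum b c 9 = of_bool (b c 8) + of_bool (b c 10) + of_bool (b c 11)"
  "nsum b c 10 = of_bool (b c 8) + of_bool (b c 9) + of_bool (b c 11)"
  "nsum b c 11 = of_bool (b c 9) + of_bool (b c 10) + of_bool (b (rgt c) 0)"
  "nsum b c 12 = of_bool (b c 3) + of_bool (b c 13) + of_bool (b c 14)"
  "nsum b c 13 = of_bool (b c 12) + of_bool (b c 14) + of_bool (b c 15)"
  "nsum b c 14 = of_bool (b c 12) + of_bool (b c 13) + of_bool (b c 15)"
  "nsum b c 15 = of_bool (b c 13) + of_bool (b c 14) + of_bool (b (dn c) 2)"
  by (simp_all add: nsum_def nb_def diamond_nb_def)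

definition diamonds_ok :: "(nat \<Rightarrow> nat \<Rightarrow> bool) \<Rightarrow> bool" where
  "diamonds_ok b \<longleftrightarrow> (\<forall>c<C. b c 9 \<noteq> b c 10 \<and> b c 8 = (\<not> b c 1) \<and> b c 11 = (\<not> b c 1) \<and> b (rgt c) 0 = b c 1 \<and>
     b c 13 \<noteq> b c 14 \<and> b c 12 = (\<not> b c 3) \<and> b c 15 = (\<not> b c 3) \<and> b (dn c) 2 = b c 3)"

text \<open>The outer neighbour of a port is an end of a diamond and carries the inverse bit. At the
  left and upper ports this diamond belongs to the adjacent cell, whence the inverse maps.\<close>

lemma nsum_full:
  assumes "diamonds_ok b" "c < C" "i < 8"
  shows "nsum b c i = full_sum (ty c) (b c) i"
proof -
  have "b (lft c) 11 = (\<not> b c 0)" using assms(1) lft[OF assms(2)] unfolding diamonds_ok_def by metis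
  moreover have "b (up c) 15 = (\<not> b c 2)" using assms(1) up[OF assms(2)] unfolding diamonds_ok_def by metis
  moreover have "b c 8 = (\<not> b c 1)" "b c 12 = (\<not> b c 3)" using assms(1,2) unfolding diamonds_ok_def by blast+
  ultimately show ?thesis using assms(3)
    by (auto simp: nsum_core full_sum_def port_nb_def less_Suc_eq numeral_eq_Suc)
qed

lemma nsum_diamond_ok:
  assumes "diamonds_ok b" "c < C"
  shows "nsum b c 8 = Suc (of_bool (b c 1))" "nsum b (lft c) 11 = Suc (of_bool (b c 0))"
    "nsum b c 12 = Suc (of_bool (b c 3))" "nsum b (up c) 15 = Suc (of_bool (b c 2))"
proof -
  have *: "b c 9 \<noteq> b c 10" "b c 13 \<noteq> b c 14" "b (lft c) 9 \<noteq> b (lft c) 10" "b (up c) 13 \<noteq> b (up c) 14"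
    using assms lft[OF assms(2)] up[OF assms(2)] unfolding diamonds_ok_def by blast+
  show "nsum b c 8 = Suc (of_bool (b c 1))" "nsum b c 12 = Suc (of_bool (b c 3))"
    unfolding nsum_diamond using *(1,2) by (auto simp: of_bool_def)
  show "nsum b (lft c) 11 = Suc (of_bool (b c 0))" "nsum b (up c) 15 = Suc (of_bool (b c 2))"
    unfolding nsum_diamond using *(3,4) lft[OF assms(2)] up[OF assms(2)] by (auto simp: of_bool_def)
qed

lemma full_sum_ne:
  "(full_sum t b 0 \<noteq> Suc (of_bool (b 0))) = (core_sum t b 0 \<noteq> 2 * of_bool (b 0))"
  "(full_sum t b 1 \<noteq> Suc (of_bool (b 1))) = (core_sum t b 1 \<noteq> 2 * of_bool (b 1))"
  "(full_sum t b 2 \<noteq> Suc (of_bool (b 2))) = (core_sum t b 2 \<noteq> 2 * of_bool (b 2))"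
  "(full_sum t b 3 \<noteq> Suc (of_bool (b 3))) = (core_sum t b 3 \<noteq> 2 * of_bool (b 3))"
  by (auto simp: full_sum_def of_bool_def)

text \<open>The five edges of each diamond give \<open>diamonds_ok\<close> through
  \<open>diamond\<close>. Once it holds, the sums in a core and at the adjoining ends of diamonds
  depend only on the eight core bits, and the remaining edges amount to
  \<open>core_ok\<close>.\<close>

lemma lucky_bits_iff: "lucky_bits b \<longleftrightarrow> diamonds_ok b \<and> (\<forall>c<C. core_ok (ty c) (b c))"
proof
  assume L: "lucky_bits b"
  have ne: "nsum b c i \<noteq> nsum b c' i'" if "c < C" "i < 16" "(c', i') \<in> set (nb c i)" for c i c' i'
    using L that unfolding lucky_bits_def by fast
  have d: "diamonds_ok b"
    unfolding diamonds_ok_def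
  proof (intro allI impI)
    fix c assume c: "c < C"
    have "nsum b c 8 \<noteq> nsum b c 9 \<and> nsum b c 8 \<noteq> nsum b c 10 \<and> nsum b c 9 \<noteq> nsum b c 10 \<and>
        nsum b c 9 \<noteq> nsum b c 11 \<and> nsum b c 10 \<noteq> nsum b c 11"
      by (intro conjI ne[OF c]) (simp_all add: nb_simps)
    then have 1: "b c 9 \<noteq> b c 10 \<and> b c 8 = (\<not> b c 1) \<and> b c 11 = (\<not> b c 1) \<and> b (rgt c) 0 = b c 1"
      unfolding nsum_diamond diamond .
    have "nsum b c 12 \<noteq> nsum b c 13 \<and> nsum b c 12 \<noteq> nsum b c 14 \<and> nsum b c 13 \<noteq> nsum b c 14 \<and>
        nsum b c 13 \<noteq> nsum b c 15 \<and> nsum b c 14 \<noteq> nsum b c 15"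
      by (intro conjI ne[OF c]) (simp_all add: nb_simps)
    then have 2: "b c 13 \<noteq> b c 14 \<and> b c 12 = (\<not> b c 3) \<and> b c 15 = (\<not> b c 3) \<and> b (dn c) 2 = b c 3"
      unfolding nsum_diamond diamond .
    from 1 2 show "b c 9 \<noteq> b c 10 \<and> b c 8 = (\<not> b c 1) \<and> b c 11 = (\<not> b c 1) \<and> b (rgt c) 0 = b c 1 \<and>
     b c 13 \<noteq> b c 14 \<and> b c 12 = (\<not> b c 3) \<and> b c 15 = (\<not> b c 3) \<and> b (dn c) 2 = b c 3" by blast
  qed
  have "core_ok (ty c) (b c)" if c: "c < C" for c
  proof -
    note S = nsum_full[OF d c]
    have "full_sum (ty c) (b c) i \<noteq> full_sum (ty c) (b c) j" if i: "i < 8" "j \<in> set (core (ty c) ! i)" for i j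
    proof -
      have "nsum b c i \<noteq> nsum b c j" by (rule ne[OF c]) (use i in \<open>auto simp: nb_def\<close>)
      then show ?thesis using S core_wf(3)[OF i] i by simp
    qed
    moreover have "full_sum (ty c) (b c) 0 \<noteq> Suc (of_bool (b c 0))"
    proof -
      have "nsum b c 0 \<noteq> nsum b (lft c) 11" by (rule ne[OF c]) (simp_all add: nb_simps)
      then show ?thesis using S[of 0] nsum_diamond_ok[OF d c] by simp
    qed
    moreover have "full_sum (ty c) (b c) 1 \<noteq> Suc (of_bool (b c 1))"
    proof -
      have "nsum b c 1 \<noteq> nsum b c 8" by (rule ne[OF c]) (simp_all add: nb_simps)
      then show ?thesis using S[of 1] nsum_diamond_ok[OF d c] by simp
    qed
    moreover have "full_sum (ty c) (b c) 2 \<noteq> Suc (of_bool (b c 2))"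
    proof -
      have "nsum b c 2 \<noteq> nsum b (up c) 15" by (rule ne[OF c]) (simp_all add: nb_simps)
      then show ?thesis using S[of 2] nsum_diamond_ok[OF d c] by simp
    qed
    moreover have "full_sum (ty c) (b c) 3 \<noteq> Suc (of_bool (b c 3))"
    proof -
      have "nsum b c 3 \<noteq> nsum b c 12" by (rule ne[OF c]) (simp_all add: nb_simps)
      then show ?thesis using S[of 3] nsum_diamond_ok[OF d c] by simp
    qed
    ultimately show ?thesis unfolding core_ok_def full_sum_ne by simp
  qed
  then show "diamonds_ok b \<and> (\<forall>c<C. core_ok (ty c) (b c))" using d by blast
next
  assume H: "diamonds_ok b \<and> (\<forall>c<C. core_ok (ty c) (b c))"
  then have d: "diamonds_ok b" by blast
  have core: "full_sum (ty c) (b c) i \<noteq> full_sum (ty c) (b c) j" if "c < C" "i < 8" "j \<in> set (core (ty c) ! i)" for c i j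
  proof -
    have "i \<in> set [0,1,2,3,4,5,6,7]" using that(2) by auto
    then show ?thesis using H that unfolding core_ok_def by blast
  qed
  have port: "full_sum (ty c) (b c) 0 \<noteq> Suc (of_bool (b c 0))" "full_sum (ty c) (b c) 1 \<noteq> Suc (of_bool (b c 1))"
    "full_sum (ty c) (b c) 2 \<noteq> Suc (of_bool (b c 2))" "full_sum (ty c) (b c) 3 \<noteq> Suc (of_bool (b c 3))"
    if "c < C" for c
    using H that unfolding core_ok_def full_sum_ne by auto
  have port': "nsum b c 0 \<noteq> nsum b (lft c) 11" "nsum b c 1 \<noteq> nsum b c 8"
    "nsum b c 2 \<noteq> nsum b (up c) 15" "nsum b c 3 \<noteq> nsum b c 12" if c: "c < C" for c
    using port[OF c] nsum_full[OF d c] nsum_diamond_ok[OF d c] by simp_all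
  have port'': "nsum b c 11 \<noteq> nsum b (rgt c) 0" "nsum b c 15 \<noteq> nsum b (dn c) 2" if c: "c < C" for c
    using port'(1)[of "rgt c"] port'(3)[of "dn c"] rgt[OF c] dn[OF c] by auto
  have dia: "nsum b c 8 \<noteq> nsum b c 9 \<and> nsum b c 8 \<noteq> nsum b c 10 \<and> nsum b c 9 \<noteq> nsum b c 10 \<and>
        nsum b c 9 \<noteq> nsum b c 11 \<and> nsum b c 10 \<noteq> nsum b c 11"
    "nsum b c 12 \<noteq> nsum b c 13 \<and> nsum b c 12 \<noteq> nsum b c 14 \<and> nsum b c 13 \<noteq> nsum b c 14 \<and>
        nsum b c 13 \<noteq> nsum b c 15 \<and> nsum b c 14 \<noteq> nsum b c 15" if c: "c < C" for c
    using d c unfolding nsum_diamond diamond diamonds_ok_def by blast+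
  show "lucky_bits b"
    unfolding lucky_bits_def
  proof (intro allI impI ballI, clarify)
    fix c i c' i'
    assume c: "c < C" and i: "i < 16" and n: "(c', i') \<in> set (nb c i)" and eq: "nsum b c i = nsum b c' i'"
    show False
    proof (cases "i < 8")
      case True
      from n consider j where "(c', i') = (c, j)" "j \<in> set (core (ty c) ! i)" | "(c', i') \<in> set (port_nb c i)"
        by (auto simp: nb_def True)
      then show False
      proof cases
        case 1
        then show False using core[OF c True 1(2)] core_wf(3)[OF True 1(2)] nsum_full[OF d c] True eq by simp
      next
        case 2
        then show False using port'[OF c] eq by (auto simp: port_nb_def split: if_splits)
      qed
    next
      case False
      then have "i = 8 \<or> i = 9 \<or> i = 10 \<or> i = 11 \<or> i = 12 \<or> i = 13 \<or> i = 14 \<or> i = 15"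
        using i by linarith
      then show False using n eq dia[OF c] port'[OF c] port''[OF c]
        by (elim disjE) (auto simp: nb_simps)
    qed
  qed
qed

text \<open>Cells meet only in their port bits, while the bits of the other core vertices are
  private. Given consistent port bits, these can therefore be chosen cell by cell.\<close>

lemma lucky_bits_exists_iff:
  "(\<exists>b. lucky_bits b) \<longleftrightarrow>
   (\<exists>L R U D. \<forall>c<C. cell_rel (ty c) (L c) (R c) (U c) (D c) \<and> L (rgt c) = R c \<and> U (dn c) = D c)"
proof
  assume "\<exists>b. lucky_bits b"
  then obtain b where b: "diamonds_ok b" "\<forall>c<C. core_ok (ty c) (b c)" using lucky_bits_iff by blast
  then have "\<forall>c<C. cell_rel (ty c) (b c 0) (b c 1) (b c 2) (b c 3) \<and> b (rgt c) 0 = b c 1 \<and> b (dn c) 2 = b c 3"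
    using core_ok_rel[OF ty] unfolding diamonds_ok_def by (intro allI impI conjI) simp_all
  then show "\<exists>L R U D. \<forall>c<C. cell_rel (ty c) (L c) (R c) (U c) (D c) \<and> L (rgt c) = R c \<and> U (dn c) = D c"
    by (intro exI[of _ "\<lambda>c. b c 0"] exI[of _ "\<lambda>c. b c 1"] exI[of _ "\<lambda>c. b c 2"] exI[of _ "\<lambda>c. b c 3"])
next
  assume "\<exists>L R U D. \<forall>c<C. cell_rel (ty c) (L c) (R c) (U c) (D c) \<and> L (rgt c) = R c \<and> U (dn c) = D c"
  then obtain L R U D where H: "\<And>c. c < C \<Longrightarrow> cell_rel (ty c) (L c) (R c) (U c) (D c)"
    "\<And>c. c < C \<Longrightarrow> L (rgt c) = R c" "\<And>c. c < C \<Longrightarrow> U (dn c) = D c" by blast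
  then have "\<forall>c. \<exists>w. c < C \<longrightarrow> core_ok (ty c) w \<and> w 0 = L c \<and> w 1 = R c \<and> w 2 = U c \<and> w 3 = D c"
    using core_rel_ok[OF ty] by (metis (no_types))
  from choice[OF this] obtain w where "\<forall>c. c < C \<longrightarrow> core_ok (ty c) (w c) \<and> w c 0 = L c \<and> w c 1 = R c \<and>
      w c 2 = U c \<and> w c 3 = D c"
    by (elim exE)
  then have w: "\<And>c. c < C \<Longrightarrow> core_ok (ty c) (w c)" "\<And>c. c < C \<Longrightarrow> w c 0 = L c"
    "\<And>c. c < C \<Longrightarrow> w c 1 = R c" "\<And>c. c < C \<Longrightarrow> w c 2 = U c" "\<And>c. c < C \<Longrightarrow> w c 3 = D c"
    by simp_all
  \<comment> \<open>The ends of a diamond get the inverse of the transported bit. For the two inner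
    vertices any unequal pair of bits would do.\<close>
  define b where "b c i = (if i < 8 then w c i else if i = 8 \<or> i = 11 then \<not> R c else
    if i = 12 \<or> i = 15 then \<not> D c else i = 9 \<or> i = 13)" for c i
  have "diamonds_ok b"
    unfolding diamonds_ok_def using w H rgt dn by (simp add: b_def)
  moreover have "core_ok (ty c) (b c)" if "c < C" for c
  proof -
    have "core_sum (ty c) (b c) i = core_sum (ty c) (w c) i" if "i < 8" for i
      unfolding core_sum_def
      by (rule arg_cong[where f = sum_list], rule map_cong) (use core_wf(3)[OF that] in \<open>auto simp: b_def\<close>)
    moreover have "b c i = w c i" if "i < 8" for i using that by (simp add: b_def)
    ultimately have fs: "full_sum (ty c) (b c) i = full_sum (ty c) (w c) i" 
      "core_sum (ty c) (b c) i = core_sum (ty c) (w c) i" "b c i = w c i" if "i < 8" for i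
      using that by (simp_all add: full_sum_def)
    note ok = w(1)[OF that, unfolded core_ok_def]
    show ?thesis
      unfolding core_ok_def
    proof (intro conjI ballI)
      fix i j :: nat assume i: "i \<in> set [0,1,2,3,4,5,6,7]" and j: "j \<in> set (core (ty c) ! i)"
      have i8: "i < 8" using i by auto
      have "full_sum (ty c) (w c) i \<noteq> full_sum (ty c) (w c) j" using ok i j by blast
      then show "full_sum (ty c) (b c) i \<noteq> full_sum (ty c) (b c) j"
        using fs(1) i8 core_wf(3)[OF i8 j] by simp
    next
      fix i :: nat assume i: "i \<in> set [0,1,2,3]"
      have i8: "i < 8" using i by auto
      have "core_sum (ty c) (w c) i \<noteq> 2 * of_bool (w c i)" using ok i by blast
      then show "core_sum (ty c) (b c) i \<noteq> 2 * of_bool (b c i)" using fs(2,3)[OF i8] by simp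
    qed
  qed
  ultimately show "\<exists>b. lucky_bits b" using lucky_bits_iff by blast
qed

end

section \<open>Lucky number two on cubic graphs\<close>

definition in_nbs :: "'a pair_pre_digraph \<Rightarrow> 'a \<Rightarrow> 'a set" where
  "in_nbs G v = {w. (w, v) \<in> parcs G}"

lemma pair_graph_facts:
  assumes "pair_graph G"
  shows "finite (pverts G)" "(u, v) \<in> parcs G \<Longrightarrow> u \<in> pverts G" "(u, v) \<in> parcs G \<Longrightarrow> v \<in> pverts G"
    "(u, v) \<in> parcs G \<Longrightarrow> (v, u) \<in> parcs G" "(u, u) \<notin> parcs G"
proof -
  interpret pair_graph G by fact
  show "finite (pverts G)" by simp
  show "(u, v) \<in> parcs G \<Longrightarrow> u \<in> pverts G" using in_arcsD1 by auto
  show "(u, v) \<in> parcs G \<Longrightarrow> v \<in> pverts G" using in_arcsD2 by auto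
  show "(u, v) \<in> parcs G \<Longrightarrow> (v, u) \<in> parcs G" using arcs_symmetric by auto
  show "(u, u) \<notin> parcs G" using pair_no_loops by fastforce
qed

lemma out_degree_card:
  assumes "pair_graph G" shows "out_degree (with_proj G) v = card (in_nbs G v)"
proof -
  have "bij_betw snd {e \<in> parcs G. fst e = v} (in_nbs G v)"
  proof (rule bij_betw_imageI)
    show "inj_on snd {e \<in> parcs G. fst e = v}" by (auto simp: inj_on_def prod_eq_iff)
    show "snd ` {e \<in> parcs G. fst e = v} = in_nbs G v"
      using pair_graph_facts(4)[OF assms] by (force simp: in_nbs_def)
  qed
  then show ?thesis
    by (simp add: out_degree_def out_arcs_def bij_betw_same_card)
qed

lemma lucky_number_2_iff:
  assumes G: "pair_graph G" and reg: "regular 3 G"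
  shows "lucky_number G = 2 \<longleftrightarrow> pverts G \<noteq> {} \<and>
    (\<exists>b. \<forall>(u, v) \<in> parcs G. (\<Sum>w \<in> in_nbs G u. of_bool (b w)) \<noteq> (\<Sum>w \<in> in_nbs G v. of_bool (b w) :: nat))"
proof -
  note facts = pair_graph_facts[OF G]
  let ?P = "\<lambda>k. 0 < k \<and> (\<exists>l. lucky_labeling G l \<and> (\<forall>v \<in> pverts G. l v \<in> {1..k}))"
  have card3: "card (in_nbs G v) = 3" if "v \<in> pverts G" for v
    using reg that out_degree_card[OF G] by (simp add: regular_def)
  have sum: "(\<Sum>w | (w, u) \<in> parcs G. l w) = 3 + (\<Sum>w \<in> in_nbs G u. of_bool (b w))"
    if "u \<in> pverts G" "\<And>w. w \<in> pverts G \<Longrightarrow> l w = Suc (of_bool (b w))" for u and l :: "'a \<Rightarrow> nat" and b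
  proof -
    have "(\<Sum>w \<in> in_nbs G u. l w) = (\<Sum>w \<in> in_nbs G u. 1 + of_bool (b w))"
      by (rule sum.cong) (use that facts(2) in \<open>auto simp: in_nbs_def\<close>)
    also have "\<dots> = (\<Sum>w \<in> in_nbs G u. 1) + (\<Sum>w \<in> in_nbs G u. of_bool (b w))" by (rule sum.distrib)
    finally show ?thesis using card3[OF that(1)] by (simp only: card_eq_sum in_nbs_def)
  qed
  show ?thesis
  proof (intro iffI conjI)
    assume two: "lucky_number G = 2"
    have ex: "\<exists>k. ?P k" using lucky_labeling_exists[OF G] by blast
    show "pverts G \<noteq> {}"
    proof
      \<comment> \<open>The empty graph is 3-regular too, but its lucky number is 1.\<close>
      assume "pverts G = {}"
      then have "?P 1" using facts(2) by (auto simp: lucky_labeling_def)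
      then have "lucky_number G \<le> 1" unfolding lucky_number_def by (rule Least_le)
      then show False using two by simp
    qed
    have "?P (lucky_number G)" unfolding lucky_number_def by (rule LeastI_ex[OF ex])
    then obtain l where l: "lucky_labeling G l" "\<forall>v \<in> pverts G. l v \<in> {1..2}" using two by auto
    let ?b = "\<lambda>v. l v = 2"
    have lb: "l w = Suc (of_bool (?b w))" if "w \<in> pverts G" for w
    proof -
      have "l w \<in> {1..2}" using l(2) that by blast
      then have "l w = 1 \<or> l w = 2" by auto
      then show ?thesis by auto
    qed
    have "(\<Sum>w \<in> in_nbs G u. of_bool (?b w)) \<noteq> (\<Sum>w \<in> in_nbs G v. of_bool (?b w) :: nat)" if uv: "(u, v) \<in> parcs G" for u v
    proof -
      have "(\<Sum>w | (w, u) \<in> parcs G. l w) \<noteq> (\<Sum>w | (w, v) \<in> parcs G. l w)"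
        using l(1) uv unfolding lucky_labeling_def by blast
      moreover have "(\<Sum>w | (w, u) \<in> parcs G. l w) = 3 + (\<Sum>w \<in> in_nbs G u. of_bool (?b w))"
        by (rule sum[OF facts(2)[OF uv] lb])
      moreover have "(\<Sum>w | (w, v) \<in> parcs G. l w) = 3 + (\<Sum>w \<in> in_nbs G v. of_bool (?b w))"
        by (rule sum[OF facts(3)[OF uv] lb])
      ultimately show ?thesis by metis
    qed
    then show "\<exists>b. \<forall>(u, v) \<in> parcs G. (\<Sum>w \<in> in_nbs G u. of_bool (b w)) \<noteq> (\<Sum>w \<in> in_nbs G v. of_bool (b w) :: nat)"
      by (intro exI[of _ ?b]) auto
  next
    assume "pverts G \<noteq> {} \<and>
      (\<exists>b. \<forall>(u, v) \<in> parcs G. (\<Sum>w \<in> in_nbs G u. of_bool (b w)) \<noteq> (\<Sum>w \<in> in_nbs G v. of_bool (b w) :: nat))"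
    then obtain b v0 where v0: "v0 \<in> pverts G" and b: "\<forall>(u, v) \<in> parcs G.
      (\<Sum>w \<in> in_nbs G u. of_bool (b w)) \<noteq> (\<Sum>w \<in> in_nbs G v. of_bool (b w) :: nat)" by blast
    have "in_nbs G v0 \<noteq> {}" using card3[OF v0] by auto
    then obtain u0 where u0: "(u0, v0) \<in> parcs G" by (auto simp: in_nbs_def)
    have "lucky_labeling G (\<lambda>w. Suc (of_bool (b w)))"
      unfolding lucky_labeling_def
    proof (intro allI impI)
      fix u v assume uv: "(u, v) \<in> parcs G"
      then show "(\<Sum>w | (w, u) \<in> parcs G. Suc (of_bool (b w))) \<noteq> (\<Sum>w | (w, v) \<in> parcs G. Suc (of_bool (b w)))"
        using b sum[OF facts(2)[OF uv], of "\<lambda>w. Suc (of_bool (b w))" b]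
          sum[OF facts(3)[OF uv], of "\<lambda>w. Suc (of_bool (b w))" b] by fastforce
    qed
    then have "?P 2" by (intro conjI exI[of _ "\<lambda>w. Suc (of_bool (b w))"]) auto
    moreover have "2 \<le> k" if "?P k" for k
    proof (rule ccontr)
      assume "\<not> 2 \<le> k"
      then have "k = 1" using that by auto
      from that obtain l where l1: "lucky_labeling G l" "\<forall>v \<in> pverts G. l v \<in> {1..k}" by blast
      then have l: "lucky_labeling G l" "\<And>v. v \<in> pverts G \<Longrightarrow> l v = Suc (of_bool False)"
        using \<open>k = 1\<close> by auto
      have s: "(\<Sum>w | (w, v) \<in> parcs G. l w) = 3" if "v \<in> pverts G" for v
        using sum[of v l "\<lambda>_. False", OF that l(2)] by simp
      then show False using l(1) u0 s[OF facts(2)[OF u0]] s[OF facts(3)[OF u0]]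
        unfolding lucky_labeling_def by fastforce
    qed
    ultimately show "lucky_number G = 2" unfolding lucky_number_def by (rule Least_equality)
  qed
qed

section \<open>Adjacency matrices and membership in NP\<close>

definition matrix_graph :: "nat \<Rightarrow> (nat \<Rightarrow> nat \<Rightarrow> bool) \<Rightarrow> nat pair_pre_digraph" where
  "matrix_graph n A = \<lparr>pverts = {..<n}, parcs = {(i, j). i < n \<and> j < n \<and> A i j}\<rparr>"

lemma matrix_graph_simps [simp]:
  "pverts (matrix_graph n A) = {..<n}"
  "(i, j) \<in> parcs (matrix_graph n A) \<longleftrightarrow> i < n \<and> j < n \<and> A i j"
  by (auto simp: matrix_graph_def)

lemma pair_graph_matrix_graph:
  assumes "\<And>i j. i < n \<Longrightarrow> j < n \<Longrightarrow> A i j \<Longrightarrow> A j i" "\<And>i. i < n \<Longrightarrow> \<not> A i i"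
  shows "pair_graph (matrix_graph n A)"
proof
  have sub: "parcs (matrix_graph n A) \<subseteq> {..<n} \<times> {..<n}" by (auto simp: matrix_graph_def)
  then show "finite (parcs (matrix_graph n A))" by (rule finite_subset) simp
  show "finite (pverts (matrix_graph n A))" by simp
  show "fst e \<in> pverts (matrix_graph n A)" "snd e \<in> pverts (matrix_graph n A)" "fst e \<noteq> snd e"
    if "e \<in> parcs (matrix_graph n A)" for e
    using that assms(2) by (auto simp: matrix_graph_def)
  show "symmetric (with_proj (matrix_graph n A))"
    using assms(1) by (auto simp: symmetric_def sym_def)
qed

lemma matrix_graph_of:
  assumes "pair_graph G" "pverts G = {..<n}"
  shows "G = matrix_graph n (\<lambda>i j. (i, j) \<in> parcs G)"
proof -
  have "parcs G = {(i, j). i < n \<and> j < n \<and> (i, j) \<in> parcs G}"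
    using pair_graph_facts(2,3)[OF assms(1)] assms(2) by auto
  then show ?thesis using assms(2) by (cases G) (simp add: matrix_graph_def)
qed

text \<open>Bit \<open>k\<close> of the encoding; the separator at \<open>k = n\<close> satisfies
  neither disjunct. A predicate on positions is what a reduction has to decide.\<close>

definition matrix_code :: "nat \<Rightarrow> (nat \<Rightarrow> nat \<Rightarrow> bool) \<Rightarrow> nat \<Rightarrow> bool" where
  "matrix_code n A k \<longleftrightarrow> k < n \<or> n < k \<and> A ((k - n - 1) div n) ((k - n - 1) mod n)"

lemma concat_matrix:
  "concat (map (\<lambda>i. map (f i) [0..<m]) [0..<n]) = map (\<lambda>k. f (k div m) (k mod m)) [0..<n * m]"
proof (induction n)
  case (Suc n)
  have "map (\<lambda>k. f (k div m) (k mod m)) [n * m..<n * m + m] = map (f n) [0..<m]"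
    by (rule nth_equalityI) auto
  moreover have "[0..<Suc n * m] = [0..<n * m] @ [n * m..<n * m + m]"
    using upt_add_eq_append[of 0 "n * m" m] by (simp add: add.commute)
  ultimately show ?case using Suc by simp
qed simp

lemma encode_matrix_graph:
  "encode_graph (matrix_graph n A) = map (matrix_code n A) [0..<n + 1 + n * n]"
proof -
  have "[0..<n + 1 + n * n] = [0..<n] @ [n] @ [n + 1..<n + 1 + n * n]"
    using upt_add_eq_append[of 0 n "1 + n * n"] by (simp add: upt_conv_Cons del: upt_Suc)
  moreover have "map (matrix_code n A) [0..<n] = replicate n True"
    by (rule nth_equalityI) (auto simp: matrix_code_def)
  moreover have "map (matrix_code n A) [n] = [False]" by (simp add: matrix_code_def)
  moreover have "map (matrix_code n A) [n + 1..<n + 1 + n * n] =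
      map (\<lambda>k. (k div n, k mod n) \<in> parcs (matrix_graph n A)) [0..<n * n]"
  proof (rule nth_equalityI)
    fix k assume "k < length (map (matrix_code n A) [n + 1..<n + 1 + n * n])"
    then have k: "k < n * n" by (simp del: upt_Suc)
    then have "0 < n" by (cases n) auto
    then have "k div n < n" "k mod n < n" using k by (auto simp: less_mult_imp_div_less)
    then show "map (matrix_code n A) [n + 1..<n + 1 + n * n] ! k =
      map (\<lambda>k. (k div n, k mod n) \<in> parcs (matrix_graph n A)) [0..<n * n] ! k"
      using k by (simp add: matrix_code_def del: upt_Suc)
  qed (simp del: upt_Suc)
  ultimately show ?thesis
    unfolding encode_graph_def Let_def concat_matrix matrix_graph_simps card_lessThan by simp
qed

text \<open>Every quantifier and sum is bounded by \<open>n\<close>, so the body is itself a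
  decision procedure once \<open>A\<close> is read from the input and \<open>b\<close> from the
  certificate.\<close>

definition cubic_lucky_2 :: "nat \<Rightarrow> (nat \<Rightarrow> nat \<Rightarrow> bool) \<Rightarrow> (nat \<Rightarrow> bool) \<Rightarrow> bool" where
  "cubic_lucky_2 n A b \<longleftrightarrow> 0 < n \<and> (\<forall>i<n. \<not> A i i) \<and> (\<forall>i<n. \<forall>j<n. A i j \<longrightarrow> A j i) \<and>
     (\<forall>i<n. (\<Sum>j<n. of_bool (A i j)) = (3::nat)) \<and>
     (\<forall>i<n. \<forall>j<n. A i j \<longrightarrow>
        (\<Sum>w<n. of_bool (A w i \<and> b w)) \<noteq> (\<Sum>w<n. of_bool (A w j \<and> b w) :: nat))"

lemma cubic_lucky_2_cong:
  assumes b: "cubic_lucky_2 n A b" and A: "\<And>i j. i < n \<Longrightarrow> j < n \<Longrightarrow> A' i j = A i j"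
    and b': "\<And>i. i < n \<Longrightarrow> b' i = b i"
  shows "cubic_lucky_2 n A' b'"
proof -
  have s1: "(\<Sum>w<n. of_bool (A' w i \<and> b' w)) = (\<Sum>w<n. of_bool (A w i \<and> b w) :: nat)" if "i < n" for i
    using that A b' by (intro sum.cong) auto
  have s2: "(\<Sum>w<n. of_bool (A' i w)) = (\<Sum>w<n. of_bool (A i w) :: nat)" if "i < n" for i
    using that A by (intro sum.cong) auto
  show ?thesis
    unfolding cubic_lucky_2_def
  proof (intro conjI allI impI)
    show "0 < n" using b by (simp add: cubic_lucky_2_def)
    show "\<not> A' i i" if "i < n" for i using b A that by (simp add: cubic_lucky_2_def)
    show "A' j i" if "i < n" "j < n" "A' i j" for i j using b A that by (simp add: cubic_lucky_2_def)
    show "(\<Sum>w<n. of_bool (A' i w)) = (3::nat)" if "i < n" for i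
      using b that unfolding s2[OF that] cubic_lucky_2_def by blast
    show "(\<Sum>w<n. of_bool (A' w i \<and> b' w)) \<noteq> (\<Sum>w<n. of_bool (A' w j \<and> b' w) :: nat)"
      if "i < n" "j < n" "A' i j" for i j
      using b that A[OF that(1,2)] unfolding s1[OF that(1)] s1[OF that(2)] cubic_lucky_2_def by blast
  qed
qed

abbreviation (input) "cubic_lucky_problem \<equiv> graph_problem (\<lambda>G. regular 3 G \<and> lucky_number G = 2)"

lemma cubic_lucky_iff:
  "(pair_graph (matrix_graph n A) \<and> regular 3 (matrix_graph n A) \<and> lucky_number (matrix_graph n A) = 2) \<longleftrightarrow>
   (\<exists>b. cubic_lucky_2 n A b)" (is "?L \<longleftrightarrow> ?R")
proof -
  let ?G = "matrix_graph n A"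
  have nbs: "in_nbs ?G v = {w. w < n \<and> A w v}" if "v < n" for v using that by (auto simp: in_nbs_def)
  have sums: "(\<Sum>w \<in> in_nbs ?G v. of_bool (b w)) = (\<Sum>w<n. of_bool (A w v \<and> b w) :: nat)" if "v < n" for v b
  proof -
    have "(\<Sum>w<n. of_bool (A w v \<and> b w) :: nat) = (\<Sum>w<n. if A w v then of_bool (b w) else 0)"
      by (rule sum.cong) auto
    also have "\<dots> = (\<Sum>w \<in> {w \<in> {..<n}. A w v}. of_bool (b w))" by (rule sum.inter_filter[symmetric]) simp
    also have "{w \<in> {..<n}. A w v} = in_nbs ?G v" using nbs[OF that] by auto
    finally show ?thesis by (rule sym)
  qed
  have cards: "card (in_nbs ?G v) = (\<Sum>w<n. of_bool (A w v))" if "v < n" for v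
  proof -
    have "{w. w < n \<and> A w v} = {..<n} \<inter> {w. A w v}" by auto
    then show ?thesis using nbs[OF that] by (simp add: of_bool_def sum.If_cases)
  qed
  have reg: "regular 3 ?G \<longleftrightarrow> (\<forall>i<n. (\<Sum>j<n. of_bool (A i j)) = (3::nat))" if G: "pair_graph ?G"
  proof -
    have "A i j = A j i" if "i < n" "j < n" for i j
      using pair_graph_facts(4)[OF G, of i j] pair_graph_facts(4)[OF G, of j i] that by auto
    then have "(\<Sum>w<n. of_bool (A w v)) = (\<Sum>w<n. of_bool (A v w) :: nat)" if "v < n" for v
      using that by (intro sum.cong) auto
    then show ?thesis using cards by (auto simp: regular_def out_degree_card[OF G])
  qed
  have luck: "lucky_number ?G = 2 \<longleftrightarrow> 0 < n \<and> (\<exists>b. \<forall>i<n. \<forall>j<n. A i j \<longrightarrow>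
        (\<Sum>w<n. of_bool (A w i \<and> b w)) \<noteq> (\<Sum>w<n. of_bool (A w j \<and> b w) :: nat))"
    if "pair_graph ?G" "regular 3 ?G"
  proof -
    have "(\<forall>(u, v) \<in> parcs ?G. (\<Sum>w \<in> in_nbs ?G u. of_bool (b w)) \<noteq> (\<Sum>w \<in> in_nbs ?G v. of_bool (b w) :: nat)) \<longleftrightarrow>
      (\<forall>i<n. \<forall>j<n. A i j \<longrightarrow>
        (\<Sum>w<n. of_bool (A w i \<and> b w)) \<noteq> (\<Sum>w<n. of_bool (A w j \<and> b w) :: nat))" for b
    proof -
      have "(\<forall>(u, v) \<in> parcs ?G. Q u v) \<longleftrightarrow> (\<forall>i<n. \<forall>j<n. A i j \<longrightarrow> Q i j)" for Q
        by (auto simp: matrix_graph_def)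
      then show ?thesis using sums by (simp cong: imp_cong)
    qed
    moreover have "pverts ?G \<noteq> {} \<longleftrightarrow> 0 < n" by (cases n) auto
    ultimately show ?thesis unfolding lucky_number_2_iff[OF that] by simp
  qed
  show ?thesis
  proof
    assume L: ?L
    then have "A j i" if "i < n" "j < n" "A i j" for i j
      using that pair_graph_facts(4)[of ?G i j] by simp
    moreover have "\<not> A i i" if "i < n" for i
      using that L pair_graph_facts(5)[of ?G i] by simp
    ultimately show ?R using L luck reg unfolding cubic_lucky_2_def by blast
  next
    assume ?R
    then obtain b where b: "cubic_lucky_2 n A b" ..
    then have G: "pair_graph ?G" by (intro pair_graph_matrix_graph) (auto simp: cubic_lucky_2_def)
    moreover have r: "regular 3 ?G" unfolding reg[OF G] using b by (simp add: cubic_lucky_2_def)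
    moreover have "lucky_number ?G = 2" unfolding luck[OF G r] using b unfolding cubic_lucky_2_def by blast
    ultimately show ?L by blast
  qed
qed

lemma cubic_lucky_problem_iff:
  "x \<in> cubic_lucky_problem \<longleftrightarrow>
   (\<exists>n A b. x = map (matrix_code n A) [0..<n + 1 + n * n] \<and> cubic_lucky_2 n A b)"
proof
  assume "x \<in> cubic_lucky_problem"
  then obtain G where G: "x = encode_graph G" "pair_graph G" "pverts G = {..<card (pverts G)}"
    "regular 3 G" "lucky_number G = 2" by (auto simp: graph_problem_def)
  define n where "n = card (pverts G)"
  define A where "A = (\<lambda>i j. (i, j) \<in> parcs G)"
  have eq: "G = matrix_graph n A" unfolding n_def A_def by (rule matrix_graph_of[OF G(2,3)])
  then have "\<exists>b. cubic_lucky_2 n A b" using cubic_lucky_iff[of n A] G by simp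
  moreover have "x = map (matrix_code n A) [0..<n + 1 + n * n]"
    using G(1) eq encode_matrix_graph by metis
  ultimately show "\<exists>n A b. x = map (matrix_code n A) [0..<n + 1 + n * n] \<and> cubic_lucky_2 n A b" by blast
next
  assume "\<exists>n A b. x = map (matrix_code n A) [0..<n + 1 + n * n] \<and> cubic_lucky_2 n A b"
  then obtain n A b where x: "x = map (matrix_code n A) [0..<n + 1 + n * n]" and b: "cubic_lucky_2 n A b" by blast
  have "pair_graph (matrix_graph n A) \<and> regular 3 (matrix_graph n A) \<and> lucky_number (matrix_graph n A) = 2"
    using cubic_lucky_iff b by blast
  then show "x \<in> cubic_lucky_problem"
    unfolding graph_problem_def x encode_matrix_graph[symmetric]
    by (intro CollectI exI[of _ "matrix_graph n A"]) simp
qed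

text \<open>The number of vertices is recovered by bounded search. A position beyond the end of
  \<open>u\<close> counts as bit 0.\<close>

definition cubic_lucky_verifier :: "bool list \<Rightarrow> bool list \<Rightarrow> bool" where
  "cubic_lucky_verifier x u \<longleftrightarrow> (\<exists>n < length x. length x = n + 1 + n * n \<and> (\<forall>i<n. nth_bit x i) \<and> \<not> nth_bit x n \<and>
     cubic_lucky_2 n (\<lambda>i j. nth_bit x (n + 1 + i * n + j)) (nth_bit u))"

text \<open>\<open>[:0, 1:]\<close> is the identity: one bit per vertex is shorter than the encoding
  of the graph.\<close>

lemma cubic_lucky_problem_verifier:
  "x \<in> cubic_lucky_problem \<longleftrightarrow> (\<exists>u. length u \<le> poly [:0, 1:] (length x) \<and> cubic_lucky_verifier x u)"
proof
  assume "x \<in> cubic_lucky_problem"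
  then obtain n A b where x: "x = map (matrix_code n A) [0..<n + 1 + n * n]" and b: "cubic_lucky_2 n A b"
    unfolding cubic_lucky_problem_iff by blast
  let ?u = "map b [0..<n]"
  have bit: "nth_bit x k \<longleftrightarrow> k < n + 1 + n * n \<and> matrix_code n A k" for k
    by (auto simp: nth_bit_def x simp del: upt_Suc)
  have A: "nth_bit x (n + 1 + i * n + j) = A i j" if "i < n" "j < n" for i j
  proof -
    have "i * n + j < Suc i * n" using that by simp
    also have "\<dots> \<le> n * n" using that by (intro mult_le_mono1) simp
    finally show ?thesis using that unfolding bit by (simp add: matrix_code_def)
  qed
  have "cubic_lucky_2 n (\<lambda>i j. nth_bit x (n + 1 + i * n + j)) (nth_bit ?u)"
    by (rule cubic_lucky_2_cong[OF b]) (simp_all only: A, simp add: nth_bit_def)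
  moreover have "length x = n + 1 + n * n" by (simp add: x)
  moreover have "\<forall>i<n. nth_bit x i" "\<not> nth_bit x n" unfolding bit by (simp_all add: matrix_code_def)
  ultimately have "cubic_lucky_verifier x ?u"
    unfolding cubic_lucky_verifier_def by (intro exI[of _ n]) simp
  moreover have "length ?u \<le> poly [:0, 1:] (length x)" by (simp add: x)
  ultimately show "\<exists>u. length u \<le> poly [:0, 1:] (length x) \<and> cubic_lucky_verifier x u" by blast
next
  assume "\<exists>u. length u \<le> poly [:0, 1:] (length x) \<and> cubic_lucky_verifier x u"
  then obtain u n where n: "length x = n + 1 + n * n" "\<forall>i<n. nth_bit x i" "\<not> nth_bit x n"
    "cubic_lucky_2 n (\<lambda>i j. nth_bit x (n + 1 + i * n + j)) (nth_bit u)"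
    unfolding cubic_lucky_verifier_def by blast
  let ?A = "\<lambda>i j. nth_bit x (n + 1 + i * n + j)"
  have "x = map (matrix_code n ?A) [0..<n + 1 + n * n]"
  proof (rule nth_equalityI)
    fix k assume k: "k < length x"
    then have "x ! k = nth_bit x k" by (simp add: nth_bit_def)
    also have "\<dots> = matrix_code n ?A k"
    proof -
      consider "k < n" | "k = n" | "n < k" by linarith
      then show ?thesis
      proof cases
        case 3
        have "n + 1 + (k - n - 1) div n * n + (k - n - 1) mod n = n + 1 + (k - n - 1)"
          by (simp only: add.assoc div_mult_mod_eq)
        also have "\<dots> = k" using 3 by simp
        finally show ?thesis using 3 by (simp add: matrix_code_def)
      qed (use n in \<open>auto simp: matrix_code_def\<close>)
    qed
    finally show "x ! k = map (matrix_code n ?A) [0..<n + 1 + n * n] ! k"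
      using k n(1) by (simp del: upt_Suc)
  qed (simp add: n(1))
  then show "x \<in> cubic_lucky_problem" unfolding cubic_lucky_problem_iff using n(4) by blast
qed

lemma cubic_lucky_problem_in_NP: "cubic_lucky_problem \<in> NP"
proof (rule NP_I[OF _ cubic_lucky_problem_verifier])
  show "decidable 0 (\<lambda>z vs. cubic_lucky_verifier (fst z) (snd z))"
    unfolding cubic_lucky_verifier_def cubic_lucky_2_def
    by (intro computable_intros; simp)
qed

section \<open>Numbering the vertices of a cell graph\<close>

context cell_graph begin

definition adj :: "nat \<Rightarrow> nat \<Rightarrow> bool" where
  "adj v w \<longleftrightarrow> (w div 16, w mod 16) \<in> set (nb (v div 16) (v mod 16))"

definition vertex :: "nat \<times> nat \<Rightarrow> nat" where
  "vertex p = 16 * fst p + snd p"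

lemma cell_less: "v < 16 * C \<Longrightarrow> v div 16 < C"
  by (simp add: less_mult_imp_div_less mult.commute)

lemma adj_set:
  assumes v: "v < 16 * C"
  shows "{w \<in> {..<16 * C}. adj v w} = vertex ` set (nb (v div 16) (v mod 16))"
    "inj_on vertex (set (nb (v div 16) (v mod 16)))"
proof -
  have n: "fst p < C" "snd p < 16" if "p \<in> set (nb (v div 16) (v mod 16))" for p
    using nb_sym[OF cell_less[OF v], of "v mod 16" "fst p" "snd p"] that by auto
  have "vertex p div 16 = fst p" "vertex p mod 16 = snd p" if "p \<in> set (nb (v div 16) (v mod 16))" for p
    using n[OF that] by (auto simp: vertex_def)
  note dm = this
  show "inj_on vertex (set (nb (v div 16) (v mod 16)))"
  proof (rule inj_onI)
    fix p q assume "p \<in> set (nb (v div 16) (v mod 16))" "q \<in> set (nb (v div 16) (v mod 16))" "vertex p = vertex q"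
    then show "p = q" using dm[of p] dm[of q] by (simp add: prod_eq_iff)
  qed
  show "{w \<in> {..<16 * C}. adj v w} = vertex ` set (nb (v div 16) (v mod 16))"
  proof (intro equalityI subsetI)
    fix w assume "w \<in> {w \<in> {..<16 * C}. adj v w}"
    then show "w \<in> vertex ` set (nb (v div 16) (v mod 16))"
      by (intro image_eqI[of _ _ "(w div 16, w mod 16)"]) (auto simp: vertex_def adj_def)
  next
    fix w assume "w \<in> vertex ` set (nb (v div 16) (v mod 16))"
    then obtain p where p: "p \<in> set (nb (v div 16) (v mod 16))" "w = vertex p" by blast
    have "vertex p < 16 * C" using n[OF p(1)] by (simp add: vertex_def)
    then show "w \<in> {w \<in> {..<16 * C}. adj v w}" using p dm[OF p(1)] by (simp add: adj_def)
  qed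
qed

lemma adj_sym: "v < 16 * C \<Longrightarrow> adj v w \<Longrightarrow> adj w v"
  using nb_sym[OF cell_less, of v "v mod 16" "w div 16" "w mod 16"] by (simp add: adj_def)

lemma adj_irrefl: "v < 16 * C \<Longrightarrow> \<not> adj v v"
  using nb_sym[OF cell_less, of v "v mod 16" "v div 16" "v mod 16"] by (auto simp: adj_def)

lemma sum_of_bool_filter:
  fixes A B :: "nat \<Rightarrow> bool"
  shows "(\<Sum>w<n. of_bool (A w \<and> B w) :: nat) = (\<Sum>w \<in> {w \<in> {..<n}. A w}. of_bool (B w))"
proof -
  have "(\<Sum>w<n. of_bool (A w \<and> B w) :: nat) = (\<Sum>w<n. if A w then of_bool (B w) else 0)"
    by (rule sum.cong) auto
  also have "\<dots> = (\<Sum>w \<in> {w \<in> {..<n}. A w}. of_bool (B w))" by (rule sum.inter_filter[symmetric]) simp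
  finally show ?thesis .
qed

text \<open>Symmetry turns the column of the adjacency matrix into a row, and the row reduces to the
  list of three neighbours.\<close>

lemma adj_sum:
  assumes v: "v < 16 * C"
  shows "(\<Sum>w<16 * C. of_bool (adj w v \<and> b w)) = nsum (\<lambda>c i. b (16 * c + i)) (v div 16) (v mod 16)"
proof -
  let ?nb = "nb (v div 16) (v mod 16)"
  have "(\<Sum>w<16 * C. of_bool (adj w v \<and> b w)) = (\<Sum>w<16 * C. of_bool (adj v w \<and> b w) :: nat)"
  proof (rule sum.cong[OF refl])
    fix w assume "w \<in> {..<16 * C}"
    then have "adj w v \<longleftrightarrow> adj v w" using adj_sym[of w v] adj_sym[OF v, of w] by auto
    then show "(of_bool (adj w v \<and> b w) :: nat) = of_bool (adj v w \<and> b w)" by simp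
  qed
  also have "\<dots> = (\<Sum>w \<in> vertex ` set ?nb. of_bool (b w))"
    unfolding sum_of_bool_filter adj_set(1)[OF v] ..
  also have "\<dots> = (\<Sum>p \<in> set ?nb. of_bool (b (vertex p)))"
    by (rule sum.reindex_cong[OF adj_set(2)[OF v] refl refl])
  also have "\<dots> = (\<Sum>p \<leftarrow> ?nb. of_bool (b (vertex p)))"
    by (rule sum.distinct_set_conv_list) (simp add: nb_regular)
  also have "\<dots> = nsum (\<lambda>c i. b (16 * c + i)) (v div 16) (v mod 16)"
    unfolding nsum_def vertex_def by (rule arg_cong[where f = sum_list], rule map_cong) auto
  finally show ?thesis .
qed

lemma adj_degree:
  assumes v: "v < 16 * C" shows "(\<Sum>w<16 * C. of_bool (adj v w)) = (3::nat)"
proof -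
  have "(\<Sum>w<16 * C. of_bool (adj v w)) = (\<Sum>w<16 * C. of_bool (adj v w \<and> True) :: nat)" by simp
  also have "\<dots> = card (vertex ` set (nb (v div 16) (v mod 16)))"
    unfolding sum_of_bool_filter adj_set(1)[OF v] by simp
  also have "\<dots> = card (set (nb (v div 16) (v mod 16)))" by (rule card_image[OF adj_set(2)[OF v]])
  also have "\<dots> = 3" using nb_regular[of "v mod 16" "v div 16"] by (simp add: distinct_card)
  finally show ?thesis .
qed

lemma lucky_bitsD:
  "lucky_bits b \<Longrightarrow> c < C \<Longrightarrow> i < 16 \<Longrightarrow> (c', i') \<in> set (nb c i) \<Longrightarrow> nsum b c i \<noteq> nsum b c' i'"
  unfolding lucky_bits_def by fast

lemma cubic_lucky_2_adj_iff:
  "cubic_lucky_2 (16 * C) adj b \<longleftrightarrow> 0 < C \<and> lucky_bits (\<lambda>c i. b (16 * c + i))"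
proof -
  let ?b = "\<lambda>c i. b (16 * c + i)"
  have "lucky_bits ?b \<longleftrightarrow> (\<forall>v<16 * C. \<forall>w<16 * C. adj v w \<longrightarrow>
      (\<Sum>u<16 * C. of_bool (adj u v \<and> b u)) \<noteq> (\<Sum>u<16 * C. of_bool (adj u w \<and> b u) :: nat))" (is "_ \<longleftrightarrow> ?R")
  proof
    assume L: "lucky_bits ?b"
    show ?R
    proof (intro allI impI)
      fix v w assume v: "v < 16 * C" and w: "w < 16 * C" and a: "adj v w"
      show "(\<Sum>u<16 * C. of_bool (adj u v \<and> b u)) \<noteq> (\<Sum>u<16 * C. of_bool (adj u w \<and> b u) :: nat)"
        unfolding adj_sum[OF v] adj_sum[OF w]
        by (rule lucky_bitsD[OF L cell_less[OF v]]) (use a in \<open>simp_all add: adj_def\<close>)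
    qed
  next
    assume R: ?R
    show "lucky_bits ?b"
      unfolding lucky_bits_def
    proof (intro allI impI ballI, clarify)
      fix c i c' i' assume c: "c < C" "i < 16" "(c', i') \<in> set (nb c i)" and eq: "nsum ?b c i = nsum ?b c' i'"
      have c': "c' < C" "i' < 16" using nb_sym[OF c] by auto
      let ?v = "16 * c + i" and ?w = "16 * c' + i'"
      have v: "?v < 16 * C" "?v div 16 = c" "?v mod 16 = i" and w: "?w < 16 * C" "?w div 16 = c'" "?w mod 16 = i'"
        using c c' by auto
      have "adj ?v ?w" using c(3) v w by (simp add: adj_def)
      then have "(\<Sum>u<16 * C. of_bool (adj u ?v \<and> b u)) \<noteq> (\<Sum>u<16 * C. of_bool (adj u ?w \<and> b u) :: nat)"
        using R v(1) w(1) by blast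
      then show False unfolding adj_sum[OF v(1)] adj_sum[OF w(1)] v w using eq by simp
    qed
  qed
  note luck = this
  have "\<forall>i<16 * C. \<not> adj i i" "\<forall>i<16 * C. \<forall>j<16 * C. adj i j \<longrightarrow> adj j i"
    "\<forall>i<16 * C. (\<Sum>j<16 * C. of_bool (adj i j)) = (3::nat)" "0 < 16 * C \<longleftrightarrow> 0 < C"
    by (simp add: adj_irrefl, use adj_sym in blast, intro allI impI adj_degree, simp_all)
  then show ?thesis unfolding cubic_lucky_2_def luck by (intro iffI conjI; (elim conjE)?; simp only:)
qed

lemma cubic_lucky_2_exists_iff:
  "(\<exists>b. cubic_lucky_2 (16 * C) adj b) \<longleftrightarrow> 0 < C \<and> (\<exists>b. lucky_bits b)"
proof
  assume "\<exists>b. cubic_lucky_2 (16 * C) adj b"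
  then obtain b where "cubic_lucky_2 (16 * C) adj b" ..
  then show "0 < C \<and> (\<exists>b. lucky_bits b)" unfolding cubic_lucky_2_adj_iff
    by (intro conjI exI[of _ "\<lambda>c i. b (16 * c + i)"]) simp_all
next
  assume "0 < C \<and> (\<exists>b. lucky_bits b)"
  then obtain b where C: "0 < C" and b: "lucky_bits b" by blast
  let ?b = "\<lambda>w. b (w div 16) (w mod 16)"
  have ns: "nsum (\<lambda>c i. ?b (16 * c + i)) c i = nsum b c i" if "c < C" "i < 16" for c i
    unfolding nsum_def
    by (rule arg_cong[where f = sum_list], rule map_cong[OF refl]) (use nb_sym[OF that] in auto)
  have "lucky_bits (\<lambda>c i. ?b (16 * c + i))"
    unfolding lucky_bits_def
  proof (intro allI impI ballI, clarify)
    fix c i c' i' assume c: "c < C" "i < 16" "(c', i') \<in> set (nb c i)"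
      and eq: "nsum (\<lambda>c i. ?b (16 * c + i)) c i = nsum (\<lambda>c i. ?b (16 * c + i)) c' i'"
    have "nsum b c i = nsum b c' i'" using eq ns[OF c(1,2)] ns[of c' i'] nb_sym[OF c] by simp
    then show False using lucky_bitsD[OF b c] by simp
  qed
  then have "cubic_lucky_2 (16 * C) adj ?b" unfolding cubic_lucky_2_adj_iff using C by (intro conjI)
  then show "\<exists>b. cubic_lucky_2 (16 * C) adj b" by (rule exI[of "cubic_lucky_2 (16 * C) adj" ?b])
qed

end

section \<open>Satisfiability as a graph on a torus of cells\<close>

text \<open>Row 0 carries a reference bit, row \<open>v + 1\<close> the variable \<open>v\<close>, which is true iff its bit agrees with
  the reference bit; column \<open>j\<close> is a clause. Inside an active column a bit travels downwards from row 0.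
  It arrives at row 0 again inverted, and only a cell of a true literal allows the change.\<close>

definition t_rgt :: "nat \<Rightarrow> nat \<Rightarrow> nat" where
  "t_rgt W c = c div W * W + (c mod W + 1) mod W"

definition t_lft :: "nat \<Rightarrow> nat \<Rightarrow> nat" where
  "t_lft W c = c div W * W + (c mod W + (W - 1)) mod W"

definition t_dn :: "nat \<Rightarrow> nat \<Rightarrow> nat \<Rightarrow> nat" where
  "t_dn R W c = (c div W + 1) mod R * W + c mod W"

definition t_up :: "nat \<Rightarrow> nat \<Rightarrow> nat \<Rightarrow> nat" where
  "t_up R W c = (c div W + (R - 1)) mod R * W + c mod W"

text \<open>Type 1 in row 0 passes the bit of an inactive column on unchanged, and types 0 and 1
  below admit an unchanged bit, so a constant satisfies such a column.\<close>

definition cell_type :: "(nat \<Rightarrow> bool) \<Rightarrow> (nat \<Rightarrow> bool) \<Rightarrow> (nat \<Rightarrow> nat \<Rightarrow> bool) \<Rightarrow> nat \<Rightarrow> nat \<Rightarrow> nat" where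
  "cell_type active pos mem W c = (if c div W = 0 then (if active (c mod W) then if pos (c mod W) then 2 else 3 else 1)
     else if mem (c div W - 1) (c mod W) then 0 else 1)"

lemma cycle_step: "j < n \<Longrightarrow> ((j + 1) mod n + (n - 1)) mod n = j" "j < n \<Longrightarrow> ((j + (n - 1)) mod n + 1) mod n = (j::nat)"
proof -
  assume j: "j < n"
  have "((j + 1) mod n + (n - 1)) mod n = (j + 1 + (n - 1)) mod n" by (rule mod_add_left_eq)
  then show "((j + 1) mod n + (n - 1)) mod n = j" using j by simp
  have "((j + (n - 1)) mod n + 1) mod n = (j + (n - 1) + 1) mod n" by (rule mod_add_left_eq)
  then show "((j + (n - 1)) mod n + 1) mod n = j" using j by simp
qed

lemma pair_index: "j < W \<Longrightarrow> (a * W + j) div W = (a::nat)" "j < W \<Longrightarrow> (a * W + j) mod W = (j::nat)"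
  by auto

lemma pair_index_less: "a < R \<Longrightarrow> j < W \<Longrightarrow> a * W + j < R * (W::nat)"
proof -
  assume "a < R" "j < W"
  then have "a * W + j < Suc a * W" by simp
  also have "\<dots> \<le> R * W" using \<open>a < R\<close> by (intro mult_le_mono1) simp
  finally show ?thesis .
qed

lemma torus_cell_graph:
  assumes "0 < W" "0 < R"
  shows "cell_graph (R * W) (t_rgt W) (t_lft W) (t_dn R W) (t_up R W) (cell_type active pos mem W)"
proof
  fix c assume c: "c < R * W"
  let ?a = "c div W" and ?j = "c mod W"
  have a: "?a < R" using c by (simp add: less_mult_imp_div_less)
  have j: "?j < W" using assms by simp
  have c_eq: "?a * W + ?j = c" by simp
  have m: "(?j + 1) mod W < W" "(?j + (W - 1)) mod W < W" "(?a + 1) mod R < R" "(?a + (R - 1)) mod R < R"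
    using assms by auto
  show "t_rgt W c < R * W \<and> t_lft W (t_rgt W c) = c"
    unfolding t_rgt_def t_lft_def pair_index[OF m(1)] cycle_step(1)[OF j] c_eq
    using pair_index_less[OF a m(1)] by simp
  show "t_lft W c < R * W \<and> t_rgt W (t_lft W c) = c"
    unfolding t_rgt_def t_lft_def pair_index[OF m(2)] cycle_step(2)[OF j] c_eq
    using pair_index_less[OF a m(2)] by simp
  show "t_dn R W c < R * W \<and> t_up R W (t_dn R W c) = c"
    unfolding t_dn_def t_up_def pair_index[OF j] cycle_step(1)[OF a] c_eq
    using pair_index_less[OF m(3) j] by simp
  show "t_up R W c < R * W \<and> t_dn R W (t_up R W c) = c"
    unfolding t_dn_def t_up_def pair_index[OF j] cycle_step(2)[OF a] c_eq
    using pair_index_less[OF m(4) j] by simp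
qed (simp add: cell_type_def)

lemma torus_sat_iff:
  assumes W: "0 < W"
  shows "(\<exists>L Q U D. \<forall>c < Suc N * W. cell_rel (cell_type active pos mem W c) (L c) (Q c) (U c) (D c) \<and>
      L (t_rgt W c) = Q c \<and> U (t_dn (Suc N) W c) = D c) \<longleftrightarrow>
    (\<exists>\<alpha>. \<forall>j<W. active j \<longrightarrow> (\<exists>v<N. mem v j \<and> \<alpha> v = pos j))"
proof
  assume "\<exists>L Q U D. \<forall>c < Suc N * W. cell_rel (cell_type active pos mem W c) (L c) (Q c) (U c) (D c) \<and>
      L (t_rgt W c) = Q c \<and> U (t_dn (Suc N) W c) = D c"
  then obtain L Q U D where H: "\<And>c. c < Suc N * W \<Longrightarrow> cell_rel (cell_type active pos mem W c) (L c) (Q c) (U c) (D c)"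
    "\<And>c. c < Suc N * W \<Longrightarrow> L (t_rgt W c) = Q c" "\<And>c. c < Suc N * W \<Longrightarrow> U (t_dn (Suc N) W c) = D c"
    by blast
  have less: "a * W + j < Suc N * W" if "a \<le> N" "j < W" for a j
    using that by (intro pair_index_less) auto
  have rel: "cell_rel (cell_type active pos mem W (a * W + j)) (L (a * W + j)) (Q (a * W + j)) (U (a * W + j)) (D (a * W + j))"
    if "a \<le> N" "j < W" for a j using H(1)[OF less[OF that]] .
  have row: "L (a * W + j) = L (a * W)" if a: "a \<le> N" and j: "j < W" for a j
    using j
  proof (induction j)
    case (Suc j)
    have "t_rgt W (a * W + j) = a * W + Suc j" using Suc.prems pair_index[of j W a] by (simp add: t_rgt_def)
    then have "L (a * W + Suc j) = Q (a * W + j)" using H(2)[OF less[OF a, of j]] Suc.prems by simp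
    also have "\<dots> = L (a * W + j)" using rel[OF a, of j] Suc.prems by (simp add: cell_rel_def)
    finally show ?case using Suc by simp
  qed simp
  define z where "z = L 0"
  define \<alpha> where "\<alpha> v = (L (Suc v * W) = z)" for v
  have "\<exists>v<N. mem v j \<and> \<alpha> v = pos j" if j: "j < W" and active: "active j" for j
  proof (rule ccontr)
    assume no: "\<not> (\<exists>v<N. mem v j \<and> \<alpha> v = pos j)"
    \<comment> \<open>The bit that leaves row 0 downwards. It has to come back from below as its
      negation, but without a true literal no cell changes it.\<close>
    define y where "y = D j"
    have "cell_rel (if pos j then 2 else 3) z (Q j) (U j) (D j)"
      using rel[of 0 j] row[of 0 j] j active by (simp add: cell_type_def z_def)
    then have y: "y = (z = pos j)" "U j = (\<not> y)"
      by (auto simp: cell_rel_def y_def split: if_splits)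
    have "D (a * W + j) = y" if "a \<le> N" for a
      using that
    proof (induction a)
      case 0 then show ?case by (simp add: y_def)
    next
      case (Suc a)
      have "t_dn (Suc N) W (a * W + j) = Suc a * W + j"
        using Suc.prems pair_index[OF j, of a] by (simp add: t_dn_def)
      then have U: "U (Suc a * W + j) = y" using H(3)[OF less[of a j]] Suc j by simp
      have dm: "(Suc a * W + j) div W = Suc a" "(Suc a * W + j) mod W = j" using pair_index[OF j] by blast+
      have r: "cell_rel (if mem a j then 0 else 1) (L (Suc a * W)) (Q (Suc a * W + j)) y (D (Suc a * W + j))"
        using rel[OF Suc.prems j] row[OF Suc.prems j] U unfolding cell_type_def dm by simp
      \<comment> \<open>By \<open>y = (z = pos j)\<close>, a row bit equal to \<open>y\<close> would
        make its literal true.\<close>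
      have "mem a j \<Longrightarrow> L (Suc a * W) \<noteq> y"
        using no Suc.prems y(1) by (auto simp: \<alpha>_def)
      then show ?case using r by (auto simp: cell_rel_def split: if_splits)
    qed
    then have "D (N * W + j) = y" by simp
    moreover have "t_dn (Suc N) W (N * W + j) = j" using pair_index[OF j, of N] by (simp add: t_dn_def)
    then have "U j = D (N * W + j)" using H(3)[OF less[of N j]] j by simp
    ultimately show False using y(2) by simp
  qed
  then show "\<exists>\<alpha>. \<forall>j<W. active j \<longrightarrow> (\<exists>v<N. mem v j \<and> \<alpha> v = pos j)" by blast
next
  assume "\<exists>\<alpha>. \<forall>j<W. active j \<longrightarrow> (\<exists>v<N. mem v j \<and> \<alpha> v = pos j)"
  then obtain \<alpha> f where f: "\<And>j. j < W \<Longrightarrow> active j \<Longrightarrow> f j < N \<and> mem (f j) j \<and> \<alpha> (f j) = pos j" by metis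
  \<comment> \<open>The reference bit is chosen to be true. An active column carries
    \<open>pos j\<close> down to the upper port in the row of the chosen literal \<open>f j\<close>
    and the negation from its lower port on, whence \<open>\<le>\<close> in \<open>U\<close> against
    \<open><\<close> in \<open>D\<close>. Inactive columns are constantly false.\<close>
  define L where "L c = (if c div W = 0 then True else \<alpha> (c div W - 1))" for c
  define U where "U c = (active (c mod W) \<and> (if c div W = 0 then \<not> pos (c mod W) else
     if c div W - 1 \<le> f (c mod W) then pos (c mod W) else \<not> pos (c mod W)))" for c
  define D where "D c = (active (c mod W) \<and> (if c div W = 0 then pos (c mod W) else
     if c div W - 1 < f (c mod W) then pos (c mod W) else \<not> pos (c mod W)))" for c
  have "cell_rel (cell_type active pos mem W c) (L c) (L c) (U c) (D c) \<and>
      L (t_rgt W c) = L c \<and> U (t_dn (Suc N) W c) = D c" if c: "c < Suc N * W" for c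
  proof -
    define a j where "a = c div W" and "j = c mod W"
    have a: "a \<le> N" using c less_mult_imp_div_less[of c "Suc N" W] by (simp add: a_def)
    have j: "j < W" using W by (simp add: j_def)
    note fj = f[OF j]
    have "L (t_rgt W c) = L c"
    proof -
      have "(c mod W + 1) mod W < W" using W by simp
      then have "t_rgt W c div W = c div W" unfolding t_rgt_def by (rule pair_index)
      then show ?thesis by (simp add: L_def)
    qed
    moreover have "U (t_dn (Suc N) W c) = D c"
    proof -
      have dm: "t_dn (Suc N) W c div W = (a + 1) mod Suc N" "t_dn (Suc N) W c mod W = j"
        unfolding t_dn_def a_def[symmetric] j_def[symmetric] using pair_index[OF j] by blast+
      show ?thesis
      proof (cases "a = N")
        case True
        then show ?thesis using fj unfolding U_def D_def dm a_def[symmetric] j_def[symmetric] by auto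
      next
        case False
        then have "(a + 1) mod Suc N = Suc a" using a by simp
        then show ?thesis using fj unfolding U_def D_def dm a_def[symmetric] j_def[symmetric] by auto
      qed
    qed
    moreover have "cell_rel (cell_type active pos mem W c) (L c) (L c) (U c) (D c)"
    proof (cases "a = 0")
      case True
      then show ?thesis
        unfolding cell_type_def L_def U_def D_def a_def[symmetric] j_def[symmetric] by (simp add: cell_rel_def)
    next
      case False
      show ?thesis
      proof (cases "a - 1 = f j \<and> active j")
        case True
        then show ?thesis using fj False
          unfolding cell_type_def L_def U_def D_def a_def[symmetric] j_def[symmetric] by (simp add: cell_rel_def)
      next
        case nf: False
        then have "U c = D c" using False
          unfolding U_def D_def a_def[symmetric] j_def[symmetric] by auto
        then show ?thesis using False
          unfolding cell_type_def a_def[symmetric] j_def[symmetric] by (auto simp: cell_rel_def)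
      qed
    qed
    ultimately show ?thesis by blast
  qed
  then show "\<exists>L Q U D. \<forall>c < Suc N * W. cell_rel (cell_type active pos mem W c) (L c) (Q c) (U c) (D c) \<and>
      L (t_rgt W c) = Q c \<and> U (t_dn (Suc N) W c) = D c"
    by (rule_tac x = L in exI, rule_tac x = L in exI, rule_tac x = U in exI, rule_tac x = D in exI) simp
qed

text \<open>The edges inside a cell of a given type form a fixed finite table, while the edges
  between cells follow from arithmetic on the torus. Split like this, adjacency is visibly
  decidable.\<close>

definition intra :: "nat \<Rightarrow> (nat \<times> nat) set" where
  "intra t = (SIGMA i:{..<8}. set (core t ! i)) \<union> {(1, 8), (3, 12), (8, 1), (8, 9), (8, 10), (9, 8), (9, 10), (9, 11),
     (10, 8), (10, 9), (10, 11), (11, 9), (11, 10), (12, 3), (12, 13), (12, 14), (13, 12), (13, 14), (13, 15),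
     (14, 12), (14, 13), (14, 15), (15, 13), (15, 14)}"

lemma finite_intra: "finite (intra t)"
  unfolding intra_def by (intro finite_UnI finite_SigmaI) simp_all

context cell_graph begin

lemma nb_mem_iff:
  assumes "i < 16"
  shows "(c', i') \<in> set (nb c i) \<longleftrightarrow> c' = c \<and> (i, i') \<in> intra (ty c) \<or>
    i = 0 \<and> i' = 11 \<and> c' = lft c \<or> i = 2 \<and> i' = 15 \<and> c' = up c \<or>
    i = 11 \<and> i' = 0 \<and> c' = rgt c \<or> i = 15 \<and> i' = 2 \<and> c' = dn c"
proof (cases "i < 8")
  case True
  then have "(i, i') \<in> intra (ty c) \<longleftrightarrow> i' \<in> set (core (ty c) ! i) \<or> i = 1 \<and> i' = 8 \<or> i = 3 \<and> i' = 12"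
    by (auto simp: intra_def)
  then show ?thesis using True by (auto simp: nb_def port_nb_def)
next
  case False
  then have "i = 8 \<or> i = 9 \<or> i = 10 \<or> i = 11 \<or> i = 12 \<or> i = 13 \<or> i = 14 \<or> i = 15"
    using assms by linarith
  then show ?thesis by (elim disjE) (auto simp: nb_simps intra_def)
qed

end

text \<open>The length of the string determines \<open>n\<close>, and its positions then determine
  all entries below \<open>n\<close>, so membership does not depend on the graph that witnesses
  it.\<close>

lemma matrix_code_in_problem:
  "map (matrix_code n A) [0..<n + 1 + n * n] \<in> cubic_lucky_problem \<longleftrightarrow> (\<exists>b. cubic_lucky_2 n A b)"
proof
  assume "map (matrix_code n A) [0..<n + 1 + n * n] \<in> cubic_lucky_problem"
  then obtain n' A' b where eq: "map (matrix_code n A) [0..<n + 1 + n * n] = map (matrix_code n' A') [0..<n' + 1 + n' * n']"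
    and b: "cubic_lucky_2 n' A' b" unfolding cubic_lucky_problem_iff by blast
  have "n + n * n = n' + n' * n'" using arg_cong[OF eq, of length] by simp
  have n: "n' = n"
  proof (rule ccontr)
    assume "n' \<noteq> n"
    then consider "n' < n" | "n < n'" by linarith
    then show False
    proof cases
      case 1
      then have "n' * n' \<le> n * n" by (intro mult_le_mono) auto
      then show False using 1 \<open>n + n * n = n' + n' * n'\<close> by linarith
    next
      case 2
      then have "n * n \<le> n' * n'" by (intro mult_le_mono) auto
      then show False using 2 \<open>n + n * n = n' + n' * n'\<close> by linarith
    qed
  qed
  have "cubic_lucky_2 n A b"
  proof (rule cubic_lucky_2_cong)
    show "cubic_lucky_2 n A' b" using b n by simp
    fix i j assume ij: "i < n" "j < n"
    let ?k = "n + 1 + i * n + j"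
    have "i * n + j < n * n" using pair_index_less[OF ij] .
    then have k: "?k < n + 1 + n * n" by simp
    have dm: "(?k - n - 1) div n = i" "(?k - n - 1) mod n = j" using ij by auto
    have "map (matrix_code n A) [0..<n + 1 + n * n] ! ?k = map (matrix_code n A') [0..<n + 1 + n * n] ! ?k"
      using eq unfolding n by (rule arg_cong)
    then have "matrix_code n A ?k = matrix_code n A' ?k" using k by (simp del: upt_Suc)
    then show "A i j = A' i j" unfolding matrix_code_def dm by simp
  qed simp
  then show "\<exists>b. cubic_lucky_2 n A b" by (rule exI[of "cubic_lucky_2 n A" b])
next
  assume "\<exists>b. cubic_lucky_2 n A b"
  then show "map (matrix_code n A) [0..<n + 1 + n * n] \<in> cubic_lucky_problem"
    unfolding cubic_lucky_problem_iff by blast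
qed

lemma poly_nat_mono: "x \<le> y \<Longrightarrow> poly p x \<le> poly p (y::nat)"
  by (induction p) (auto intro: add_mono mult_le_mono)

text \<open>A halted run stays as it is, so acceptance can be read off at one later time common to
  all certificates.\<close>

lemma accepts_iff_run:
  assumes "tm_wf M" "halts_within M xs n" "n \<le> m"
  shows "accepts M xs \<longleftrightarrow> fst (run M xs m) = tm_accept M"
proof
  assume "accepts M xs"
  then obtain l where l: "fst (run M xs l) = tm_accept M" by (auto simp: accepts_def)
  have "run M xs (max l m) = run M xs l" by (rule run_stable) (auto simp: halting_def l)
  moreover have "run M xs (max l m) = run M xs n"
    by (rule run_stable) (use assms in \<open>auto simp: halts_within_def\<close>)
  moreover have "run M xs m = run M xs n"
    by (rule run_stable) (use assms in \<open>auto simp: halts_within_def\<close>)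
  ultimately show "fst (run M xs m) = tm_accept M" using l by simp
qed (auto simp: accepts_def)

section \<open>The reduction from an arbitrary problem in NP\<close>

locale np_verifier = verifier +
  fixes p r :: "nat poly"
  assumes halts: "\<And>x u. halts_within M [x, u] (poly r (length x + length u))"
begin

definition cert :: "bool list \<Rightarrow> nat" where "cert x = poly p (length x)"
text \<open>A common running time for all certificates of admissible length. The summand
  \<open>cert x\<close> makes the window of tiles contain the certificate.\<close>

definition time :: "bool list \<Rightarrow> nat" where "time x = cert x + poly r (length x + cert x)"
definition cells :: "bool list \<Rightarrow> nat" where "cells x = (time x + 1) * (2 * time x + 1)"
definition vars :: "bool list \<Rightarrow> nat" where "vars x = cells x * ncol"
text \<open>One positive clause for each pair of a time and a position, followed by one column for
  every ordered pair of variables. Variable \<open>i * ncol + c\<close> says that tile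
  \<open>c\<close> is chosen at the pair numbered \<open>i\<close>.\<close>

definition cols :: "bool list \<Rightarrow> nat" where "cols x = cells x + vars x * vars x"

definition row_of :: "bool list \<Rightarrow> nat \<Rightarrow> nat" where "row_of x v = v div ncol div (2 * time x + 1)"
definition pos_of :: "bool list \<Rightarrow> nat \<Rightarrow> nat" where "pos_of x v = v div ncol mod (2 * time x + 1)"

definition var_conflict :: "bool list \<Rightarrow> nat \<Rightarrow> nat \<Rightarrow> bool" where
  "var_conflict x v v' \<longleftrightarrow> conflict x (time x) (cert x) (row_of x v) (pos_of x v) (v mod ncol)
     (row_of x v') (pos_of x v') (v' mod ncol)"

text \<open>Every ordered pair of variables has a column, and the columns of compatible pairs are
  switched off. So the index of a clause is plain arithmetic instead of an enumeration of the
  conflicts.\<close>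

definition active :: "bool list \<Rightarrow> nat \<Rightarrow> bool" where
  "active x j \<longleftrightarrow> j < cells x \<or> var_conflict x ((j - cells x) div vars x) ((j - cells x) mod vars x)"

definition mem :: "bool list \<Rightarrow> nat \<Rightarrow> nat \<Rightarrow> bool" where
  "mem x v j \<longleftrightarrow> (if j < cells x then v div ncol = j
     else v = (j - cells x) div vars x \<or> v = (j - cells x) mod vars x)"

abbreviation ctype :: "bool list \<Rightarrow> nat \<Rightarrow> nat" where
  "ctype x \<equiv> cell_type (active x) (\<lambda>j. j < cells x) (mem x) (cols x)"

lemma accepted_iff:
  "(\<exists>u. length u \<le> poly p (length x) \<and> accepts M [x, u]) \<longleftrightarrow>
   (\<exists>u. length u \<le> cert x \<and> fst (run M [x, u] (time x)) = tm_accept M)"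
proof -
  have "accepts M [x, u] \<longleftrightarrow> fst (run M [x, u] (time x)) = tm_accept M" if "length u \<le> cert x" for u
  proof (rule accepts_iff_run[OF wf halts])
    have "poly r (length x + length u) \<le> poly r (length x + cert x)" using that by (intro poly_nat_mono) simp
    then show "poly r (length x + length u) \<le> time x" by (simp add: time_def)
  qed
  then show ?thesis by (auto simp: cert_def)
qed

lemma cells_index: "t \<le> time x \<Longrightarrow> j \<le> 2 * time x \<Longrightarrow> t * (2 * time x + 1) + j < cells x"
  unfolding cells_def by (rule pair_index_less) auto

text \<open>An assignment may choose several tiles at one place. Keeping one of them is harmless,
  since the negative clauses only forbid combinations of chosen tiles.\<close>

lemma clauses_satisfiable_iff:
  "(\<exists>\<alpha>. \<forall>j<cols x. active x j \<longrightarrow> (\<exists>v<vars x. mem x v j \<and> \<alpha> v = (j < cells x))) \<longleftrightarrow>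
   (\<exists>g. (\<forall>t\<le>time x. \<forall>j\<le>2 * time x. g t j < ncol) \<and>
      (\<forall>t\<le>time x. \<forall>j\<le>2 * time x. \<forall>t'\<le>time x. \<forall>j'\<le>2 * time x.
         \<not> conflict x (time x) (cert x) t j (g t j) t' j' (g t' j')))"
proof
  let ?T = "time x" and ?S = "2 * time x + 1"
  assume "\<exists>\<alpha>. \<forall>j<cols x. active x j \<longrightarrow> (\<exists>v<vars x. mem x v j \<and> \<alpha> v = (j < cells x))"
  then obtain \<alpha> where \<alpha>: "\<And>j. j < cols x \<Longrightarrow> active x j \<Longrightarrow> \<exists>v<vars x. mem x v j \<and> \<alpha> v = (j < cells x)" by blast
  have "\<exists>v. v < vars x \<and> v div ncol = i \<and> \<alpha> v" if i: "i < cells x" for i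
    using \<alpha>[of i] i by (auto simp: cols_def active_def mem_def)
  then have "\<forall>i. \<exists>v. i < cells x \<longrightarrow> v < vars x \<and> v div ncol = i \<and> \<alpha> v" by blast
  from choice[OF this] obtain G where G: "\<And>i. i < cells x \<Longrightarrow> G i < vars x \<and> G i div ncol = i \<and> \<alpha> (G i)"
    by blast
  define g where "g t j = G (t * ?S + j) mod ncol" for t j
  have G': "row_of x (G (t * ?S + j)) = t" "pos_of x (G (t * ?S + j)) = j" "G (t * ?S + j) mod ncol = g t j"
    if "t \<le> ?T" "j \<le> 2 * ?T" for t j
    using G[OF cells_index[OF that]] pair_index[of j ?S t] that by (auto simp: row_of_def pos_of_def g_def)
  have "g t j < ncol" if "t \<le> ?T" "j \<le> 2 * ?T" for t j
  proof -
    have "0 < vars x" using G[OF cells_index[OF that]] by linarith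
    then show ?thesis by (simp add: vars_def g_def)
  qed
  moreover have "\<not> conflict x ?T (cert x) t j (g t j) t' j' (g t' j')"
    if t: "t \<le> ?T" "j \<le> 2 * ?T" "t' \<le> ?T" "j' \<le> 2 * ?T" for t j t' j'
  proof
    assume c: "conflict x ?T (cert x) t j (g t j) t' j' (g t' j')"
    let ?v = "G (t * ?S + j)" and ?v' = "G (t' * ?S + j')"
    note v = G[OF cells_index[OF t(1,2)]] and v' = G[OF cells_index[OF t(3,4)]]
    let ?j = "cells x + (?v * vars x + ?v')"
    have "?v * vars x + ?v' < vars x * vars x" using v v' by (intro pair_index_less) auto
    then have jc: "?j < cols x" by (simp add: cols_def)
    have dm: "(?j - cells x) div vars x = ?v" "(?j - cells x) mod vars x = ?v'"
      using pair_index[of ?v' "vars x" ?v] v' by auto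
    have "var_conflict x ?v ?v'" using c G'[OF t(1,2)] G'[OF t(3,4)] by (simp add: var_conflict_def)
    then have "active x ?j" unfolding active_def dm by simp
    from \<alpha>[OF jc this] obtain w where w: "mem x w ?j" "\<alpha> w = (?j < cells x)" by blast
    from w(1) have "w = ?v \<or> w = ?v'" unfolding mem_def dm by simp
    then show False using w(2) v v' by auto
  qed
  ultimately show "\<exists>g. (\<forall>t\<le>?T. \<forall>j\<le>2 * ?T. g t j < ncol) \<and>
      (\<forall>t\<le>?T. \<forall>j\<le>2 * ?T. \<forall>t'\<le>?T. \<forall>j'\<le>2 * ?T. \<not> conflict x ?T (cert x) t j (g t j) t' j' (g t' j'))"
    by (intro exI[of _ g]) simp
next
  let ?T = "time x" and ?S = "2 * time x + 1"
  assume "\<exists>g. (\<forall>t\<le>?T. \<forall>j\<le>2 * ?T. g t j < ncol) \<and>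
      (\<forall>t\<le>?T. \<forall>j\<le>2 * ?T. \<forall>t'\<le>?T. \<forall>j'\<le>2 * ?T. \<not> conflict x ?T (cert x) t j (g t j) t' j' (g t' j'))"
  then obtain g where g: "\<forall>t\<le>?T. \<forall>j\<le>2 * ?T. g t j < ncol"
    and nc: "\<forall>t\<le>?T. \<forall>j\<le>2 * ?T. \<forall>t'\<le>?T. \<forall>j'\<le>2 * ?T. \<not> conflict x ?T (cert x) t j (g t j) t' j' (g t' j')"
    by (elim exE conjE)
  define \<alpha> where "\<alpha> v = (g (row_of x v) (pos_of x v) = v mod ncol)" for v
  have rp: "i div ?S \<le> ?T" "i mod ?S \<le> 2 * ?T" if "i < cells x" for i
    using that less_mult_imp_div_less[of i "?T + 1" ?S] mod_less_divisor[of ?S i]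
    by (auto simp: cells_def simp del: mod_less_divisor)
  have rp': "row_of x v \<le> ?T" "pos_of x v \<le> 2 * ?T" if "v < vars x" for v
    using rp[of "v div ncol"] that less_mult_imp_div_less[of v "cells x" ncol]
    by (auto simp: row_of_def pos_of_def vars_def)
  have "\<exists>v<vars x. mem x v j \<and> \<alpha> v = (j < cells x)" if j: "j < cols x" and act: "active x j" for j
  proof (cases "j < cells x")
    case True
    let ?c = "g (j div ?S) (j mod ?S)"
    have c: "?c < ncol" using g rp[OF True] by simp
    let ?v = "j * ncol + ?c"
    have dm: "?v div ncol = j" "?v mod ncol = ?c" using pair_index[OF c] by auto
    have "?v < vars x" unfolding vars_def by (rule pair_index_less[OF True c])
    moreover have "mem x ?v j" using True dm by (simp add: mem_def)
    moreover have "\<alpha> ?v" unfolding \<alpha>_def row_of_def pos_of_def dm by simp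
    ultimately show ?thesis using True by blast
  next
    case False
    let ?v = "(j - cells x) div vars x" and ?v' = "(j - cells x) mod vars x"
    have jl: "j - cells x < vars x * vars x" using j False by (simp add: cols_def)
    then have "0 < vars x" by (cases "vars x") auto
    then have v: "?v < vars x" "?v' < vars x" using jl by (auto simp: less_mult_imp_div_less)
    have vc: "var_conflict x ?v ?v'" using act False by (simp add: active_def)
    have "\<not> (\<alpha> ?v \<and> \<alpha> ?v')"
    proof
      assume "\<alpha> ?v \<and> \<alpha> ?v'"
      then have e: "g (row_of x ?v) (pos_of x ?v) = ?v mod ncol" "g (row_of x ?v') (pos_of x ?v') = ?v' mod ncol"
        by (simp_all add: \<alpha>_def)
      have "\<not> conflict x ?T (cert x) (row_of x ?v) (pos_of x ?v) (g (row_of x ?v) (pos_of x ?v))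
          (row_of x ?v') (pos_of x ?v') (g (row_of x ?v') (pos_of x ?v'))"
        using nc rp'[OF v(1)] rp'[OF v(2)] by blast
      then show False using vc unfolding e var_conflict_def by blast
    qed
    moreover have "mem x ?v j" "mem x ?v' j" using False by (simp_all add: mem_def)
    ultimately show ?thesis using False v by blast
  qed
  then show "\<exists>\<alpha>. \<forall>j<cols x. active x j \<longrightarrow> (\<exists>v<vars x. mem x v j \<and> \<alpha> v = (j < cells x))" by blast
qed

definition red_size :: "bool list \<Rightarrow> nat" where
  "red_size x = 16 * (Suc (vars x) * cols x)"

text \<open>The four types are listed so that each membership test refers to a constant set;
  \<open>intra\<close> of a computed type would not be a fixed table.\<close>

definition red_adj :: "bool list \<Rightarrow> nat \<Rightarrow> nat \<Rightarrow> bool" where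
  "red_adj x v w \<longleftrightarrow>
    w div 16 = v div 16 \<and> (
      ctype x (v div 16) = 0 \<and> (v mod 16, w mod 16) \<in> intra 0 \<or>
      ctype x (v div 16) = 1 \<and> (v mod 16, w mod 16) \<in> intra 1 \<or>
      ctype x (v div 16) = 2 \<and> (v mod 16, w mod 16) \<in> intra 2 \<or>
      ctype x (v div 16) = 3 \<and> (v mod 16, w mod 16) \<in> intra 3) \<or>
    v mod 16 = 0 \<and> w mod 16 = 11 \<and> w div 16 = t_lft (cols x) (v div 16) \<or>
    v mod 16 = 2 \<and> w mod 16 = 15 \<and> w div 16 = t_up (Suc (vars x)) (cols x) (v div 16) \<or>
    v mod 16 = 11 \<and> w mod 16 = 0 \<and> w div 16 = t_rgt (cols x) (v div 16) \<or>
    v mod 16 = 15 \<and> w mod 16 = 2 \<and> w div 16 = t_dn (Suc (vars x)) (cols x) (v div 16)"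

definition reduction :: "bool list \<Rightarrow> bool list" where
  "reduction x = map (matrix_code (red_size x) (red_adj x)) [0..<red_size x + 1 + red_size x * red_size x]"

lemma cols_pos: "0 < cols x"
  by (simp add: cols_def cells_def)

lemma reduction_correct:
  "reduction x \<in> cubic_lucky_problem \<longleftrightarrow> (\<exists>u. length u \<le> poly p (length x) \<and> accepts M [x, u])"
proof -
  let ?R = "Suc (vars x)" and ?W = "cols x"
  interpret G: cell_graph "?R * ?W" "t_rgt ?W" "t_lft ?W" "t_dn ?R ?W" "t_up ?R ?W" "ctype x"
    by (rule torus_cell_graph) (simp_all add: cols_pos)
  have adj: "red_adj x = G.adj"
  proof (intro ext)
    fix v w
    have t: "ctype x c = 0 \<or> ctype x c = 1 \<or> ctype x c = 2 \<or> ctype x c = 3" for c using G.ty[of c] by linarith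
    have "(ctype x c = 0 \<and> q \<in> intra 0 \<or> ctype x c = 1 \<and> q \<in> intra 1 \<or> ctype x c = 2 \<and> q \<in> intra 2 \<or>
        ctype x c = 3 \<and> q \<in> intra 3) \<longleftrightarrow> q \<in> intra (ctype x c)" for c q
      using t[of c] by (elim disjE) simp_all
    then show "red_adj x v w = G.adj v w"
      unfolding red_adj_def G.adj_def by (subst G.nb_mem_iff) simp_all
  qed
  have "reduction x \<in> cubic_lucky_problem \<longleftrightarrow> (\<exists>b. cubic_lucky_2 (16 * (?R * ?W)) G.adj b)"
    unfolding reduction_def matrix_code_in_problem adj red_size_def ..
  also have "\<dots> \<longleftrightarrow> (\<exists>b. G.lucky_bits b)"
    unfolding G.cubic_lucky_2_exists_iff using cols_pos by simp
  also have "\<dots> \<longleftrightarrow> (\<exists>\<alpha>. \<forall>j<cols x. active x j \<longrightarrow> (\<exists>v<vars x. mem x v j \<and> \<alpha> v = (j < cells x)))"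
    unfolding G.lucky_bits_exists_iff by (rule torus_sat_iff[OF cols_pos])
  also have "\<dots> \<longleftrightarrow> (\<exists>u. length u \<le> cert x \<and> fst (run M [x, u] (time x)) = tm_accept M)"
    unfolding clauses_satisfiable_iff
    by (rule accepting_iff_conflict_free[symmetric]) (simp add: time_def)
  also have "\<dots> \<longleftrightarrow> (\<exists>u. length u \<le> poly p (length x) \<and> accepts M [x, u])"
    by (rule accepted_iff[symmetric])
  finally show ?thesis .
qed

lemma computable_sizes:
  "computable d (\<lambda>z vs. cert (fst z))" "computable d (\<lambda>z vs. time (fst z))"
  "computable d (\<lambda>z vs. cells (fst z))" "computable d (\<lambda>z vs. vars (fst z))" "computable d (\<lambda>z vs. cols (fst z))"
  unfolding cols_def vars_def cells_def time_def cert_def by (intro computable_intros)+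

lemma decidable_conflict:
  assumes "computable d t" "computable d j" "computable d c" "computable d t'" "computable d j'" "computable d c'"
  shows "decidable d (\<lambda>z vs. conflict (fst z) (time (fst z)) (cert (fst z)) (t z vs) (j z vs) (c z vs)
    (t' z vs) (j' z vs) (c' z vs))"
  unfolding conflict_def
  by (intro computable_intros computable_sizes assms
      decidable_finite[OF finite_bad(2)] decidable_finite2[OF finite_bad(1)])

lemma decidable_var_conflict:
  assumes "computable d v" "computable d v'"
  shows "decidable d (\<lambda>z vs. var_conflict (fst z) (v z vs) (v' z vs))"
  unfolding var_conflict_def row_of_def pos_of_def
  by (intro decidable_conflict computable_intros computable_sizes assms)

lemma decidable_active:
  assumes "computable d j" shows "decidable d (\<lambda>z vs. active (fst z) (j z vs))"
  unfolding active_def by (intro decidable_var_conflict computable_intros computable_sizes assms)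

lemma decidable_mem:
  assumes "computable d v" "computable d j" shows "decidable d (\<lambda>z vs. mem (fst z) (v z vs) (j z vs))"
  unfolding mem_def by (intro computable_intros computable_sizes assms)

lemma computable_ctype:
  assumes "computable d c" shows "computable d (\<lambda>z vs. ctype (fst z) (c z vs))"
  unfolding cell_type_def
  by (intro decidable_active decidable_mem computable_intros computable_sizes assms)

lemma computable_torus:
  assumes "computable d c"
  shows "computable d (\<lambda>z vs. t_lft (cols (fst z)) (c z vs))" "computable d (\<lambda>z vs. t_rgt (cols (fst z)) (c z vs))"
    "computable d (\<lambda>z vs. t_up (Suc (vars (fst z))) (cols (fst z)) (c z vs))"
    "computable d (\<lambda>z vs. t_dn (Suc (vars (fst z))) (cols (fst z)) (c z vs))"
  unfolding t_lft_def t_rgt_def t_up_def t_dn_def Suc_eq_plus1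
  by (intro computable_intros computable_sizes assms)+

lemma decidable_red_adj:
  assumes "computable d v" "computable d w" shows "decidable d (\<lambda>z vs. red_adj (fst z) (v z vs) (w z vs))"
  unfolding red_adj_def
  by (intro computable_ctype computable_torus decidable_finite2[OF finite_intra] computable_intros assms)

lemma polytime_reduction: "polytime_computable reduction"
proof -
  have size: "computable d (\<lambda>z vs. red_size (fst z))" for d
    unfolding red_size_def Suc_eq_plus1 by (intro computable_intros computable_sizes)
  have "polytime_computable (\<lambda>x. map (matrix_code (red_size x) (red_adj x))
      [0..<red_size x + 1 + red_size x * red_size x])"
  proof (rule polytime_computable_I)
    show "computable 0 (\<lambda>z vs. red_size (fst z) + 1 + red_size (fst z) * red_size (fst z))"
      by (intro computable_intros size)
    show "decidable 1 (\<lambda>z vs. matrix_code (red_size (fst z)) (red_adj (fst z)) (hd vs))"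
      unfolding matrix_code_def by (intro decidable_red_adj computable_intros size) simp_all
  qed
  then show ?thesis by (simp add: reduction_def[abs_def])
qed

end

lemma cubic_lucky_problem_NP_hard:
  assumes "A \<in> NP" shows "polytime_reducible A cubic_lucky_problem"
proof -
  from assms obtain M and p r :: "nat poly" where M: "tm_wf M" "2 \<le> tm_tapes M"
    "\<forall>x u. halts_within M [x, u] (poly r (length x + length u))"
    and A: "\<forall>x. x \<in> A \<longleftrightarrow> (\<exists>u. length u \<le> poly p (length x) \<and> accepts M [x, u])"
    unfolding NP_def by blast
  interpret np_verifier M p r by unfold_locales (use M in auto)
  show ?thesis unfolding polytime_reducible_def
    using polytime_reduction reduction_correct A by blast
qed

theorem theorem2:
  shows "NP_complete (graph_problem (\<lambda>G. regular 3 G \<and> lucky_number G = 2))"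
  unfolding NP_complete_def using cubic_lucky_problem_in_NP cubic_lucky_problem_NP_hard by blast

end
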